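(* Let $a \geq 2$, $b \geq 1$, $k \geq 1$, and $l_j \geq 1$ for $j=1,\ldots,k$ be integers. Then there exists an I-isolated (in particular, F-isolated) smooth Fano polytope $P$ of dimension $n=a+2b-1+\sum_{j=1}^k l_j$ with $n+k+3$ vertices whose primitive relations are of the forms \begin{align*} v_1+\cdots+v_a+y_1+\cdots+y_b&=(a+b-1)t, \\ y_1+\cdots+y_b+z&=u_1+\cdots+u_b, \\ z+t&=0, \\ t+u_1+\cdots+u_b&=y_1+\cdots+y_b, \\ u_1+\cdots+u_b+v_1+\cdots+v_a&=(a+b-2)t, \\ w_{1,j}+\cdots+w_{l_j+1,j}&=\alpha_{1,j}+\cdots+\alpha_{l_j,j} \qquad (j=1,\ldots,k), \end{align*} where $$V(P)=\{v_1,\ldots,v_a,y_1,\ldots,y_b,z,t,u_1,\ldots,u_b\} \cup \bigcup_{j=1}^k \{w_{1,j},\ldots,w_{l_j+1,j}\}$$ and $\{\alpha_{i,j} : 1 \leq i \leq l_j,\ 1 \leq j \leq k\} = \{y_q,u_q : 1 \leq q \leq b\}$.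
   Context: A lattice $n$-polytope is an $n$-dimensional convex polytope $P\subset\mathbb{R}^n$ whose vertices lie in $\mathbb{Z}^n$; $V(P)$ denotes its vertex set. It is a smooth Fano $n$-polytope if the origin is in its interior and the vertex set of each facet of $P$ is a $\mathbb{Z}$-basis of $\mathbb{Z}^n$. Two lattice polytopes $Q,Q'\subset\mathbb{R}^n$ are unimodularly equivalent if there is an affine map $\phi:\mathbb{R}^n\to\mathbb{R}^n$ with $\phi(\mathbb{Z}^n)=\mathbb{Z}^n$ and $\phi(Q)=Q'$. $\mathcal{F}(n)$ denotes the set of smooth Fano $n$-polytopes up to unimodular equivalence. F-equivalence: smooth Fano $n$-polytopes $P$ and $Q$ are F-equivalent if there is a sequence $P_0,P_1,\ldots,P_m$ of smooth Fano $n$-polytopes such that: (A) $P$ and $Q$ are unimodularly equivalent to $P_0$ and $P_m$, respectively; (B) for each $1\le i\le m$, for some lattice point $w$, either $V(P_i)=V(P_{i-1})\cup\{w\}$ with $w\notin V(P_{i-1})$, or $V(P_{i-1})=V(P_i)\cup\{w\}$ with $w\notin V(P_i)$; (C) if $w\in V(P_i)\setminus V(P_{i-1})$, then there is a proper face $F$ of $P_{i-1}$ such that $w=\sum_{v\in V(F)}v$ and the set of facets of $P_i$ containing $w$ equals $\{\mathrm{conv}(\{w\}\cup(V(F')\setminus\{v\})) : F' \text{ a facet of } P_{i-1},\ F\subset F',\ v\in V(F)\}$ (that is, $P_i$ is obtained from $P_{i-1}$ by a stellar subdivision with $w$); if $w\in V(P_{i-1})\setminus V(P_i)$, the same condition holds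 with the roles of $P_{i-1}$ and $P_i$ exchanged. I-equivalence: $P$ and $Q$ are I-equivalent if there is a sequence of smooth Fano $n$-polytopes satisfying (A) and (B) (but not necessarily (C)). A smooth Fano $n$-polytope $P$ is F-isolated (resp. I-isolated) if no $P'\in\mathcal{F}(n)\setminus\{P\}$ is F-equivalent (resp. I-equivalent) to $P$; i.e. every smooth Fano $n$-polytope F-equivalent (resp. I-equivalent) to $P$ is unimodularly equivalent to $P$. Primitive collections and relations: a nonempty subset $A\subset V(P)$ is a primitive collection of $P$ if $\mathrm{conv}(A)$ is not a proper face of $P$ but, for every $x\in A$, $A\setminus\{x\}$ is the vertex set of a proper (possibly empty) face of $P$. If $A=\{x_1,\ldots,x_l\}$ is a primitive collection, then either $x_1+\cdots+x_l=0$, or there is a unique proper face of $P$ with vertices $y_1,\ldots,y_m$ such that $x_1+\cdots+x_l=a_1y_1+\cdots+a_my_m$ with all $a_i\in\mathbb{Z}_{>0}$. This relation ($x_1+\cdots+x_l=0$, or $x_1+\cdots+x_l=a_1y_1+\cdots+a_my_m$) is the primitive relation for $A$. The primitive relations in $P$ are the primitive relations for all primitive collections of $P$. If some of the terms $\alpha_{1,j},\ldots,\alpha_{l_j,j}$ coincide, the right-hand side $\alpha_{1,j}+\cdots+\alpha_{l_j,j}$ is read after collecting equal terms with multiplicity.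
   Formalization: The formal theorem adds the hypothesis 2b ≤ l_1+…+l_k; without it the claim fails, since the n+k+3 vertices force the y_q, u_q to be 2b distinct points, while {α_{i,j}} has at most l_1+…+l_k elements (e.g. a=2, b=k=l_1=1). *)

theory Defs
  imports "HOL-Analysis.Analysis" "HOL-Library.Multiset"
begin

definition int_lattice :: "(real ^ 'n) set" where
  "int_lattice = {x. \<forall>i. x $ i \<in> \<int>}"

definition vertices :: "(real ^ 'n) set \<Rightarrow> (real ^ 'n) set" where
  "vertices P = {x. x extreme_point_of P}"

(* Proper faces may be empty. *)
definition proper_face_of :: "(real ^ 'n) set \<Rightarrow> (real ^ 'n) set \<Rightarrow> bool"
    (infix "proper'_face'_of" 50) where
  "F proper_face_of P \<longleftrightarrow> F face_of P \<and> F \<noteq> P"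

definition lattice_polytope :: "(real ^ 'n) set \<Rightarrow> bool" where
  "lattice_polytope P \<longleftrightarrow>
     polytope P \<and> aff_dim P = int CARD('n) \<and> vertices P \<subseteq> int_lattice"

definition is_lattice_basis :: "(real ^ 'n) set \<Rightarrow> bool" where
  "is_lattice_basis B \<longleftrightarrow>
     finite B \<and> B \<subseteq> int_lattice \<and>
     (\<forall>c :: real ^ 'n \<Rightarrow> int. (\<Sum>v\<in>B. of_int (c v) *\<^sub>R v) = 0 \<longrightarrow> (\<forall>v\<in>B. c v = 0)) \<and>
     (\<forall>x\<in>int_lattice. \<exists>c :: real ^ 'n \<Rightarrow> int. x = (\<Sum>v\<in>B. of_int (c v) *\<^sub>R v))"

definition smooth_fano :: "(real ^ 'n) set \<Rightarrow> bool" where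
  "smooth_fano P \<longleftrightarrow>
     lattice_polytope P \<and> 0 \<in> interior P \<and>
     (\<forall>F. F facet_of P \<longrightarrow> is_lattice_basis (vertices F))"

definition unimodularly_equivalent :: "(real ^ 'n) set \<Rightarrow> (real ^ 'n) set \<Rightarrow> bool" where
  "unimodularly_equivalent Q Q' \<longleftrightarrow>
     (\<exists>f c. linear f \<and> (\<lambda>x. f x + c) ` int_lattice = int_lattice \<and> (\<lambda>x. f x + c) ` Q = Q')"

definition I_step :: "(real ^ 'n) set \<Rightarrow> (real ^ 'n) set \<Rightarrow> bool" where
  "I_step P Q \<longleftrightarrow>
     (\<exists>w\<in>int_lattice.
        w \<notin> vertices P \<and> vertices Q = vertices P \<union> {w} \<or>
        w \<notin> vertices Q \<and> vertices P = vertices Q \<union> {w})"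

(* Q arises from P by a stellar subdivision with new vertex w. *)
definition stellar_subdivision ::
    "(real ^ 'n) set \<Rightarrow> real ^ 'n \<Rightarrow> (real ^ 'n) set \<Rightarrow> bool" where
  "stellar_subdivision P w Q \<longleftrightarrow>
     (\<exists>F. F proper_face_of P \<and> w = \<Sum>(vertices F) \<and>
        {G. G facet_of Q \<and> w \<in> G} =
        {convex hull ({w} \<union> (vertices F' - {v})) | F' v.
           F' facet_of P \<and> F \<subseteq> F' \<and> v \<in> vertices F})"

definition F_step :: "(real ^ 'n) set \<Rightarrow> (real ^ 'n) set \<Rightarrow> bool" where
  "F_step P Q \<longleftrightarrow>
     I_step P Q \<and>
     (\<forall>w \<in> vertices Q - vertices P. stellar_subdivision P w Q) \<and>
     (\<forall>w \<in> vertices P - vertices Q. stellar_subdivision Q w P)"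

definition I_equivalent :: "(real ^ 'n) set \<Rightarrow> (real ^ 'n) set \<Rightarrow> bool" where
  "I_equivalent P Q \<longleftrightarrow>
     smooth_fano P \<and> smooth_fano Q \<and>
     (\<exists>(m::nat) R. (\<forall>i\<le>m. smooth_fano (R i)) \<and>
        unimodularly_equivalent P (R 0) \<and> unimodularly_equivalent Q (R m) \<and>
        (\<forall>i\<in>{1..m}. I_step (R (i - 1)) (R i)))"

definition F_equivalent :: "(real ^ 'n) set \<Rightarrow> (real ^ 'n) set \<Rightarrow> bool" where
  "F_equivalent P Q \<longleftrightarrow>
     smooth_fano P \<and> smooth_fano Q \<and>
     (\<exists>(m::nat) R. (\<forall>i\<le>m. smooth_fano (R i)) \<and>
        unimodularly_equivalent P (R 0) \<and> unimodularly_equivalent Q (R m) \<and>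
        (\<forall>i\<in>{1..m}. F_step (R (i - 1)) (R i)))"

definition I_isolated :: "(real ^ 'n) set \<Rightarrow> bool" where
  "I_isolated P \<longleftrightarrow>
     smooth_fano P \<and>
     (\<forall>P'. smooth_fano P' \<and> I_equivalent P' P \<longrightarrow> unimodularly_equivalent P' P)"

definition F_isolated :: "(real ^ 'n) set \<Rightarrow> bool" where
  "F_isolated P \<longleftrightarrow>
     smooth_fano P \<and>
     (\<forall>P'. smooth_fano P' \<and> F_equivalent P' P \<longrightarrow> unimodularly_equivalent P' P)"

definition primitive_collection :: "(real ^ 'n) set \<Rightarrow> (real ^ 'n) set \<Rightarrow> bool" where
  "primitive_collection P A \<longleftrightarrow>
     A \<noteq> {} \<and> A \<subseteq> vertices P \<and> \<not> (convex hull A) proper_face_of P \<and>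
     (\<forall>x\<in>A. \<exists>F. F proper_face_of P \<and> vertices F = A - {x})"

(* The relation x_1 + ... + x_l = a_1 y_1 + ... + a_m y_m is encoded as the pair of the set
   {x_1, ..., x_l} and the multiset containing each y_i exactly a_i times. *)
definition primitive_relations :: "(real ^ 'n) set \<Rightarrow> ((real ^ 'n) set \<times> (real ^ 'n) multiset) set" where
  "primitive_relations P =
     {(A, M). primitive_collection P A \<and>
        (\<Sum>A = 0 \<and> M = {#} \<or>
         \<Sum>A \<noteq> 0 \<and> (\<exists>F. F proper_face_of P \<and> vertices F = set_mset M \<and> \<Sum>A = \<Sum>\<^sub># M))}"

end

theory Submission
  imports Defs
begin

text \<open>
  The polytope is built from its relations. The vectors \<open>v\<^sub>i, y\<^sub>i, z, t,
  u\<^sub>i, w\<^sub>i\<^sub>j\<close> are images of abstract labels under a map \<open>pt\<close>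
  that satisfies \<open>z = - t\<close>, \<open>\<Sum>u = \<Sum>y - t\<close>, \<open>\<Sum>v = (a
  + b - 1) t - \<Sum>y\<close> and \<open>\<Sum>\<^sub>i w\<^sub>i\<^sub>j = \<Sum>\<^sub>i
  \<alpha>\<^sub>i\<^sub>j\<close> and maps some of the labels to a lattice basis. A linear
  functional is then the same as a real-valued function on the labels that satisfies the relations
  (lemma \<open>functional\<close>), so that all questions about facets become small computations
  with such functions. The sets of labels that contain none of the intended primitive collections
  have an explicit list of maximal elements (lemma \<open>subset_fac\<close>). Each of these
  maximal sets is a lattice basis and has a functional that is one on it and at most zero on all
  other labels. As all relations have positive degree, no facet of the convex hull
  \<open>P\<close> contains a primitive collection; so the maximal sets are exactly the vertex
  sets of the facets, \<open>P\<close> is a smooth Fano polytope, and its primitive relations are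
  the intended ones (\<open>smooth_fano_P\<close>, \<open>primitive_relations_P\<close>).

  For I-isolation, let \<open>Q\<close> be a smooth Fano polytope.

  Suppose that \<open>Q\<close> has one vertex \<open>x\<close> more than \<open>P\<close>. No
  normal of a facet of \<open>P\<close> has the value one on \<open>x\<close>, because otherwise
  some facet of \<open>Q\<close> would have too many vertices. If the normals \<open>c\<close>,
  \<open>c'\<close> of two adjacent facets take values on different sides of one, the point
  between them with value one is the normal of a facet of \<open>Q\<close>, hence integral; if the
  relation of the wall between the facets has degree one, the segment from \<open>c\<close> to
  \<open>c'\<close> contains no integral point besides its ends, which is a contradiction. Walls
  of degree one connect all facets that do not contain both the block \<open>v\<close> and
  \<open>z\<close>. So the normals of all these facets are on the same side. They cannot all
  exceed one on \<open>x\<close>, because \<open>t\<close> remains a vertex. If they are all at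
  most zero on \<open>x\<close>, then \<open>x\<close> lies in the cone over a facet that contains
  all \<open>v\<^sub>i\<close> and \<open>z\<close>, and a wall of degree two forces
  \<open>x\<close> to be a basis vector plus a multiple of \<open>z\<close>; but then some facet
  normal is one on \<open>x\<close>.

  Suppose that \<open>Q\<close> has one vertex \<open>x\<close> less than \<open>P\<close>. If
  \<open>x\<close> is \<open>z\<close> or one of the \<open>v\<^sub>i\<close> or
  \<open>w\<^sub>i\<^sub>j\<close>, some nonzero functional is nonnegative on all other vertices,
  so that the origin is not interior to \<open>Q\<close>. If \<open>x = t\<close>, the facet
  normals of \<open>Q\<close> violate \<open>\<Sum>v + \<Sum>y = (a + b - 1) t\<close>. If
  \<open>x\<close> is one of the \<open>y\<^sub>i\<close> or \<open>u\<^sub>i\<close>, it occurs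
  on the right of a relation of degree one inside the blocks \<open>y, z, t, u\<close> and, since
  every \<open>y\<^sub>i\<close> and \<open>u\<^sub>i\<close> is among the
  \<open>\<alpha>\<^sub>i\<^sub>j\<close>, also on the right of a relation for some
  \<open>w\<^sub>j\<close>; eliminating \<open>x\<close> between the two leaves a relation of
  degree at most zero whose right-hand side lies in a facet of \<open>Q\<close>, which is
  impossible (lemma \<open>vertex_not_removable\<close>).

  A polytope equivalent to \<open>P\<close> is the image of the same labels under another map of
  this kind, so it has no neighbour either, and a sequence of I-steps that ends at it has length
  zero.
\<close>

section \<open>Lattice bases\<close>

lemma axis_in_int_lattice: "axis i (1::real) \<in> int_lattice"
  by (auto simp: int_lattice_def axis_def)

lemma int_lattice_inner:
  assumes "x \<in> int_lattice" "y \<in> int_lattice"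
  shows "x \<bullet> y \<in> \<int>"
  using assms by (auto simp: int_lattice_def inner_vec_def intro!: Ints_sum Ints_mult)

lemma int_lattice_sum:
  assumes "\<And>v. v \<in> B \<Longrightarrow> f v \<in> int_lattice"
  shows "sum f B \<in> int_lattice"
  using assms by (auto simp: int_lattice_def intro!: Ints_sum)

lemma int_latticeI_inner:
  assumes "\<And>y. y \<in> int_lattice \<Longrightarrow> x \<bullet> y \<in> \<int>"
  shows "x \<in> int_lattice"
  using assms[OF axis_in_int_lattice] by (auto simp: int_lattice_def inner_axis)

text \<open>The coefficients of the coordinate vectors with respect to the basis form the inverse
  of the matrix of basis vectors; its columns are the dual basis. In particular a
  \<open>\<int>\<close>-independent generating set is also linearly independent over the
  reals.\<close>

lemma lattice_basis_dual:
  assumes B: "is_lattice_basis B" and b: "b \<in> B"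
  obtains m where "m \<in> int_lattice" "m \<bullet> b = 1" "\<And>b'. b' \<in> B \<Longrightarrow> b' \<noteq> b \<Longrightarrow> m \<bullet> b' = 0"
proof -
  have fin: "finite B" and sub: "B \<subseteq> int_lattice"
    and ind: "\<And>c :: real^'a \<Rightarrow> int. (\<Sum>v\<in>B. of_int (c v) *\<^sub>R v) = 0 \<Longrightarrow> \<forall>v\<in>B. c v = 0"
    and span: "\<And>x. x \<in> int_lattice \<Longrightarrow> \<exists>c :: real^'a \<Rightarrow> int. x = (\<Sum>v\<in>B. of_int (c v) *\<^sub>R v)"
    using B unfolding is_lattice_basis_def by blast+
  have "\<forall>i. \<exists>c :: real^'a \<Rightarrow> int. axis i 1 = (\<Sum>v\<in>B. of_int (c v) *\<^sub>R v)"
    using span axis_in_int_lattice by blast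
  then obtain C :: "'a \<Rightarrow> real^'a \<Rightarrow> int"
    where C: "\<And>i. axis i 1 = (\<Sum>v\<in>B. of_int (C i v) *\<^sub>R v)" by metis
  define m :: "real^'a" where "m = (\<chi> i. of_int (C i b))"
  have val: "m \<bullet> b' = (if b' = b then 1 else 0)" if b': "b' \<in> B" for b'
  proof -
    define k where "k i = \<lfloor>b' $ i\<rfloor>" for i
    have k: "of_int (k i) = b' $ i" for i
    proof -
      have "b' $ i \<in> \<int>" using sub b' by (auto simp: int_lattice_def)
      then show ?thesis by (auto simp: k_def elim!: Ints_cases)
    qed
    define d where "d v = (\<Sum>i\<in>UNIV. k i * C i v) - (if v = b' then 1 else 0)" for v
    have "b' = (\<Sum>i\<in>UNIV. (b' $ i) *\<^sub>R axis i 1)"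
      using basis_expansion[of b'] by (simp add: scalar_mult_eq_scaleR)
    also have "\<dots> = (\<Sum>i\<in>UNIV. \<Sum>v\<in>B. (of_int (k i) * of_int (C i v)) *\<^sub>R v)"
      by (simp add: C scaleR_sum_right k)
    also have "\<dots> = (\<Sum>v\<in>B. (\<Sum>i\<in>UNIV. of_int (k i) * of_int (C i v)) *\<^sub>R v)"
      by (subst sum.swap) (simp add: scaleR_sum_left)
    finally have e: "(\<Sum>v\<in>B. (\<Sum>i\<in>UNIV. of_int (k i) * of_int (C i v)) *\<^sub>R v) = b'" by simp
    have "(\<Sum>v\<in>B. (if v = b' then 1 else 0 :: real) *\<^sub>R v) = b'"
      using fin b' by (simp add: if_distrib[of "\<lambda>t. t *\<^sub>R _"] cong: if_cong)
    then have "(\<Sum>v\<in>B. of_int (d v) *\<^sub>R v) = 0"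
      using e by (simp add: d_def scaleR_diff_left sum_subtractf)
        (simp add: if_distrib[of "\<lambda>t. t *\<^sub>R _"] if_distrib[of of_int] cong: if_cong)
    then have "d b = 0" using ind b by blast
    then have "real_of_int (\<Sum>i\<in>UNIV. k i * C i b) = (if b = b' then 1 else 0)"
      by (auto simp: d_def split: if_splits)
    then show ?thesis
      by (auto simp: m_def inner_vec_def k mult.commute split: if_splits)
  qed
  show thesis
    by (rule that[of m]) (use val b in \<open>auto simp: m_def int_lattice_def\<close>)
qed

lemma inner_dual_combination:
  assumes "finite B" "b \<in> B" "m \<bullet> b = 1" "\<And>b'. b' \<in> B \<Longrightarrow> b' \<noteq> b \<Longrightarrow> m \<bullet> b' = 0"
  shows "m \<bullet> (\<Sum>v\<in>B. r v *\<^sub>R v) = (r b :: real)"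
proof -
  have "m \<bullet> (\<Sum>v\<in>B. r v *\<^sub>R v) = (\<Sum>v\<in>B. if v = b then r b else 0)"
    unfolding inner_sum_right using assms by (intro sum.cong) auto
  then show ?thesis using assms by simp
qed

lemma lattice_basis_independent:
  assumes B: "is_lattice_basis B"
  shows "independent B"
proof -
  have fin: "finite B" using B by (simp add: is_lattice_basis_def)
  show ?thesis
  proof (rule independent_if_scalars_zero[OF fin])
    fix u x assume u: "(\<Sum>v\<in>B. u v *\<^sub>R v) = 0" and x: "x \<in> B"
    obtain m where m: "m \<bullet> x = 1" "\<And>b'. b' \<in> B \<Longrightarrow> b' \<noteq> x \<Longrightarrow> m \<bullet> b' = 0"
      using lattice_basis_dual[OF B x] by metis
    show "u x = 0" using inner_dual_combination[OF fin x m, of u] u by simp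
  qed
qed

lemma lattice_basis_span:
  fixes B :: "(real^'n) set"
  assumes B: "is_lattice_basis B"
  shows "span B = UNIV"
proof -
  have "axis i 1 \<in> span B" for i :: 'n
  proof -
    obtain c :: "real^'n \<Rightarrow> int" where "axis i 1 = (\<Sum>v\<in>B. of_int (c v) *\<^sub>R v)"
      using B axis_in_int_lattice unfolding is_lattice_basis_def by blast
    then show ?thesis by (simp add: span_sum span_base span_scale)
  qed
  then have "(\<Sum>i\<in>UNIV. (x $ i) *\<^sub>R axis i 1) \<in> span B" for x :: "real^'n"
    by (intro span_sum span_scale)
  moreover have e: "(\<Sum>i\<in>UNIV. (x $ i) *\<^sub>R axis i 1) = x" for x :: "real^'n"
    using basis_expansion[of x] by (simp add: scalar_mult_eq_scaleR)
  ultimately have "x \<in> span B" for x by (simp only: e)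
  then show ?thesis by blast
qed

lemma lattice_basis_card:
  fixes B :: "(real^'n) set"
  assumes B: "is_lattice_basis B"
  shows "card B = CARD('n)"
proof -
  have "dim (UNIV :: (real^'n) set) = card B"
    by (rule dim_eq_card[OF _ lattice_basis_independent[OF B]]) (simp add: lattice_basis_span[OF B])
  then show ?thesis by simp
qed

lemma lattice_basisI:
  fixes B :: "(real^'n) set"
  assumes fin: "finite B" and sub: "B \<subseteq> int_lattice" and card: "card B = CARD('n)"
    and dual: "\<And>b. b \<in> B \<Longrightarrow> \<exists>m\<in>int_lattice. m \<bullet> b = 1 \<and> (\<forall>b'\<in>B. b' \<noteq> b \<longrightarrow> m \<bullet> b' = 0)"
  shows "is_lattice_basis B"
proof -
  obtain m where m: "\<And>b. b \<in> B \<Longrightarrow> m b \<in> int_lattice \<and> m b \<bullet> b = 1"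
    "\<And>b b'. b \<in> B \<Longrightarrow> b' \<in> B \<Longrightarrow> b' \<noteq> b \<Longrightarrow> m b \<bullet> b' = 0"
    using dual by metis
  have coeff: "m b \<bullet> (\<Sum>v\<in>B. r v *\<^sub>R v) = r b" if "b \<in> B" for b r
    by (rule inner_dual_combination) (use that fin m in auto)
  have "independent B"
  proof (rule independent_if_scalars_zero[OF fin])
    fix u x assume "(\<Sum>v\<in>B. u v *\<^sub>R v) = 0" "x \<in> B"
    then show "u x = 0" using coeff[of x u] by simp
  qed
  moreover have "dim (UNIV :: (real^'n) set) \<le> card B" using card by simp
  ultimately have "UNIV \<subseteq> span B" using card_ge_dim_independent[OF subset_UNIV] by blast
  then have span: "span B = UNIV" by (simp add: top.extremum_uniqueI)
  show ?thesis
    unfolding is_lattice_basis_def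
  proof (intro conjI allI impI ballI)
    fix c :: "real^'n \<Rightarrow> int" and v assume "(\<Sum>v\<in>B. of_int (c v) *\<^sub>R v) = 0" "v \<in> B"
    then show "c v = 0" using coeff[of v "\<lambda>v. of_int (c v)"] by simp
  next
    fix x :: "real^'n" assume x: "x \<in> int_lattice"
    obtain r where r: "x = (\<Sum>v\<in>B. r v *\<^sub>R v)"
      using span span_finite[OF fin] by (metis (no_types, lifting) UNIV_I imageE)
    have "r b \<in> \<int>" if "b \<in> B" for b
      using coeff[OF that, of r] int_lattice_inner[of "m b" x] m that x by (auto simp: r)
    then have "x = (\<Sum>v\<in>B. of_int \<lfloor>r v\<rfloor> *\<^sub>R v)" unfolding r by (intro sum.cong) auto
    then show "\<exists>c :: real^'n \<Rightarrow> int. x = (\<Sum>v\<in>B. of_int (c v) *\<^sub>R v)"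
      by (rule exI[of _ "\<lambda>v. \<lfloor>r v\<rfloor>"])
  qed (use fin sub in auto)
qed

section \<open>Facets of smooth Fano polytopes\<close>

lemma smooth_fanoD:
  fixes Q :: "(real^'n) set"
  assumes "smooth_fano Q"
  shows smooth_fano_polytope: "polytope Q"
    and smooth_fano_lattice_vertices: "vertices Q \<subseteq> int_lattice"
    and smooth_fano_interior: "0 \<in> interior Q"
    and smooth_fano_facet_basis: "F facet_of Q \<Longrightarrow> is_lattice_basis (vertices F)"
  using assms by (auto simp: smooth_fano_def lattice_polytope_def)

lemma polytope_eq_hull_vertices:
  fixes Q :: "(real^'n) set"
  assumes "polytope Q"
  shows "Q = convex hull (vertices Q)"
  unfolding vertices_def
  by (rule Krein_Milman_Minkowski) (use assms in \<open>auto simp: polytope_imp_compact polytope_imp_convex\<close>)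

lemma finite_vertices:
  fixes Q :: "(real^'n) set"
  assumes "polytope Q"
  shows "finite (vertices Q)"
  using assms extreme_points_of_convex_hull finite_subset
  unfolding polytope_def vertices_def by (metis (no_types))

lemma vertices_face:
  assumes "F face_of Q"
  shows "vertices F = vertices Q \<inter> F"
  using extreme_point_of_face[OF assms] by (auto simp: vertices_def)

lemma vertices_subset: "vertices Q \<subseteq> Q"
  by (auto simp: vertices_def extreme_point_of_def)

lemma inner_le_on_hull:
  assumes "\<And>v. v \<in> S \<Longrightarrow> c \<bullet> v \<le> t" "x \<in> convex hull S"
  shows "c \<bullet> x \<le> (t :: real)"
proof -
  have "convex hull S \<subseteq> {x. c \<bullet> x \<le> t}"
    by (rule hull_minimal) (use assms convex_halfspace_le in auto)
  then show ?thesis using assms by auto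
qed

definition facet_normal :: "(real^'n) set \<Rightarrow> (real^'n) set \<Rightarrow> real^'n \<Rightarrow> bool" where
  "facet_normal Q F c \<longleftrightarrow>
     F facet_of Q \<and> c \<in> int_lattice \<and> F = {x\<in>Q. c \<bullet> x = 1} \<and> (\<forall>x\<in>Q. c \<bullet> x \<le> 1)"

lemma facet_normal_vertices:
  assumes "facet_normal Q F c"
  shows "vertices F = {x\<in>vertices Q. c \<bullet> x = 1}"
  using assms vertices_face[of F Q] vertices_subset[of Q] facet_of_imp_face_of[of F Q]
  by (auto simp: facet_normal_def)

lemma facet_supporting_functional:
  fixes Q :: "(real^'n) set"
  assumes poly: "polyhedron Q" and int: "0 \<in> interior Q" and F: "F facet_of Q"
  obtains c where "F = {x\<in>Q. c \<bullet> x = 1}" "\<forall>x\<in>Q. c \<bullet> x \<le> 1"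
proof -
  have "F exposed_face_of Q"
    using exposed_face_of_polyhedron[OF poly] F facet_of_imp_face_of by blast
  moreover have "F \<noteq> {}" "F \<noteq> Q" using F by (auto simp: facet_of_def)
  ultimately obtain n \<beta> where n: "n \<noteq> 0" "Q \<subseteq> {x. n \<bullet> x \<le> \<beta>}" "F = Q \<inter> {x. n \<bullet> x = \<beta>}"
    unfolding exposed_face_of by blast
  have "interior Q \<subseteq> {x. n \<bullet> x < \<beta>}"
    using interior_mono[OF n(2)] interior_halfspace_le[OF n(1)] by auto
  then have pos: "\<beta> > 0" using int by auto
  show thesis by (rule that[of "(1/\<beta>) *\<^sub>R n"]) (use n pos in \<open>auto simp: field_simps\<close>)
qed

lemma smooth_fano_facet_normal:
  fixes Q :: "(real^'n) set"
  assumes Q: "smooth_fano Q" and F: "F facet_of Q"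
  obtains c where "facet_normal Q F c"
proof -
  have "polyhedron Q" using Q by (simp add: smooth_fano_polytope polytope_imp_polyhedron)
  then obtain c where c: "F = {x\<in>Q. c \<bullet> x = 1}" "\<forall>x\<in>Q. c \<bullet> x \<le> 1"
    using facet_supporting_functional[OF _ smooth_fano_interior[OF Q] F] by blast
  have one: "c \<bullet> v = 1" if "v \<in> vertices F" for v
    using that vertices_subset[of F] c by auto
  have basis: "is_lattice_basis (vertices F)" by (rule smooth_fano_facet_basis[OF Q F])
  have "c \<in> int_lattice"
  proof (rule int_latticeI_inner)
    fix y :: "real^'n" assume "y \<in> int_lattice"
    then obtain d :: "real^'n \<Rightarrow> int" where "y = (\<Sum>v\<in>vertices F. of_int (d v) *\<^sub>R v)"
      using basis unfolding is_lattice_basis_def by blast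
    then show "c \<bullet> y \<in> \<int>" by (auto simp: inner_sum_right one intro!: Ints_sum)
  qed
  with c F that show thesis by (auto simp: facet_normal_def)
qed

lemma facet_through_supporting:
  fixes Q :: "(real^'n) set"
  assumes Q: "smooth_fano Q" and le: "\<And>v. v \<in> vertices Q \<Longrightarrow> c \<bullet> v \<le> 1"
    and S: "S \<subseteq> vertices Q" "S \<noteq> {}" "\<And>v. v \<in> S \<Longrightarrow> c \<bullet> v = 1"
  obtains F where "F facet_of Q" "S \<subseteq> vertices F"
proof -
  have poly: "polyhedron Q" using Q by (simp add: smooth_fano_polytope polytope_imp_polyhedron)
  have leQ: "c \<bullet> x \<le> 1" if "x \<in> Q" for x
    using inner_le_on_hull[of "vertices Q" c 1 x] le that
      polytope_eq_hull_vertices[OF smooth_fano_polytope[OF Q]] by auto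
  have face: "(Q \<inter> {x. c \<bullet> x = 1}) face_of Q"
    by (rule face_of_Int_supporting_hyperplane_le)
      (use leQ Q in \<open>auto simp: smooth_fano_polytope polytope_imp_convex\<close>)
  moreover have "0 \<in> Q" using smooth_fano_interior[OF Q] interior_subset by blast
  then have "Q \<inter> {x. c \<bullet> x = 1} \<noteq> Q" by (metis (mono_tags, lifting) IntD2 inner_zero_right mem_Collect_eq zero_neq_one)
  moreover have "S \<subseteq> Q \<inter> {x. c \<bullet> x = 1}" using S vertices_subset[of Q] by auto
  ultimately obtain F where F: "F facet_of Q" "Q \<inter> {x. c \<bullet> x = 1} \<subseteq> F"
    using face_of_polyhedron_subset_facet[OF poly] S by (metis subset_empty)
  have "S \<subseteq> vertices F"
    using vertices_face[OF facet_of_imp_face_of[OF F(1)]] F(2) S \<open>S \<subseteq> Q \<inter> _\<close> by blast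
  with F that show thesis by blast
qed

text \<open>The cones over the facets cover the space: the ray from the interior point
  \<open>0\<close> through a point leaves the polytope in some facet.\<close>

lemma smooth_fano_cone:
  fixes Q :: "(real^'n) set"
  assumes Q: "smooth_fano Q"
  obtains F d where "F facet_of Q" "\<And>v. v \<in> vertices F \<Longrightarrow> 0 \<le> d v"
    "x = (\<Sum>v\<in>vertices F. d v *\<^sub>R v)"
proof -
  have pt: "polytope Q" by (rule smooth_fano_polytope[OF Q])
  have poly: "polyhedron Q" using pt by (rule polytope_imp_polyhedron)
  define y where "y = (if x = 0 then axis undefined 1 else x)"
  have "y \<noteq> 0" by (auto simp: y_def axis_eq_0_iff)
  then obtain e where e: "e > 0" "0 + e *\<^sub>R y \<in> frontier Q"
    using ray_to_frontier[of Q 0 y] smooth_fano_interior[OF Q] polytope_imp_bounded[OF pt] by metis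
  have "rel_frontier Q = frontier Q"
    using smooth_fano_interior[OF Q] by (metis empty_iff rel_frontier_nonempty_interior)
  then have "e *\<^sub>R y \<in> \<Union>{F. F facet_of Q}"
    using rel_frontier_of_polyhedron[OF poly] e by simp
  then obtain F where F: "F facet_of Q" "e *\<^sub>R y \<in> F" by blast
  have pF: "polytope F"
    using F(1) pt by (meson face_of_polytope_polytope facet_of_imp_face_of)
  have "e *\<^sub>R y \<in> convex hull (vertices F)"
    using F(2) polytope_eq_hull_vertices[OF pF] by simp
  then obtain d where d: "\<forall>v\<in>vertices F. 0 \<le> d v" "(\<Sum>v\<in>vertices F. d v *\<^sub>R v) = e *\<^sub>R y"
    unfolding convex_hull_finite[OF finite_vertices[OF pF]] by blast
  show thesis
  proof (cases "x = 0")
    case True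
    then show thesis by (intro that[OF F(1), of "\<lambda>_. 0"]) auto
  next
    case False
    have "x = (1/e) *\<^sub>R (\<Sum>v\<in>vertices F. d v *\<^sub>R v)" using False e by (simp add: d y_def)
    also have "\<dots> = (\<Sum>v\<in>vertices F. (d v / e) *\<^sub>R v)" by (simp add: scaleR_sum_right)
    finally show thesis
      by (intro that[OF F(1), of "\<lambda>v. d v / e"]) (use d e in auto)
  qed
qed

lemma facet_normal_cone:
  assumes "facet_normal Q F c"
  shows "c \<bullet> (\<Sum>v\<in>vertices F. d v *\<^sub>R v) = (\<Sum>v\<in>vertices F. d v)"
  using facet_normal_vertices[OF assms] by (auto simp: inner_sum_right intro!: sum.cong)

lemma facet_normal_int_le:
  assumes "facet_normal Q F c" "v \<in> vertices Q"
  shows "c \<bullet> v \<le> 1"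
  using assms vertices_subset[of Q] by (auto simp: facet_normal_def)

lemma facet_normal_Ints:
  assumes "facet_normal Q F c" "x \<in> int_lattice"
  shows "c \<bullet> x \<in> \<int>"
  using assms int_lattice_inner by (auto simp: facet_normal_def)

text \<open>A nonzero lattice point is a nonnegative integer combination of the vertices of some
  facet, so the corresponding facet normal is at least one on it.\<close>

lemma lattice_interior_point:
  fixes Q :: "(real^'n) set"
  assumes Q: "smooth_fano Q" and x: "x \<in> int_lattice" "x \<in> interior Q"
  shows "x = 0"
proof (rule ccontr)
  assume nz: "x \<noteq> 0"
  obtain F d where F: "F facet_of Q" and d: "\<And>v. v \<in> vertices F \<Longrightarrow> 0 \<le> d v"
    "x = (\<Sum>v\<in>vertices F. d v *\<^sub>R v)" using smooth_fano_cone[OF Q] by metis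
  obtain c where c: "facet_normal Q F c" using smooth_fano_facet_normal[OF Q F] .
  have "0 \<le> c \<bullet> x" unfolding d(2) facet_normal_cone[OF c] using d(1) by (rule sum_nonneg)
  moreover have "c \<bullet> x \<noteq> 0"
  proof
    assume "c \<bullet> x = 0"
    then have "\<forall>v\<in>vertices F. d v = 0"
      using d(1) smooth_fano_facet_basis[OF Q F] unfolding d(2) facet_normal_cone[OF c]
      by (subst (asm) sum_nonneg_eq_0_iff) (auto simp: is_lattice_basis_def)
    with d(2) nz show False by simp
  qed
  moreover have "c \<bullet> x < 1"
  proof -
    have cnz: "c \<noteq> 0" using \<open>c \<bullet> x \<noteq> 0\<close> by auto
    have "Q \<subseteq> {x. c \<bullet> x \<le> 1}" using c by (auto simp: facet_normal_def)
    from interior_mono[OF this] show ?thesis using interior_halfspace_le[OF cnz, of 1] x(2) by auto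
  qed
  moreover obtain i where "c \<bullet> x = of_int i" using facet_normal_Ints[OF c x(1)] by (rule Ints_cases)
  ultimately show False by simp
qed

lemma basis_functional_eq:
  assumes B: "is_lattice_basis B" and eq: "\<And>b. b \<in> B \<Longrightarrow> c \<bullet> b = c' \<bullet> b"
  shows "c = c'"
proof -
  have "B \<subseteq> {x. (c - c') \<bullet> x = 0}" using eq by (auto simp: inner_diff_left)
  then have "span B \<subseteq> {x. (c - c') \<bullet> x = 0}" by (rule span_minimal[OF _ subspace_hyperplane])
  then have "(c - c') \<bullet> (c - c') = 0" unfolding lattice_basis_span[OF B] by blast
  then show ?thesis by simp
qed

lemma facet_normal_sum_le:
  assumes "facet_normal Q F c" "S \<subseteq> vertices Q"
  shows "c \<bullet> \<Sum>S \<le> real (card S)"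
proof -
  have "(\<Sum>v\<in>S. c \<bullet> v) \<le> (\<Sum>v\<in>S. 1)"
    by (rule sum_mono) (use assms facet_normal_int_le in blast)
  then show ?thesis by (simp add: inner_sum_right)
qed

lemma facet_normal_sum_eq:
  assumes "facet_normal Q F c" "S \<subseteq> vertices F" 
  shows "c \<bullet> \<Sum>S = real (card S)"
proof -
  have "(\<Sum>v\<in>S. c \<bullet> v) = (\<Sum>v\<in>S. 1)"
    by (rule sum.cong) (use assms(2) facet_normal_vertices[OF assms(1)] in auto)
  then show ?thesis by (simp add: inner_sum_right)
qed

lemma facet_normal_sum_max:
  fixes Q :: "(real^'n) set"
  assumes Q: "smooth_fano Q" and c: "facet_normal Q F c" and S: "S \<subseteq> vertices Q"
    and ge: "c \<bullet> \<Sum>S > real (card S) - 1"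
  shows "S \<subseteq> vertices F"
proof (rule ccontr)
  assume "\<not> S \<subseteq> vertices F"
  then obtain s where s: "s \<in> S" "s \<notin> vertices F" by blast
  have fin: "finite S" using S finite_vertices[OF smooth_fano_polytope[OF Q]] finite_subset by blast
  have "c \<bullet> s \<noteq> 1" "c \<bullet> s \<le> 1" "c \<bullet> s \<in> \<int>"
    using s S facet_normal_vertices[OF c] facet_normal_int_le[OF c] facet_normal_Ints[OF c]
      smooth_fano_lattice_vertices[OF Q] by auto
  then have le0: "c \<bullet> s \<le> 0" by (auto elim!: Ints_cases)
  have "\<Sum>S = s + \<Sum>(S - {s})" using fin s by (simp add: sum.remove)
  then have "c \<bullet> \<Sum>S \<le> c \<bullet> \<Sum>(S - {s})" using le0 by (simp add: inner_add_right)
  also have "\<dots> \<le> real (card (S - {s}))" by (rule facet_normal_sum_le[OF c]) (use S in auto)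
  also have "\<dots> = real (card S) - 1"
    using fin s card_gt_0_iff[of S] by (subst card_Diff_singleton) (auto simp: of_nat_diff)
  finally show False using ge by simp
qed

section \<open>Adding a vertex\<close>

text \<open>If the value were one, the hyperplane of the facet \<open>G\<close> would support
  \<open>Q\<close> and contain \<open>x\<close> in addition to the vertices of \<open>G\<close>,
  which are already as many as the dimension.\<close>

lemma added_vertex_off_facets:
  fixes P :: "(real^'n) set"
  assumes P: "smooth_fano P" and Q: "smooth_fano Q"
    and V: "vertices Q = insert x (vertices P)" and x: "x \<notin> vertices P"
    and G: "facet_normal P G c"
  shows "c \<bullet> x \<noteq> 1"
proof
  assume one: "c \<bullet> x = 1"
  have G1: "c \<bullet> v = 1" "v \<in> vertices P" if "v \<in> vertices G" for v
    using that facet_normal_vertices[OF G] by auto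
  obtain F where F: "F facet_of Q" "insert x (vertices G) \<subseteq> vertices F"
  proof (rule facet_through_supporting[OF Q])
    show "c \<bullet> v \<le> 1" if "v \<in> vertices Q" for v
      using that one facet_normal_int_le[OF G] by (auto simp: V)
    show "insert x (vertices G) \<subseteq> vertices Q" using G1 by (auto simp: V)
    show "c \<bullet> v = 1" if "v \<in> insert x (vertices G)" for v using that one G1 by auto
  qed auto
  have bF: "is_lattice_basis (vertices F)" by (rule smooth_fano_facet_basis[OF Q F(1)])
  have bG: "is_lattice_basis (vertices G)"
    using smooth_fano_facet_basis[OF P] G by (auto simp: facet_normal_def)
  have "card (insert x (vertices G)) \<le> card (vertices F)"
    by (rule card_mono) (use F bF in \<open>auto simp: is_lattice_basis_def\<close>)
  moreover have "x \<notin> vertices G" using x G1 by auto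
  moreover have "finite (vertices G)" using bG by (simp add: is_lattice_basis_def)
  ultimately show False using lattice_basis_card[OF bF] lattice_basis_card[OF bG] by simp
qed

text \<open>Dually, \<open>P\<close> corresponds to its polar, with the facet normals as vertices,
  and adding the vertex \<open>x\<close> cuts the polar by the half-space of functionals that are
  at most one on \<open>x\<close>. The normals of two adjacent facets span an edge of the polar,
  of length \<open>1 - c' \<bullet> s\<close>. If they lie on different sides of the cut, the edge
  is truncated at an inner point, whose position is \<open>\<theta>\<close>. This point is the
  normal of a new facet and therefore integral, so that its distance from the ends of the edge is
  an integer.\<close>

lemma added_vertex_cuts_edge:
  fixes P :: "(real^'n) set"
  assumes P: "smooth_fano P" and Q: "smooth_fano Q"
    and V: "vertices Q = insert x (vertices P)" and x: "x \<notin> vertices P"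
    and G: "facet_normal P G c" and G': "facet_normal P G' c'"
    and s: "s \<in> vertices G" and R: "vertices G - {s} \<subseteq> vertices G'"
    and cut: "(c \<bullet> x - 1) * (c' \<bullet> x - 1) < 0"
  obtains \<theta> where "0 < \<theta>" "\<theta> < 1" "\<theta> * (1 - c' \<bullet> s) \<in> \<int>" "(1 - \<theta>) * (c \<bullet> x) + \<theta> * (c' \<bullet> x) = 1"
proof -
  define \<theta> where "\<theta> = (c \<bullet> x - 1) / (c \<bullet> x - c' \<bullet> x)"
  have \<theta>: "0 < \<theta>" "\<theta> < 1" "(1 - \<theta>) * (c \<bullet> x) + \<theta> * (c' \<bullet> x) = 1"
  proof -
    consider "c \<bullet> x > 1" "c' \<bullet> x < 1" | "c \<bullet> x < 1" "c' \<bullet> x > 1"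
      using cut by (auto simp: mult_less_0_iff)
    then have "0 < \<theta> \<and> \<theta> < 1 \<and> c \<bullet> x \<noteq> c' \<bullet> x"
      by cases (auto simp: \<theta>_def divide_simps)
    then have pos: "0 < \<theta>" "\<theta> < 1" and ne: "c \<bullet> x - c' \<bullet> x \<noteq> 0" by auto
    have "\<theta> * (c \<bullet> x - c' \<bullet> x) = c \<bullet> x - 1" using ne by (simp add: \<theta>_def)
    then show "(1 - \<theta>) * (c \<bullet> x) + \<theta> * (c' \<bullet> x) = 1" by (simp add: algebra_simps)
    show "0 < \<theta>" "\<theta> < 1" by (rule pos)+
  qed
  define n where "n = (1 - \<theta>) *\<^sub>R c + \<theta> *\<^sub>R c'"
  have n: "n \<bullet> v = (1 - \<theta>) * (c \<bullet> v) + \<theta> * (c' \<bullet> v)" for v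
    by (simp add: n_def inner_add_left)
  define S where "S = insert x (vertices G - {s})"
  have R': "c \<bullet> v = 1" "c' \<bullet> v = 1" "v \<in> vertices P" if "v \<in> vertices G - {s}" for v
    using that R facet_normal_vertices[OF G] facet_normal_vertices[OF G'] by auto
  have S1: "n \<bullet> v = 1" if "v \<in> S" for v
    using that \<theta>(3) R' by (auto simp: S_def n)
  obtain F where F: "F facet_of Q" "S \<subseteq> vertices F"
  proof (rule facet_through_supporting[OF Q])
    show "n \<bullet> v \<le> 1" if "v \<in> vertices Q" for v
    proof (cases "v = x")
      case True
      then show ?thesis using \<theta>(3) by (simp add: n)
    next
      case False
      then have "c \<bullet> v \<le> 1" "c' \<bullet> v \<le> 1"
        using that V facet_normal_int_le[OF G] facet_normal_int_le[OF G'] by auto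
      then have "(1 - \<theta>) * (c \<bullet> v) \<le> (1 - \<theta>) * 1" "\<theta> * (c' \<bullet> v) \<le> \<theta> * 1"
        using \<theta> by (auto intro!: mult_left_mono)
      then show ?thesis by (simp add: n)
    qed
    show "S \<subseteq> vertices Q" using R' by (auto simp: S_def V)
  qed (use S1 in \<open>auto simp: S_def\<close>)
  have bF: "is_lattice_basis (vertices F)" by (rule smooth_fano_facet_basis[OF Q F(1)])
  have bG: "is_lattice_basis (vertices G)"
    using smooth_fano_facet_basis[OF P] G by (auto simp: facet_normal_def)
  have "x \<notin> vertices G" using x facet_normal_vertices[OF G] by auto
  moreover have "finite (vertices G)" using bG by (simp add: is_lattice_basis_def)
  moreover have "card (vertices G) > 0" using s \<open>finite (vertices G)\<close> card_gt_0_iff by blast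
  ultimately have "card S = card (vertices F)"
    using lattice_basis_card[OF bF] lattice_basis_card[OF bG] s by (simp add: S_def)
  then have SF: "S = vertices F"
    using F(2) bF by (intro card_subset_eq) (auto simp: is_lattice_basis_def)
  obtain cF where cF: "facet_normal Q F cF" using smooth_fano_facet_normal[OF Q F(1)] .
  have "n = cF"
    by (rule basis_functional_eq[OF bF]) (use S1 SF facet_normal_vertices[OF cF] in auto)
  moreover have "s \<in> int_lattice"
    using s facet_normal_vertices[OF G] smooth_fano_lattice_vertices[OF P] by auto
  ultimately have "n \<bullet> s \<in> \<int>" using facet_normal_Ints[OF cF] by simp
  moreover have "n \<bullet> s = 1 - \<theta> * (1 - c' \<bullet> s)"
    using s facet_normal_vertices[OF G] by (simp add: n algebra_simps)
  ultimately have "\<theta> * (1 - c' \<bullet> s) \<in> \<int>" using Ints_diff[OF Ints_1, of "n \<bullet> s"] by simp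
  with \<theta> that show thesis by blast
qed

text \<open>The edge between the two normals has length one and so cannot be cut at an inner
  integral point.\<close>

lemma added_vertex_same_side:
  fixes P :: "(real^'n) set"
  assumes P: "smooth_fano P" and Q: "smooth_fano Q"
    and V: "vertices Q = insert x (vertices P)" and x: "x \<notin> vertices P"
    and G: "facet_normal P G c" and G': "facet_normal P G' c'"
    and s: "s \<in> vertices G" and R: "vertices G - {s} \<subseteq> vertices G'" and s0: "c' \<bullet> s = 0"
  shows "c \<bullet> x > 1 \<longleftrightarrow> c' \<bullet> x > 1"
proof (rule ccontr)
  assume "\<not> ?thesis"
  moreover have "c \<bullet> x \<noteq> 1" "c' \<bullet> x \<noteq> 1"
    using added_vertex_off_facets[OF P Q V x] G G' by blast+
  ultimately have "(c \<bullet> x - 1) * (c' \<bullet> x - 1) < 0" by (auto simp: mult_less_0_iff)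
  from added_vertex_cuts_edge[OF P Q V x G G' s R this] obtain \<theta> :: real
    where "0 < \<theta>" "\<theta> < 1" "\<theta> \<in> \<int>" using s0 by auto
  then show False by (auto elim!: Ints_cases)
qed

text \<open>If the normals of all facets through the vertex \<open>t\<close> were cut off,
  \<open>t\<close> would stop being a vertex. The witness is the facet whose cone contains
  \<open>N t - x\<close> for large \<open>N\<close>; it contains \<open>t\<close> because \<open>N
  t - x\<close> has almost the direction of \<open>t\<close>.\<close>

lemma added_vertex_keeps_vertex:
  fixes P :: "(real^'n) set"
  assumes P: "smooth_fano P" and Q: "smooth_fano Q"
    and V: "vertices Q = insert x (vertices P)" and t: "t \<in> vertices P"
  obtains G c where "facet_normal P G c" "t \<in> vertices G" "c \<bullet> x \<le> 1"
proof -
  have pQ: "polytope Q" and pP: "polytope P" using P Q smooth_fano_polytope by auto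
  obtain F where F: "F facet_of Q" "t \<in> F"
  proof -
    have "{t} face_of Q" using t V by (auto simp: face_of_singleton vertices_def)
    moreover have "{t} \<noteq> Q" using smooth_fano_interior[OF Q] by (metis empty_iff interior_singleton)
    ultimately show thesis
      using face_of_polyhedron_subset_facet[OF polytope_imp_polyhedron[OF pQ], of "{t}"] that by blast
  qed
  obtain cF where cF: "facet_normal Q F cF" using smooth_fano_facet_normal[OF Q F(1)] .
  have tF: "cF \<bullet> t = 1" using cF F(2) by (auto simp: facet_normal_def)
  have xF: "cF \<bullet> x \<le> 1" by (rule facet_normal_int_le[OF cF]) (simp add: V)
  have "\<forall>G. \<exists>c. G facet_of P \<longrightarrow> facet_normal P G c"
    using smooth_fano_facet_normal[OF P] by blast
  then obtain nf where nf: "\<And>G. G facet_of P \<Longrightarrow> facet_normal P G (nf G)" by metis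
  \<comment> \<open>With this choice a normal that is at most zero on \<open>t\<close> is at most \<open>N - 2\<close> on \<open>N t - x\<close>, whereas
    the normal of \<open>F\<close> shows that the coefficients of \<open>N t - x\<close> add up to at least \<open>N - 1\<close>.\<close>
  define N where "N = 2 + (\<Sum>G | G facet_of P. \<bar>nf G \<bullet> x\<bar>)"
  have N: "\<bar>nf G \<bullet> x\<bar> \<le> N - 2" if "G facet_of P" for G
    unfolding N_def using finite_polytope_facets[OF pP] that
    by (auto intro!: member_le_sum[of G "{G. G facet_of P}" "\<lambda>G. \<bar>nf G \<bullet> x\<bar>"])
  have N2: "N \<ge> 2" unfolding N_def by (simp add: sum_nonneg)
  obtain G d where G: "G facet_of P" and d: "\<And>v. v \<in> vertices G \<Longrightarrow> 0 \<le> d v"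
    "N *\<^sub>R t - x = (\<Sum>v\<in>vertices G. d v *\<^sub>R v)"
    using smooth_fano_cone[OF P, of "N *\<^sub>R t - x"] by blast
  have cG: "facet_normal P G (nf G)" by (rule nf[OF G])
  have "N - 1 \<le> cF \<bullet> (N *\<^sub>R t - x)" using tF xF by (simp add: inner_diff_right)
  also have "\<dots> = (\<Sum>v\<in>vertices G. d v * (cF \<bullet> v))" by (simp add: d(2) inner_sum_right)
  also have "\<dots> \<le> (\<Sum>v\<in>vertices G. d v * 1)"
    using d(1) facet_normal_int_le[OF cF] facet_normal_vertices[OF cG]
    by (intro sum_mono mult_left_mono) (auto simp: V)
  also have "\<dots> = nf G \<bullet> (N *\<^sub>R t - x)" unfolding d(2) facet_normal_cone[OF cG] by simp
  also have "\<dots> = N * (nf G \<bullet> t) - nf G \<bullet> x" by (simp add: inner_diff_right)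
  finally have key: "N - 1 \<le> N * (nf G \<bullet> t) - nf G \<bullet> x" .
  have "nf G \<bullet> t = 1"
  proof (rule ccontr)
    assume "nf G \<bullet> t \<noteq> 1"
    moreover have "nf G \<bullet> t \<le> 1" by (rule facet_normal_int_le[OF cG t])
    moreover have "nf G \<bullet> t \<in> \<int>"
      by (rule facet_normal_Ints[OF cG]) (use t smooth_fano_lattice_vertices[OF P] in auto)
    ultimately have "nf G \<bullet> t \<le> 0" by (auto elim!: Ints_cases)
    then have "N * (nf G \<bullet> t) \<le> 0" using N2 by (simp add: mult_le_0_iff)
    then show False using key N[OF G] by linarith
  qed
  then show thesis
    using that[OF cG] key t facet_normal_vertices[OF cG] by auto
qed

section \<open>Removing a vertex\<close>

lemma smooth_fano_nonneg_functional:
  fixes Q :: "(real^'n) set"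
  assumes Q: "smooth_fano Q" and c: "\<And>v. v \<in> vertices Q \<Longrightarrow> 0 \<le> c \<bullet> v"
  shows "c = 0"
proof (rule ccontr)
  assume nz: "c \<noteq> 0"
  have "Q \<subseteq> {x. (-c) \<bullet> x \<le> 0}"
    using inner_le_on_hull[of "vertices Q" "-c" 0] c
      polytope_eq_hull_vertices[OF smooth_fano_polytope[OF Q]] by auto
  from interior_mono[OF this] show False
    using interior_halfspace_le[of "-c" 0] nz smooth_fano_interior[OF Q] by auto
qed

text \<open>The first of the two relations of degree one with \<open>x\<close> on the right
  replaces \<open>x\<close>: after the removal, \<open>A\<close> together with the remaining terms
  \<open>E\<close> of the second relation must lie in one facet \<open>F\<close>, since otherwise
  a facet normal of \<open>P\<close> shows that the point \<open>\<Sum>A + \<Sum>E = \<Sum>M +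
  \<Sum>E\<close> can only be represented with the help of \<open>x\<close>. Substituting the
  first relation into the second lowers its degree, so that the normal of \<open>F\<close> forces
  all terms of \<open>W\<close> into \<open>F\<close> as well, which makes the vertices of
  \<open>F\<close> linearly dependent.\<close>

lemma vertex_not_removable:
  fixes P :: "(real^'n) set"
  assumes P: "smooth_fano P" and Q: "smooth_fano Q"
    and V: "vertices P = insert x (vertices Q)" and x: "x \<notin> vertices Q"
    and A: "A \<subseteq> vertices Q" "\<Sum>A = \<Sum>M" "card A = card M + 1" and xM: "x \<in> M"
    and W: "W \<subseteq> vertices Q" "\<Sum>W = sum f I" "card W = card I + 1" and I: "finite I" "x \<in> f ` I"
    and G: "G facet_of P" "M \<union> f ` I \<subseteq> vertices G"
    and w: "w \<in> W" "w \<notin> A" "w \<notin> M" "w \<notin> f ` I"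
  shows False
proof -
  have finP: "finite (vertices P)" using finite_vertices smooth_fano_polytope[OF P] by blast
  obtain cG where cG: "facet_normal P G cG" using smooth_fano_facet_normal[OF P G(1)] .
  have GP: "vertices G \<subseteq> vertices P" using facet_normal_vertices[OF cG] by auto
  have fin: "finite A" "finite M" "finite W"
    by (rule finite_subset[OF _ finP]; use A(1) W(1) G(2) GP V in blast)+
  \<comment> \<open>\<open>m\<close> is the multiplicity of \<open>x\<close> in the second relation; the other terms may be repeated, but for
    the choice of the facet only the set \<open>E\<close> of their values matters.\<close>
  define I0 where "I0 = {i\<in>I. f i = x}"
  define I1 where "I1 = {i\<in>I. f i \<noteq> x}"
  define E where "E = f ` I1"
  have E: "finite E" "x \<notin> E" "E \<subseteq> vertices G" "E \<subseteq> vertices Q"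
    using I G GP V by (auto simp: E_def I1_def)
  have Isplit: "I = I0 \<union> I1" "I0 \<inter> I1 = {}" "finite I0" "finite I1"
    using I by (auto simp: I0_def I1_def)
  define m where "m = card I0"
  have m: "m \<ge> 1" using I Isplit(3) card_gt_0_iff[of I0] by (auto simp: m_def I0_def)
  have cardI: "card I = m + card I1" using Isplit card_Un_disjoint m_def by metis
  have sumI: "sum f I = real m *\<^sub>R x + sum f I1"
  proof -
    have "sum f I = sum f I0 + sum f I1" using Isplit sum.union_disjoint by metis
    also have "sum f I0 = sum (\<lambda>_. x) I0" by (rule sum.cong) (auto simp: I0_def)
    finally show ?thesis by (simp only: m_def sum_constant_scaleR)
  qed
  define D where "D = \<Sum>A + \<Sum>E"
  obtain F d where F: "F facet_of Q" and d: "\<And>v. v \<in> vertices F \<Longrightarrow> 0 \<le> d v"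
    "D = (\<Sum>v\<in>vertices F. d v *\<^sub>R v)" using smooth_fano_cone[OF Q, of D] by blast
  obtain h where h: "facet_normal Q F h" using smooth_fano_facet_normal[OF Q F] .
  have FQ: "vertices F \<subseteq> vertices Q" using facet_normal_vertices[OF h] by auto
  have bF: "is_lattice_basis (vertices F)" by (rule smooth_fano_facet_basis[OF Q F])
  have bG: "is_lattice_basis (vertices G)" by (rule smooth_fano_facet_basis[OF P G(1)])
  have inF: "A \<subseteq> vertices F \<and> E \<subseteq> vertices F"
  proof (rule ccontr)
    assume no: "\<not> ?thesis"
    have hA: "h \<bullet> \<Sum>A \<le> card A" and hE: "h \<bullet> \<Sum>E \<le> card E"
      using facet_normal_sum_le[OF h A(1)] facet_normal_sum_le[OF h E(4)] by auto
    have "h \<bullet> \<Sum>A \<le> real (card A) - 1 \<or> h \<bullet> \<Sum>E \<le> real (card E) - 1"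
      using no facet_normal_sum_max[OF Q h A(1)] facet_normal_sum_max[OF Q h E(4)] by force
    then have "h \<bullet> D \<le> real (card M) + real (card E)"
      using hA hE A(3) by (auto simp: D_def inner_add_right)
    also have "\<dots> = cG \<bullet> D"
      using facet_normal_sum_eq[OF cG, of M] facet_normal_sum_eq[OF cG E(3)] G(2) A(2)
      by (simp add: D_def inner_add_right)
    finally have le: "(\<Sum>v\<in>vertices F. d v) \<le> (\<Sum>v\<in>vertices F. d v * (cG \<bullet> v))"
      unfolding d(2) facet_normal_cone[OF h] by (simp add: inner_sum_right)
    have nn: "0 \<le> d v * (1 - cG \<bullet> v)" if "v \<in> vertices F" for v
      using that d(1) facet_normal_int_le[OF cG, of v] FQ V by auto
    have "(\<Sum>v\<in>vertices F. d v * (1 - cG \<bullet> v)) \<le> 0"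
      using le by (simp add: right_diff_distrib sum_subtractf)
    moreover have "(\<Sum>v\<in>vertices F. d v * (1 - cG \<bullet> v)) \<ge> 0" by (rule sum_nonneg) (rule nn)
    ultimately have "(\<Sum>v\<in>vertices F. d v * (1 - cG \<bullet> v)) = 0" by simp
    then have z: "d v * (1 - cG \<bullet> v) = 0" if "v \<in> vertices F" for v
      using nn that bF by (subst (asm) sum_nonneg_eq_0_iff) (auto simp: is_lattice_basis_def)
    have xG: "x \<in> vertices G" using xM G by auto
    obtain \<mu> where \<mu>: "\<mu> \<bullet> x = 1" "\<And>b'. b' \<in> vertices G \<Longrightarrow> b' \<noteq> x \<Longrightarrow> \<mu> \<bullet> b' = 0"
      using lattice_basis_dual[OF bG xG] by metis
    have "\<mu> \<bullet> v = 0 \<or> d v = 0" if "v \<in> vertices F" for v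
    proof (cases "d v = 0")
      case False
      then have "cG \<bullet> v = 1" using z[OF that] by simp
      then have "v \<in> vertices G" using that FQ V facet_normal_vertices[OF cG] by auto
      moreover have "v \<noteq> x" using that FQ x by auto
      ultimately show ?thesis using \<mu> by blast
    qed simp
    then have "\<mu> \<bullet> D = 0" unfolding d(2) inner_sum_right by (intro sum.neutral) auto
    moreover have "\<mu> \<bullet> \<Sum>E = 0" unfolding inner_sum_right
      by (rule sum.neutral) (use E \<mu> in auto)
    moreover have "\<mu> \<bullet> \<Sum>(M - {x}) = 0" unfolding inner_sum_right
      by (rule sum.neutral) (use G \<mu> in auto)
    moreover have "\<Sum>M = x + \<Sum>(M - {x})" using fin xM by (simp add: sum.remove)
    ultimately show False using A(2) \<mu>(1) by (simp add: D_def inner_add_right)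
  qed
  define M' where "M' = M - {x}"
  have M': "M' \<subseteq> vertices Q" using G GP V by (auto simp: M'_def)
  have sumM: "\<Sum>M = x + \<Sum>M'" using fin xM by (simp add: sum.remove M'_def)
  have cardM: "real (card M') = real (card M) - 1"
    using fin xM card_gt_0_iff[of M] unfolding M'_def
    by (subst card_Diff_singleton) (auto simp: of_nat_diff)
  \<comment> \<open>The second relation after elimination of \<open>x\<close>, of degree \<open>1 - m\<close>.\<close>
  have rel: "\<Sum>W + real m *\<^sub>R \<Sum>M' = real m *\<^sub>R \<Sum>A + sum f I1"
    unfolding W(2) sumI A(2) sumM by (simp add: algebra_simps)
  have hI1: "h \<bullet> sum f I1 = card I1"
  proof -
    have "(\<Sum>i\<in>I1. h \<bullet> f i) = (\<Sum>i\<in>I1. 1)"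
      by (rule sum.cong) (use inF facet_normal_vertices[OF h] in \<open>auto simp: E_def\<close>)
    then show ?thesis by (simp add: inner_sum_right)
  qed
  have hrel: "h \<bullet> \<Sum>W + m * (h \<bullet> \<Sum>M') = m * (real (card M) + 1) + card I1"
    using arg_cong[OF rel, of "\<lambda>z. h \<bullet> z"] facet_normal_sum_eq[OF h, of A] inF hI1 A(3)
    by (simp add: inner_add_right)
  have hW: "h \<bullet> \<Sum>W \<le> real m + card I1 + 1"
    using facet_normal_sum_le[OF h W(1)] W(3) cardI by simp
  have hM: "h \<bullet> \<Sum>M' \<le> real (card M) - 1" using facet_normal_sum_le[OF h M'] cardM by simp
  have "m * (h \<bullet> \<Sum>M') \<le> m * (real (card M) - 1)" using hM by (intro mult_left_mono) auto
  then have lower: "h \<bullet> \<Sum>W \<ge> 2 * real m + card I1" using hrel by (simp add: algebra_simps)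
  then have m1: "m = 1" using hW m by linarith
  have WF: "W \<subseteq> vertices F"
    by (rule facet_normal_sum_max[OF Q h W(1)]) (use lower W(3) cardI m1 in simp)
  have MF: "M' \<subseteq> vertices F"
  proof (rule facet_normal_sum_max[OF Q h M'])
    have "h \<bullet> \<Sum>W + h \<bullet> \<Sum>M' = real (card M) + 1 + card I1" using hrel unfolding m1 by simp
    moreover have "h \<bullet> \<Sum>W \<le> 1 + card I1 + 1" using hW unfolding m1 by simp
    ultimately show "h \<bullet> \<Sum>M' > real (card M') - 1" using cardM by linarith
  qed
  obtain \<mu> where \<mu>: "\<mu> \<bullet> w = 1" "\<And>b'. b' \<in> vertices F \<Longrightarrow> b' \<noteq> w \<Longrightarrow> \<mu> \<bullet> b' = 0"
    using lattice_basis_dual[OF bF subsetD[OF WF w(1)]] by metis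
  have "\<mu> \<bullet> \<Sum>(W - {w}) = 0" "\<mu> \<bullet> \<Sum>M' = 0" "\<mu> \<bullet> \<Sum>A = 0" "\<mu> \<bullet> sum f I1 = 0"
    unfolding inner_sum_right
    by (rule sum.neutral, use \<mu> WF MF inF w in \<open>force simp: M'_def E_def I1_def\<close>)+
  moreover have "\<Sum>W = w + \<Sum>(W - {w})" using fin w by (simp add: sum.remove)
  ultimately show False using arg_cong[OF rel, of "\<lambda>z. \<mu> \<bullet> z"] \<mu>(1) by (simp add: inner_add_right)
qed

section \<open>Unimodular equivalence\<close>

lemma unimodular_linear_part:
  fixes f :: "real^'n \<Rightarrow> real^'n"
  assumes f: "linear f" and L: "(\<lambda>x. f x + c) ` int_lattice = int_lattice"
  shows "c \<in> int_lattice" "f ` int_lattice = int_lattice" "bij f"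
proof -
  have add: "x + y \<in> int_lattice" "x - y \<in> int_lattice"
    if "x \<in> int_lattice" "y \<in> int_lattice" for x y :: "real^'n"
    using that by (auto simp: int_lattice_def)
  have "0 \<in> int_lattice" by (auto simp: int_lattice_def)
  then have "f 0 + c \<in> int_lattice" using L by blast
  then show c: "c \<in> int_lattice" using linear_0[OF f] by simp
  show fL: "f ` int_lattice = int_lattice"
  proof (intro subset_antisym subsetI)
    fix y assume "y \<in> f ` int_lattice"
    then obtain x where x: "x \<in> int_lattice" "y = f x" by blast
    then have "f x + c \<in> int_lattice" using L by blast
    then show "y \<in> int_lattice" using add(2)[OF _ c, of "f x + c"] x by simp
  next
    fix y :: "real^'n" assume "y \<in> int_lattice"
    then have "y + c \<in> (\<lambda>x. f x + c) ` int_lattice" unfolding L by (rule add[OF _ c])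
    then show "y \<in> f ` int_lattice" by auto
  qed
  have "y \<in> range f" for y
  proof -
    have "(\<Sum>i\<in>UNIV. (y $ i) *\<^sub>R axis i 1) \<in> range f"
    proof (intro subspace_sum subspace_scale)
      show "subspace (range f)" "subspace (range f)" by (rule linear_subspace_image[OF f subspace_UNIV])+
      show "axis i 1 \<in> range f" for i using axis_in_int_lattice fL by blast
    qed
    then show ?thesis using basis_expansion[of y] by (simp add: scalar_mult_eq_scaleR)
  qed
  then have "surj f" by blast
  then show "bij f" using linear_surjective_imp_injective[OF f] by (simp add: bij_def)
qed

lemma unimodularly_equivalent_sym:
  assumes "unimodularly_equivalent P R"
  shows "unimodularly_equivalent R P"
proof -
  obtain f c where f: "linear f" and L: "(\<lambda>x. f x + c) ` int_lattice = int_lattice"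
    and R: "(\<lambda>x. f x + c) ` P = R" using assms unfolding unimodularly_equivalent_def by blast
  have bij: "bij f" by (rule unimodular_linear_part[OF f L])
  define g where "g = inv f"
  have g: "linear g" "g (f x) = x" for x
    unfolding g_def using inj_linear_imp_inv_linear[OF f] bij by (auto simp: bij_is_inj)
  have inv: "(\<lambda>x. g x + (- g c)) ` (\<lambda>x. f x + c) ` S = S" for S
    by (simp add: image_image linear_add[OF g(1)] g(2))
  have "(\<lambda>x. g x + (- g c)) ` int_lattice = int_lattice" "(\<lambda>x. g x + (- g c)) ` R = P"
    using inv[of int_lattice] inv[of P] unfolding L R .
  with g(1) show ?thesis
    unfolding unimodularly_equivalent_def by blast
qed

lemma unimodularly_equivalent_trans:
  assumes "unimodularly_equivalent P R" "unimodularly_equivalent R S"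
  shows "unimodularly_equivalent P S"
proof -
  obtain f c where f: "linear f" "(\<lambda>x. f x + c) ` int_lattice = int_lattice" "(\<lambda>x. f x + c) ` P = R"
    using assms unfolding unimodularly_equivalent_def by blast
  obtain g d where g: "linear g" "(\<lambda>x. g x + d) ` int_lattice = int_lattice" "(\<lambda>x. g x + d) ` R = S"
    using assms unfolding unimodularly_equivalent_def by blast
  have comp: "(\<lambda>x. (g \<circ> f) x + (g c + d)) ` X = (\<lambda>x. g x + d) ` (\<lambda>x. f x + c) ` X" for X
    by (simp add: image_image linear_add[OF g(1)] add.assoc)
  show ?thesis
    unfolding unimodularly_equivalent_def
    using linear_compose[OF f(1) g(1)] comp[of int_lattice] comp[of P] f g by metis
qed

text \<open>The origin is the only lattice point in the interior of either polytope, so it is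
  preserved.\<close>

lemma unimodular_equivalence_linear:
  fixes P :: "(real^'n) set"
  assumes P: "smooth_fano P" and R: "smooth_fano R" and "unimodularly_equivalent P R"
  obtains f where "linear f" "bij f" "f ` int_lattice = int_lattice" "f ` P = R"
proof -
  obtain f c where f: "linear f" and L: "(\<lambda>x. f x + c) ` int_lattice = int_lattice"
    and R': "(\<lambda>x. f x + c) ` P = R" using assms unfolding unimodularly_equivalent_def by blast
  note lin = unimodular_linear_part[OF f L]
  have "R = (\<lambda>y. c + y) ` (f ` P)" using R' by (auto simp: image_image add.commute)
  then have "interior R = (\<lambda>y. c + y) ` (f ` interior P)"
    using interior_translation[of c "f ` P"] interior_injective_linear_image[OF f, of P] lin(3)
    by (simp add: bij_is_inj)
  then obtain p where p: "p \<in> interior P" "c + f p = 0"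
    using smooth_fano_interior[OF R] by (metis (no_types, lifting) imageE)
  have "- c \<in> int_lattice" using lin(1) by (auto simp: int_lattice_def)
  then have "- c \<in> f ` int_lattice" unfolding lin(2) .
  then obtain q where q: "q \<in> int_lattice" "- c = f q" by (elim imageE)
  have "f p = f q" using minus_unique[OF p(2)] q(2) by simp
  then have "p = q" using injD[OF bij_is_inj[OF lin(3)]] by blast
  with q have "p \<in> int_lattice" by simp
  then have "p = 0" using lattice_interior_point[OF P] p(1) by blast
  then have "c = 0" using p(2) linear_0[OF f] by simp
  with R' that[OF f lin(3,2)] show thesis by simp
qed

section \<open>The combinatorial configuration\<close>

text \<open>The vertices are treated abstractly, through labels, because the image of the polytope
  under a unimodular map has the same labels with different vectors.\<close>

datatype label = Lv nat | Ly nat | Lz | Lt | Lu nat | Lw nat nat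

text \<open>The five blocks \<open>v, y, z, t, u\<close> are arranged in a pentagon whose
  consecutive pairs are the primitive collections. A facet contains two non-adjacent blocks
  completely, which give the kind its name, and misses one element of each of the other
  three.\<close>

datatype kind = VZ | VT | YT | YU | ZU

fun omitted :: "kind \<Rightarrow> nat \<Rightarrow> nat \<Rightarrow> nat \<Rightarrow> label set" where
  "omitted VZ r p q = {Ly p, Lt, Lu q}"
| "omitted VT r p q = {Ly p, Lz, Lu q}"
| "omitted YT r p q = {Lv r, Lz, Lu q}"
| "omitted YU r p q = {Lv r, Lz, Lt}"
| "omitted ZU r p q = {Lv r, Lt, Ly p}"

locale configuration =
  fixes a b k :: nat and l :: "nat \<Rightarrow> nat" and al :: "nat \<Rightarrow> nat \<Rightarrow> label"
  assumes a2: "2 \<le> a" and b1: "1 \<le> b" and l1: "\<And>j. j \<in> {1..k} \<Longrightarrow> 1 \<le> l j"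
    and range_al: "{al i j | i j. i \<in> {1..l j} \<and> j \<in> {1..k}} = Ly ` {1..b} \<union> Lu ` {1..b}"
begin

definition labels :: "label set" where
  "labels = Lv ` {1..a} \<union> Ly ` {1..b} \<union> {Lz, Lt} \<union> Lu ` {1..b}
     \<union> (\<Union>j\<in>{1..k}. (\<lambda>i. Lw i j) ` {1..l j + 1})"

text \<open>The relations, solved for the sums over the blocks in the order \<open>z\<close>,
  \<open>u\<close>, \<open>v\<close>, \<open>w\<close>. They are stated for an arbitrary real
  vector space because they apply both to the vectors and to the values of functionals.\<close>

definition rel :: "(label \<Rightarrow> 'c::real_vector) \<Rightarrow> bool" where
  "rel g \<longleftrightarrow> g Lz = - g Lt \<and>
     (\<Sum>i=1..b. g (Lu i)) = (\<Sum>i=1..b. g (Ly i)) - g Lt \<and>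
     (\<Sum>i=1..a. g (Lv i)) = (real a + real b - 1) *\<^sub>R g Lt - (\<Sum>i=1..b. g (Ly i)) \<and>
     (\<forall>j\<in>{1..k}. (\<Sum>i=1..l j + 1. g (Lw i j)) = (\<Sum>i=1..l j. g (al i j)))"

definition base_prims :: "label set set" where
  "base_prims = {Lv ` {1..a} \<union> Ly ` {1..b}, Ly ` {1..b} \<union> {Lz}, {Lz, Lt},
     {Lt} \<union> Lu ` {1..b}, Lu ` {1..b} \<union> Lv ` {1..a}}"

definition wprim :: "nat \<Rightarrow> label set" where
  "wprim j = (\<lambda>i. Lw i j) ` {1..l j + 1}"

definition prims :: "label set set" where
  "prims = base_prims \<union> wprim ` {1..k}"

text \<open>The sets of vertices of the facets: besides the elements omitted from the pentagon,
  one element \<open>w\<^sub>i\<^sub>j\<close> is missing for each \<open>j\<close>, with \<open>i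
  = \<sigma> j\<close>.\<close>

definition fac :: "kind \<Rightarrow> nat \<Rightarrow> nat \<Rightarrow> nat \<Rightarrow> (nat \<Rightarrow> nat) \<Rightarrow> label set" where
  "fac K r p q \<sigma> = labels - omitted K r p q - (\<lambda>j. Lw (\<sigma> j) j) ` {1..k}"

text \<open>One tuple of indices serves all kinds, so that a facet and its neighbours can be
  described by nearly the same data.\<close>

definition valid :: "nat \<Rightarrow> nat \<Rightarrow> nat \<Rightarrow> (nat \<Rightarrow> nat) \<Rightarrow> bool" where
  "valid r p q \<sigma> \<longleftrightarrow> r \<in> {1..a} \<and> p \<in> {1..b} \<and> q \<in> {1..b} \<and> (\<forall>j\<in>{1..k}. \<sigma> j \<in> {1..l j + 1})"

lemma finite_labels: "finite labels"
  by (simp add: labels_def)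

lemma labels_iff:
  "Lv i \<in> labels \<longleftrightarrow> i \<in> {1..a}" "Ly i \<in> labels \<longleftrightarrow> i \<in> {1..b}" "Lz \<in> labels" "Lt \<in> labels"
  "Lu i \<in> labels \<longleftrightarrow> i \<in> {1..b}" "Lw i j \<in> labels \<longleftrightarrow> j \<in> {1..k} \<and> i \<in> {1..l j + 1}"
  by (auto simp: labels_def image_iff)

lemma al_cases:
  assumes "i \<in> {1..l j}" "j \<in> {1..k}"
  obtains m where "m \<in> {1..b}" "al i j = Ly m" | m where "m \<in> {1..b}" "al i j = Lu m"
proof -
  have "al i j \<in> Ly ` {1..b} \<union> Lu ` {1..b}" unfolding range_al[symmetric] using assms by blast
  then show thesis using that by blast
qed

lemma al_in_labels: "i \<in> {1..l j} \<Longrightarrow> j \<in> {1..k} \<Longrightarrow> al i j \<in> labels"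
  by (rule al_cases) (auto simp: labels_iff)

lemma card_labels: "card labels = a + 2 * b + 2 + (\<Sum>j=1..k. l j) + k"
proof -
  have W: "card (\<Union>j\<in>{1..k}. (\<lambda>i. Lw i j) ` {1..l j + 1}) = (\<Sum>j=1..k. l j + 1)"
    by (subst card_UN_disjoint) (auto simp: card_image inj_on_def)
  have s: "(\<Sum>j=1..k. l j + 1) = (\<Sum>j=1..k. l j) + k" by (simp only: sum.distrib) simp
  have "card labels = card (Lv ` {1..a} \<union> Ly ` {1..b} \<union> {Lz, Lt} \<union> Lu ` {1..b})
      + card (\<Union>j\<in>{1..k}. (\<lambda>i. Lw i j) ` {1..l j + 1})"
    unfolding labels_def by (rule card_Un_disjoint) auto
  also have "card (Lv ` {1..a} \<union> Ly ` {1..b} \<union> {Lz, Lt} \<union> Lu ` {1..b})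
      = card (Lv ` {1..a} \<union> Ly ` {1..b} \<union> {Lz, Lt}) + card (Lu ` {1..b})"
    by (rule card_Un_disjoint) auto
  also have "card (Lv ` {1..a} \<union> Ly ` {1..b} \<union> {Lz, Lt})
      = card (Lv ` {1..a} \<union> Ly ` {1..b}) + card {Lz, Lt}"
    by (rule card_Un_disjoint) auto
  also have "card (Lv ` {1..a} \<union> Ly ` {1..b}) = card (Lv ` {1..a}) + card (Ly ` {1..b})"
    by (rule card_Un_disjoint) auto
  finally show ?thesis unfolding W s by (simp add: card_image inj_on_def)
qed

lemma card_fac:
  assumes v: "valid r p q \<sigma>"
  shows "card (fac K r p q \<sigma>) + 3 + k = card labels"
proof -
  let ?W = "(\<lambda>j. Lw (\<sigma> j) j) ` {1..k}"
  have W: "?W \<subseteq> labels" "card ?W = k" "omitted K r p q \<inter> ?W = {}"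
    using v by (cases K; auto simp: labels_iff valid_def card_image inj_on_def)+
  have O: "omitted K r p q \<subseteq> labels" "card (omitted K r p q) = 3" "finite (omitted K r p q)"
    using v by (cases K; auto simp: labels_iff valid_def)+
  have "card (omitted K r p q \<union> ?W) = 3 + k"
    using W O by (subst card_Un_disjoint) auto
  moreover have "fac K r p q \<sigma> = labels - (omitted K r p q \<union> ?W)" by (auto simp: fac_def)
  moreover have "card (labels - (omitted K r p q \<union> ?W)) = card labels - card (omitted K r p q \<union> ?W)"
    using W O by (intro card_Diff_subset) auto
  moreover have "card (omitted K r p q \<union> ?W) \<le> card labels"
    using W O finite_labels by (intro card_mono) auto
  ultimately show ?thesis by simp
qed

lemma fac_subset: "fac K r p q \<sigma> \<subseteq> labels"
  by (auto simp: fac_def)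

text \<open>A set of labels without primitive collection misses a vertex cover of the pentagon,
  and a minimal vertex cover of a pentagon consists of three blocks.\<close>

lemma subset_fac:
  assumes S: "S \<subseteq> labels" and no: "\<And>C. C \<in> prims \<Longrightarrow> \<not> C \<subseteq> S"
  obtains K r p q \<sigma> where "valid r p q \<sigma>" "S \<subseteq> fac K r p q \<sigma>"
proof -
  note goal = that
  have "\<forall>j\<in>{1..k}. \<exists>i\<in>{1..l j + 1}. Lw i j \<notin> S"
  proof
    fix j assume "j \<in> {1..k}"
    then have "\<not> wprim j \<subseteq> S" using no by (auto simp: prims_def)
    then show "\<exists>i\<in>{1..l j + 1}. Lw i j \<notin> S" by (auto simp: wprim_def)
  qed
  then obtain \<sigma> where \<sigma>: "\<And>j. j \<in> {1..k} \<Longrightarrow> \<sigma> j \<in> {1..l j + 1} \<and> Lw (\<sigma> j) j \<notin> S" by metis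
  have facI: thesis if "r \<in> {1..a}" "p \<in> {1..b}" "q \<in> {1..b}" "omitted K r p q \<inter> S = {}" for K r p q
  proof (rule goal)
    show "valid r p q \<sigma>" unfolding valid_def using that(1-3) \<sigma> by blast
    show "S \<subseteq> fac K r p q \<sigma>"
    proof
      fix s assume s: "s \<in> S"
      then have "s \<notin> (\<lambda>j. Lw (\<sigma> j) j) ` {1..k}" using \<sigma> by blast
      then show "s \<in> fac K r p q \<sigma>" unfolding fac_def using s S that(4) by blast
    qed
  qed
  have N: "\<not> Lv ` {1..a} \<union> Ly ` {1..b} \<subseteq> S" "\<not> Ly ` {1..b} \<union> {Lz} \<subseteq> S" "\<not> {Lz, Lt} \<subseteq> S"
     "\<not> {Lt} \<union> Lu ` {1..b} \<subseteq> S" "\<not> Lu ` {1..b} \<union> Lv ` {1..a} \<subseteq> S"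
    by (rule no; unfold prims_def base_prims_def; blast)+
  have one: "1 \<in> {1..a}" "1 \<in> {1..b}" using a2 b1 by auto
  show thesis
  proof (cases "Lz \<in> S")
    case True
    then have t: "Lt \<notin> S" and "\<not> Ly ` {1..b} \<subseteq> S" using N by auto
    then obtain p where p: "p \<in> {1..b}" "Ly p \<notin> S" by blast
    show thesis
    proof (cases "Lv ` {1..a} \<subseteq> S")
      case True
      then obtain q where "q \<in> {1..b}" "Lu q \<notin> S" using N by blast
      then show thesis using facI[of 1 p q VZ] p t one by auto
    next
      case False
      then obtain r where "r \<in> {1..a}" "Lv r \<notin> S" by blast
      then show thesis using facI[of r p 1 ZU] p t one by auto
    qed
  next
    case z: False
    show thesis
    proof (cases "Lv ` {1..a} \<subseteq> S")
      case True
      then obtain p q where "p \<in> {1..b}" "Ly p \<notin> S" "q \<in> {1..b}" "Lu q \<notin> S" using N by blast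
      then show thesis using facI[of 1 p q VT] z one by auto
    next
      case False
      then obtain r where r: "r \<in> {1..a}" "Lv r \<notin> S" by blast
      show thesis
      proof (cases "Lt \<in> S")
        case True
        then obtain q where "q \<in> {1..b}" "Lu q \<notin> S" using N by blast
        then show thesis using facI[of r 1 q YT] r z one by auto
      next
        case False
        then show thesis using facI[of r 1 1 YU] r z one by auto
      qed
    qed
  qed
qed

text \<open>A functional that is at most one on all labels cannot be one on the left-hand side of
  a relation of positive degree, as it would then exceed one somewhere on the right. This will
  exclude primitive collections from facets.\<close>

lemma prims_not_level:
  fixes h :: "label \<Rightarrow> real"
  assumes h: "rel h" and le: "\<And>s. s \<in> labels \<Longrightarrow> h s \<le> 1" and C: "C \<in> prims"
    and one: "\<And>s. s \<in> C \<Longrightarrow> h s = 1"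
  shows False
proof -
  have z: "h Lz = - h Lt" and U: "(\<Sum>i=1..b. h (Lu i)) = (\<Sum>i=1..b. h (Ly i)) - h Lt"
    and V: "(\<Sum>i=1..a. h (Lv i)) = (real a + real b - 1) * h Lt - (\<Sum>i=1..b. h (Ly i))"
    and W: "\<And>j. j \<in> {1..k} \<Longrightarrow> (\<Sum>i=1..l j + 1. h (Lw i j)) = (\<Sum>i=1..l j. h (al i j))"
    using h by (auto simp: rel_def)
  have t: "h Lt \<le> 1" by (rule le) (simp add: labels_iff)
  have ab: "real a + real b - 1 \<ge> 2" "real a + real b - 2 \<ge> 1" using a2 b1 by linarith+
  have tt: "(real a + real b - 1) * h Lt \<le> (real a + real b - 1) * 1"
    "(real a + real b - 2) * h Lt \<le> (real a + real b - 2) * 1"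
    using t ab by (intro mult_left_mono; linarith)+
  have sumle: "(\<Sum>i=1..n. F i) \<le> real n" if "\<And>i. i \<in> {1..n} \<Longrightarrow> F i \<le> 1" for F :: "nat \<Rightarrow> real" and n
    using sum_mono[of "{1..n}" F "\<lambda>_. 1"] that by simp
  have Yle: "(\<Sum>i=1..b. h (Ly i)) \<le> b" and Ule: "(\<Sum>i=1..b. h (Lu i)) \<le> b"
    by (rule sumle, rule le, simp add: labels_iff)+
  have sumone: "(\<Sum>i=1..n. F i) = real n" if "\<And>i. i \<in> {1..n} \<Longrightarrow> F i = 1" for F :: "nat \<Rightarrow> real" and n
    using that by simp
  consider "C = Lv ` {1..a} \<union> Ly ` {1..b}" | "C = Ly ` {1..b} \<union> {Lz}" | "C = {Lz, Lt}"
    | "C = {Lt} \<union> Lu ` {1..b}" | "C = Lu ` {1..b} \<union> Lv ` {1..a}"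
    | j where "j \<in> {1..k}" "C = wprim j"
    using C by (auto simp: prims_def base_prims_def)
  then show False
  proof cases
    case 1
    then have "(\<Sum>i=1..a. h (Lv i)) = a" "(\<Sum>i=1..b. h (Ly i)) = b" using one by auto
    then show False using V tt by simp
  next
    case 2
    then have "h Lz = 1" "(\<Sum>i=1..b. h (Ly i)) = b" using one by auto
    then show False using U z Ule by simp
  next
    case 3
    then show False using one[of Lz] one[of Lt] z by simp
  next
    case 4
    then have "h Lt = 1" "(\<Sum>i=1..b. h (Lu i)) = b" using one by auto
    then show False using U Yle by simp
  next
    case 5
    then have "(\<Sum>i=1..a. h (Lv i)) = a" "(\<Sum>i=1..b. h (Lu i)) = b" using one by auto
    then show False using U V tt by (simp add: algebra_simps)
  next
    case 6
    then have "(\<Sum>i=1..l j + 1. h (Lw i j)) = real (l j + 1)"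
      by (intro sumone one) (auto simp: wprim_def)
    moreover have "(\<Sum>i=1..l j. h (al i j)) \<le> l j"
      using 6 by (intro sumle le al_in_labels) auto
    ultimately show False using W[OF 6(1)] by simp
  qed
qed

lemma prims_antichain:
  assumes "C \<in> prims" "C' \<in> prims" "C' \<subseteq> C"
  shows "C' = C"
proof -
  have one: "1 \<in> {1..a}" "1 \<in> {1..b}" "\<And>j. 1 \<in> {1..l j + 1}" using a2 b1 by auto
  consider (base) "C' \<in> base_prims" "C \<in> base_prims"
    | (mixed1) j where "C' = wprim j" "C \<in> base_prims"
    | (mixed2) j where "C' \<in> base_prims" "C = wprim j"
    | (w) i j where "C' = wprim i" "C = wprim j"
    using assms by (auto simp: prims_def)
  then show ?thesis
  proof cases
    case base
    have mem: "Lv 1 \<in> Lv ` {1..a}" "Ly 1 \<in> Ly ` {1..b}" "Lu 1 \<in> Lu ` {1..b}" using one by auto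
    have sub: "s \<in> C' \<longrightarrow> s \<in> C" for s using assms(3) by blast
    show ?thesis using base mem sub[of "Lv 1"] sub[of "Ly 1"] sub[of Lz] sub[of Lt] sub[of "Lu 1"] unfolding base_prims_def
      by (elim insertE emptyE) (simp_all add: image_iff)
  next
    case mixed1
    then have "Lw 1 j \<in> C" using assms(3) one(3) by (auto simp: wprim_def)
    then show ?thesis using mixed1 by (auto simp: base_prims_def)
  next
    case mixed2
    have "Lv 1 \<in> Lv ` {1..a}" "Ly 1 \<in> Ly ` {1..b}" "Lu 1 \<in> Lu ` {1..b}" using one by auto
    then show ?thesis using mixed2 assms(3) by (fastforce simp: base_prims_def wprim_def)
  next
    case w
    then have "Lw 1 i \<in> wprim j" using assms(3) one(3) by (auto simp: wprim_def)
    then show ?thesis using w by (auto simp: wprim_def)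
  qed
qed

lemma prims_subset: "C \<in> prims \<Longrightarrow> C \<subseteq> labels"
  by (auto simp: prims_def base_prims_def wprim_def labels_def)

subsection \<open>Functions satisfying the relations\<close>

text \<open>The value at \<open>i\<close> is changed so that the sum over the block becomes
  \<open>S\<close>.\<close>

definition fill :: "nat \<Rightarrow> nat \<Rightarrow> (nat \<Rightarrow> real) \<Rightarrow> real \<Rightarrow> nat \<Rightarrow> real" where
  "fill i n F S = F(i := S - (\<Sum>i'\<in>{1..n} - {i}. F i'))"

lemma fill_other: "i' \<noteq> i \<Longrightarrow> fill i n F S i' = F i'"
  by (simp add: fill_def)

lemma sum_fill:
  assumes "i \<in> {1..n}"
  shows "(\<Sum>i'=1..n. fill i n F S i') = S"
proof -
  have "(\<Sum>i'=1..n. fill i n F S i') = fill i n F S i + (\<Sum>i'\<in>{1..n} - {i}. fill i n F S i')"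
    using assms by (intro sum.remove) auto
  also have "(\<Sum>i'\<in>{1..n} - {i}. fill i n F S i') = (\<Sum>i'\<in>{1..n} - {i}. F i')"
    by (rule sum.cong) (auto simp: fill_other)
  finally show ?thesis by (simp add: fill_def)
qed

lemma fill_full:
  assumes "i \<in> {1..n}" "S = (\<Sum>i'=1..n. F i')"
  shows "fill i n F S i' = F i'"
proof -
  have "(\<Sum>i'=1..n. F i') = F i + (\<Sum>i'\<in>{1..n} - {i}. F i')"
    using assms by (intro sum.remove) auto
  then show ?thesis using assms(2) by (simp add: fill_def)
qed

lemma fill_Ints: "(\<And>i. F i \<in> \<int>) \<Longrightarrow> S \<in> \<int> \<Longrightarrow> fill i n F S i' \<in> \<int>"
  by (auto simp: fill_def intro!: Ints_diff Ints_sum)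

text \<open>A function on a facet extends to all labels: the values on the two complete blocks
  determine \<open>\<tau>\<close>, the value at \<open>t\<close>, and \<open>\<upsilon>\<close>,
  the sum over the block \<open>y\<close>, and these determine the sums over all other
  blocks.\<close>

lemma extend_fac:
  fixes f :: "label \<Rightarrow> real"
  assumes v: "valid r p q \<sigma>"
  obtains g where "rel g" "\<And>s. s \<in> fac K r p q \<sigma> \<Longrightarrow> g s = f s"
    "(\<forall>s. f s \<in> \<int>) \<longrightarrow> (\<forall>s. g s \<in> \<int>)"
proof -
  have rpq: "r \<in> {1..a}" "p \<in> {1..b}" "q \<in> {1..b}" "\<And>j. j \<in> {1..k} \<Longrightarrow> \<sigma> j \<in> {1..l j + 1}"
    using v by (auto simp: valid_def)
  let ?V = "\<Sum>i=1..a. f (Lv i)" and ?Y = "\<Sum>i=1..b. f (Ly i)" and ?U = "\<Sum>i=1..b. f (Lu i)"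
  define \<tau> where "\<tau> = (case K of VZ \<Rightarrow> - f Lz | VT \<Rightarrow> f Lt | YT \<Rightarrow> f Lt | YU \<Rightarrow> ?Y - ?U | ZU \<Rightarrow> - f Lz)"
  define \<upsilon> where "\<upsilon> = (case K of VZ \<Rightarrow> (real a + real b - 1) * \<tau> - ?V
    | VT \<Rightarrow> (real a + real b - 1) * \<tau> - ?V | YT \<Rightarrow> ?Y | YU \<Rightarrow> ?Y | ZU \<Rightarrow> ?U + \<tau>)"
  define g0 where "g0 = (\<lambda>s. case s of Lt \<Rightarrow> \<tau> | Lz \<Rightarrow> - \<tau>
    | Ly i \<Rightarrow> fill p b (\<lambda>i. f (Ly i)) \<upsilon> i
    | Lu i \<Rightarrow> fill q b (\<lambda>i. f (Lu i)) (\<upsilon> - \<tau>) i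
    | Lv i \<Rightarrow> fill r a (\<lambda>i. f (Lv i)) ((real a + real b - 1) * \<tau> - \<upsilon>) i
    | Lw i j \<Rightarrow> 0)"
  define g where "g = (\<lambda>s. case s of
      Lw i j \<Rightarrow> fill (\<sigma> j) (l j + 1) (\<lambda>i. f (Lw i j)) (\<Sum>i=1..l j. g0 (al i j)) i | s \<Rightarrow> g0 s)"
  have g: "g Lt = \<tau>" "g Lz = - \<tau>" "\<And>i. g (Ly i) = fill p b (\<lambda>i. f (Ly i)) \<upsilon> i"
    "\<And>i. g (Lu i) = fill q b (\<lambda>i. f (Lu i)) (\<upsilon> - \<tau>) i"
    "\<And>i. g (Lv i) = fill r a (\<lambda>i. f (Lv i)) ((real a + real b - 1) * \<tau> - \<upsilon>) i"
    "\<And>i j. g (Lw i j) = fill (\<sigma> j) (l j + 1) (\<lambda>i. f (Lw i j)) (\<Sum>i=1..l j. g0 (al i j)) i"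
    by (auto simp: g_def g0_def)
  have gal: "g0 (al i j) = g (al i j)" if "i \<in> {1..l j}" "j \<in> {1..k}" for i j
    using that by (rule al_cases) (auto simp: g_def)
  have "rel g"
    unfolding rel_def
  proof (intro conjI ballI)
    fix j assume j: "j \<in> {1..k}"
    have "(\<Sum>i=1..l j + 1. g (Lw i j)) = (\<Sum>i=1..l j. g0 (al i j))"
      unfolding g by (rule sum_fill) (rule rpq(4)[OF j])
    also have "\<dots> = (\<Sum>i=1..l j. g (al i j))" by (rule sum.cong) (use gal j in auto)
    finally show "(\<Sum>i=1..l j + 1. g (Lw i j)) = (\<Sum>i=1..l j. g (al i j))" .
  qed (use rpq in \<open>simp_all only: g sum_fill, simp_all\<close>)
  moreover have "g s = f s" if s: "s \<in> fac K r p q \<sigma>" for s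
  proof -
    have sL: "s \<in> labels" "s \<notin> omitted K r p q" "s \<notin> (\<lambda>j. Lw (\<sigma> j) j) ` {1..k}"
      using s by (auto simp: fac_def)
    have Y: "g (Ly i) = f (Ly i)" if "i \<noteq> p \<or> \<upsilon> = ?Y" for i
      using that rpq(2) by (auto simp: g fill_other fill_full)
    have U: "g (Lu i) = f (Lu i)" if "i \<noteq> q \<or> \<upsilon> - \<tau> = ?U" for i
      using that rpq(3) by (auto simp: g fill_other fill_full)
    have V: "g (Lv i) = f (Lv i)" if "i \<noteq> r \<or> (real a + real b - 1) * \<tau> - \<upsilon> = ?V" for i
      using that rpq(1) by (auto simp: g fill_other fill_full)
    show ?thesis
    proof (cases s)
      case (Lw i j)
      then have "i \<noteq> \<sigma> j" using sL by (auto simp: labels_iff)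
      then show ?thesis unfolding Lw g by (rule fill_other)
    next
      case (Lv i) show ?thesis unfolding Lv by (rule V) (use sL Lv in \<open>cases K; simp add: \<tau>_def \<upsilon>_def; blast\<close>)
    next
      case (Ly i) show ?thesis unfolding Ly by (rule Y) (use sL Ly in \<open>cases K; simp add: \<tau>_def \<upsilon>_def; blast\<close>)
    next
      case (Lu i) show ?thesis unfolding Lu by (rule U) (use sL Lu in \<open>cases K; simp add: \<tau>_def \<upsilon>_def; blast\<close>)
    qed (use sL in \<open>cases K; simp add: g \<tau>_def\<close>)+
  qed
  moreover have "g s \<in> \<int>" if "\<forall>s. f s \<in> \<int>" for s
  proof -
    note f = that[rule_format]
    have S: "?V \<in> \<int>" "?Y \<in> \<int>" "?U \<in> \<int>" by (auto intro!: Ints_sum f)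
    have ab: "real a + real b - 1 \<in> \<int>" by (auto intro!: Ints_diff Ints_add)
    have \<tau>: "\<tau> \<in> \<int>" unfolding \<tau>_def by (cases K) (auto intro!: Ints_diff S f simp: minus_in_Ints_iff)
    have \<upsilon>: "\<upsilon> \<in> \<int>" unfolding \<upsilon>_def by (cases K) (auto intro!: Ints_diff Ints_mult Ints_add S f ab \<tau>)
    have g0: "g0 s \<in> \<int>" for s
      unfolding g0_def by (cases s) (auto intro!: fill_Ints f \<tau> \<upsilon> ab Ints_diff Ints_mult simp: minus_in_Ints_iff)
    then show ?thesis unfolding g_def by (cases s) (auto intro!: fill_Ints f Ints_sum)
  qed
  ultimately show thesis using that by blast
qed

lemma sum_all_but_one:
  assumes "i \<in> {1..n}" "\<And>i'. i' \<in> {1..n} \<Longrightarrow> i' \<noteq> i \<Longrightarrow> F i' = e"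
  shows "(\<Sum>i'=1..n. F i') = (real n - 1) * e + (F i :: real)"
proof -
  have "(\<Sum>i'=1..n. F i') = F i + (\<Sum>i'\<in>{1..n} - {i}. F i')" using assms(1) by (simp add: sum.remove)
  also have "(\<Sum>i'\<in>{1..n} - {i}. F i') = (\<Sum>i'\<in>{1..n} - {i}. e)" by (rule sum.cong) (use assms(2) in auto)
  finally show ?thesis using assms(1) by (simp add: of_nat_diff)
qed

text \<open>The case \<open>e = 1\<close> serves to evaluate facet normals, the case \<open>e =
  0\<close> to show that a solution of the relations is determined by its values on a
  facet.\<close>

lemma fac_block_sums:
  fixes h :: "label \<Rightarrow> real"
  assumes v: "valid r p q \<sigma>" and one: "\<forall>s\<in>fac K r p q \<sigma>. h s = e"
  shows "(\<Sum>i=1..a. h (Lv i)) = (real a - 1) * e + h (Lv r)"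
    and "(\<Sum>i=1..b. h (Ly i)) = (real b - 1) * e + h (Ly p)"
    and "(\<Sum>i=1..b. h (Lu i)) = (real b - 1) * e + h (Lu q)"
    and "j \<in> {1..k} \<Longrightarrow> (\<Sum>i=1..l j + 1. h (Lw i j)) = real (l j) * e + h (Lw (\<sigma> j) j)"
    and "s \<in> labels \<Longrightarrow> s \<notin> omitted K r p q \<Longrightarrow> s \<notin> (\<lambda>j. Lw (\<sigma> j) j) ` {1..k} \<Longrightarrow> h s = e"
proof -
  have rpq: "r \<in> {1..a}" "p \<in> {1..b}" "q \<in> {1..b}" "\<And>j. j \<in> {1..k} \<Longrightarrow> \<sigma> j \<in> {1..l j + 1}"
    using v by (auto simp: valid_def)
  have in_fac: "s \<in> fac K r p q \<sigma>" if "s \<in> labels" "s \<notin> omitted K r p q" "s \<notin> (\<lambda>j. Lw (\<sigma> j) j) ` {1..k}" for s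
    using that by (auto simp: fac_def)
  note one = one[rule_format]
  show "(\<Sum>i=1..a. h (Lv i)) = (real a - 1) * e + h (Lv r)"
    by (rule sum_all_but_one[OF rpq(1)], rule one, rule in_fac) (cases K; auto simp: labels_iff)+
  show "(\<Sum>i=1..b. h (Ly i)) = (real b - 1) * e + h (Ly p)"
    by (rule sum_all_but_one[OF rpq(2)], rule one, rule in_fac) (cases K; auto simp: labels_iff)+
  show "(\<Sum>i=1..b. h (Lu i)) = (real b - 1) * e + h (Lu q)"
    by (rule sum_all_but_one[OF rpq(3)], rule one, rule in_fac) (cases K; auto simp: labels_iff)+
  show "(\<Sum>i=1..l j + 1. h (Lw i j)) = real (l j) * e + h (Lw (\<sigma> j) j)" if j: "j \<in> {1..k}"
  proof -
    have "(\<Sum>i=1..l j + 1. h (Lw i j)) = (real (l j + 1) - 1) * e + h (Lw (\<sigma> j) j)"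
      by (rule sum_all_but_one[OF rpq(4)[OF j]], rule one, rule in_fac)
        (use j in \<open>cases K; auto simp: labels_iff\<close>)+
    also have "(real (l j + 1) - 1) * e = real (l j) * e" by simp
    finally show ?thesis .
  qed
  show "h s = e" if "s \<in> labels" "s \<notin> omitted K r p q" "s \<notin> (\<lambda>j. Lw (\<sigma> j) j) ` {1..k}"
    using one in_fac that by blast
qed

text \<open>The values of a facet normal on the omitted labels follow from the block sums. The
  value \<open>0\<close> at an omitted label means that the wall to a neighbouring facet that
  contains this label has degree one.\<close>

lemma fac_normal_values:
  fixes h :: "label \<Rightarrow> real"
  assumes v: "valid r p q \<sigma>" and h: "rel h" and one: "\<And>s. s \<in> fac K r p q \<sigma> \<Longrightarrow> h s = 1"
  shows fac_normal_outside: "s \<in> labels \<Longrightarrow> s \<notin> fac K r p q \<sigma> \<Longrightarrow> h s \<le> 0"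
    and "K = VT \<Longrightarrow> h Lz = -1"
    and "K = YT \<Longrightarrow> h (Lu q) = 0"
    and "K = YT \<Longrightarrow> h (Lv r) = 0"
    and "K = YU \<Longrightarrow> h Lz = 0"
    and "K = ZU \<Longrightarrow> h (Ly p) = 0"
    and "K = YU \<Longrightarrow> j \<in> {1..k} \<Longrightarrow> h (Lw (\<sigma> j) j) = 0"
proof -
  have "\<forall>s\<in>fac K r p q \<sigma>. h s = 1" using one by blast
  note S = fac_block_sums[OF v this]
  have rpq: "r \<in> {1..a}" "p \<in> {1..b}" "q \<in> {1..b}" "\<And>j. j \<in> {1..k} \<Longrightarrow> \<sigma> j \<in> {1..l j + 1}"
    using v by (auto simp: valid_def)
  have z: "h Lz = - h Lt" and U: "(\<Sum>i=1..b. h (Lu i)) = (\<Sum>i=1..b. h (Ly i)) - h Lt"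
    and V: "(\<Sum>i=1..a. h (Lv i)) = (real a + real b - 1) * h Lt - (\<Sum>i=1..b. h (Ly i))"
    and W: "\<And>j. j \<in> {1..k} \<Longrightarrow> (\<Sum>i=1..l j + 1. h (Lw i j)) = (\<Sum>i=1..l j. h (al i j))"
    using h by (auto simp: rel_def)
  have ab: "real a \<ge> 2" "real b \<ge> 1" using a2 b1 by linarith+
  have vals: "case K of
      VZ \<Rightarrow> h Lt = -1 \<and> h (Ly p) \<le> 0 \<and> h (Lu q) \<le> 0
    | VT \<Rightarrow> h Lz = -1 \<and> h (Ly p) = 0 \<and> h (Lu q) \<le> 0
    | YT \<Rightarrow> h Lz = -1 \<and> h (Lv r) = 0 \<and> h (Lu q) = 0
    | YU \<Rightarrow> h Lz = 0 \<and> h Lt = 0 \<and> h (Lv r) \<le> 0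
    | ZU \<Rightarrow> h Lt = -1 \<and> h (Ly p) = 0 \<and> h (Lv r) \<le> 0"
  proof (cases K)
    case VZ
    then have "h Lz = 1" "h (Lv r) = 1" using S(5) rpq by (auto simp: labels_iff image_iff)
    with z have "h Lt = -1" by simp
    with S(1-3) U V ab \<open>h (Lv r) = 1\<close> VZ show ?thesis by simp
  next
    case VT
    then have "h Lt = 1" "h (Lv r) = 1" using S(5) rpq by (auto simp: labels_iff image_iff)
    with S(1-3) U V z ab VT show ?thesis by simp
  next
    case YT
    then have "h Lt = 1" "h (Ly p) = 1" using S(5) rpq by (auto simp: labels_iff image_iff)
    with S(1-3) U V z ab YT show ?thesis by simp
  next
    case YU
    then have "h (Ly p) = 1" "h (Lu q) = 1" using S(5) rpq by (auto simp: labels_iff image_iff)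
    moreover from this S(2,3) U have "h Lt = 0" by simp
    ultimately show ?thesis using S(1-3) V z ab YU by simp
  next
    case ZU
    then have "h Lz = 1" "h (Lu q) = 1" using S(5) rpq by (auto simp: labels_iff image_iff)
    with z have "h Lt = -1" by simp
    with S(1-3) U V ab \<open>h (Lu q) = 1\<close> ZU show ?thesis by simp
  qed
  have base: "h s \<le> 1" if "s \<in> labels" "s \<notin> (\<lambda>j. Lw (\<sigma> j) j) ` {1..k}" for s
  proof (cases "s \<in> omitted K r p q")
    case True
    then show ?thesis using vals by (cases K) auto
  next
    case False
    then show ?thesis using S(5) that by simp
  qed
  have Wval: "h (Lw (\<sigma> j) j) = (\<Sum>i=1..l j. h (al i j)) - l j" if "j \<in> {1..k}" for j
    using S(4)[OF that] W[OF that] by simp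
  have ale: "h (al i j) \<le> 1" if "i \<in> {1..l j}" "j \<in> {1..k}" for i j
    using that by (rule al_cases) (auto simp: labels_iff intro!: base)
  have Wle: "h (Lw (\<sigma> j) j) \<le> 0" if "j \<in> {1..k}" for j
    using sum_mono[of "{1..l j}" "\<lambda>i. h (al i j)" "\<lambda>_. 1"] ale that Wval by simp
  show "h s \<le> 0" if "s \<in> labels" "s \<notin> fac K r p q \<sigma>"
  proof (cases "s \<in> omitted K r p q")
    case True
    then show ?thesis using vals by (cases K) auto
  next
    case False
    then have "s \<in> (\<lambda>j. Lw (\<sigma> j) j) ` {1..k}" using that unfolding fac_def by blast
    then show ?thesis using Wle by (elim imageE) simp
  qed
  show "h (Lw (\<sigma> j) j) = 0" if "K = YU" "j \<in> {1..k}"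
  proof -
    have "h (al i j) = 1" if "i \<in> {1..l j}" for i
      using that \<open>j \<in> {1..k}\<close>
      by (rule al_cases) (use \<open>K = YU\<close> S(5) in \<open>auto simp: labels_iff image_iff\<close>)
    then show ?thesis using Wval that by simp
  qed
  show "K = VT \<Longrightarrow> h Lz = -1" "K = YT \<Longrightarrow> h (Lu q) = 0" "K = YT \<Longrightarrow> h (Lv r) = 0" "K = YU \<Longrightarrow> h Lz = 0"
    "K = ZU \<Longrightarrow> h (Ly p) = 0" using vals by auto
qed

lemma rel_zero:
  fixes h :: "label \<Rightarrow> real"
  assumes v: "valid r p q \<sigma>" and h: "rel h" and zero: "\<And>s. s \<in> fac YT r p q \<sigma> \<Longrightarrow> h s = 0"
    and s: "s \<in> labels"
  shows "h s = 0"
proof -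
  have "\<forall>s\<in>fac YT r p q \<sigma>. h s = 0" using zero by blast
  note S = fac_block_sums[OF v this]
  have rpq: "p \<in> {1..b}" using v by (auto simp: valid_def)
  have z: "h Lz = - h Lt" and U: "(\<Sum>i=1..b. h (Lu i)) = (\<Sum>i=1..b. h (Ly i)) - h Lt"
    and V: "(\<Sum>i=1..a. h (Lv i)) = (real a + real b - 1) * h Lt - (\<Sum>i=1..b. h (Ly i))"
    and W: "\<And>j. j \<in> {1..k} \<Longrightarrow> (\<Sum>i=1..l j + 1. h (Lw i j)) = (\<Sum>i=1..l j. h (al i j))"
    using h by (auto simp: rel_def)
  have ty: "h Lt = 0" "h (Ly p) = 0" using S(5) rpq by (auto simp: labels_iff image_iff)
  then have zu: "h Lz = 0" "h (Lu q) = 0" "h (Lv r) = 0" using S(1-3) U V z by simp_all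
  have base: "h s = 0" if "s \<in> labels" "s \<notin> (\<lambda>j. Lw (\<sigma> j) j) ` {1..k}" for s
    using that S(5)[of s] zu by auto
  have "h (Lw (\<sigma> j) j) = 0" if j: "j \<in> {1..k}" for j
  proof -
    have "h (al i j) = 0" if "i \<in> {1..l j}" for i
      using that j by (rule al_cases) (auto simp: labels_iff intro!: base)
    then show ?thesis using S(4)[OF j] W[OF j] by simp
  qed
  then show ?thesis using base s by blast
qed

end

section \<open>The polytope\<close>

context configuration
begin

text \<open>The labels of the facet \<open>base\<close> serve as coordinates: the other vectors
  are determined by those of \<open>base\<close> through the relations.\<close>

definition base :: "label set" where
  "base = fac YT a 1 b (\<lambda>j. l j + 1)"

lemma valid_base: "valid a 1 b (\<lambda>j. l j + 1)"
  using a2 b1 by (auto simp: valid_def)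

lemma base_subset: "base \<subseteq> labels"
  unfolding base_def by (rule fac_subset)

lemma finite_base: "finite base"
  using finite_subset[OF base_subset finite_labels] .

lemma rel_base_unique:
  fixes g g' :: "label \<Rightarrow> real"
  assumes "rel g" "rel g'" "\<And>s. s \<in> base \<Longrightarrow> g s = g' s" "s \<in> labels"
  shows "g s = g' s"
proof -
  have "rel (\<lambda>s. g s - g' s)"
    using assms(1,2) by (simp add: rel_def sum_subtractf algebra_simps)
  from rel_zero[OF valid_base this] assms(3,4) show ?thesis by (simp add: base_def)
qed

lemma rel_base_Ints:
  fixes g :: "label \<Rightarrow> real"
  assumes g: "rel g" "\<And>s. s \<in> base \<Longrightarrow> g s \<in> \<int>" and s: "s \<in> labels"
  shows "g s \<in> \<int>"
proof -
  let ?f = "\<lambda>s. if s \<in> base then g s else 0"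
  obtain g' where g': "rel g'" "\<And>s. s \<in> base \<Longrightarrow> g' s = ?f s"
    "(\<forall>s. ?f s \<in> \<int>) \<longrightarrow> (\<forall>s. g' s \<in> \<int>)"
    using extend_fac[OF valid_base, of YT ?f] unfolding base_def[symmetric] by metis
  have "g' s \<in> \<int>" using g(2) g'(3) by auto
  moreover have "g s = g' s" by (rule rel_base_unique[OF g(1) g'(1) _ s]) (simp add: g'(2))
  ultimately show ?thesis by simp
qed

text \<open>Two choices for the omitted \<open>w\<^sub>i\<^sub>j\<close> suffice to reach every
  label, since each block \<open>w\<^sub>j\<close> has at least two elements.\<close>

lemma label_in_fac:
  assumes s: "s \<in> labels"
  obtains K r p q \<sigma> where "valid r p q \<sigma>" "s \<in> fac K r p q \<sigma>"
proof -
  have v: "valid 1 1 1 (\<lambda>_. 1)" "valid 1 1 1 (\<lambda>_. 2)" using a2 b1 l1 by (auto simp: valid_def)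
  have "\<exists>K. s \<in> fac K 1 1 1 (\<lambda>_. 1) \<or> s \<in> fac K 1 1 1 (\<lambda>_. 2)"
  proof (cases s)
    case (Lv i) then have "s \<in> fac VT 1 1 1 (\<lambda>_. 1)" using s by (auto simp: fac_def)
    then show ?thesis by blast
  next
    case (Ly i) then have "s \<in> fac YT 1 1 1 (\<lambda>_. 1)" using s by (auto simp: fac_def)
    then show ?thesis by blast
  next
    case Lz then have "s \<in> fac VZ 1 1 1 (\<lambda>_. 1)" using s by (auto simp: fac_def)
    then show ?thesis by blast
  next
    case Lt then have "s \<in> fac VT 1 1 1 (\<lambda>_. 1)" using s by (auto simp: fac_def)
    then show ?thesis by blast
  next
    case (Lu i) then have "s \<in> fac YU 1 1 1 (\<lambda>_. 1)" using s by (auto simp: fac_def)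
    then show ?thesis by blast
  next
    case (Lw i j)
    then have "s \<in> fac YU 1 1 1 (\<lambda>_. 1) \<or> s \<in> fac YU 1 1 1 (\<lambda>_. 2)" using s by (auto simp: fac_def)
    then show ?thesis by blast
  qed
  then show thesis using that v by blast
qed

text \<open>The labels generate the space positively: the relations force a nonnegative solution
  to vanish first on \<open>z\<close> and \<open>t\<close>, whose values add up to zero, and from
  there on one block after the other.\<close>

lemma rel_nonneg_zero:
  fixes h :: "label \<Rightarrow> real"
  assumes h: "rel h" and nn: "\<And>s. s \<in> labels \<Longrightarrow> 0 \<le> h s" and s: "s \<in> labels"
  shows "h s = 0"
proof -
  have z: "h Lz = - h Lt" and U: "(\<Sum>i=1..b. h (Lu i)) = (\<Sum>i=1..b. h (Ly i)) - h Lt"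
    and V: "(\<Sum>i=1..a. h (Lv i)) = (real a + real b - 1) * h Lt - (\<Sum>i=1..b. h (Ly i))"
    and W: "\<And>j. j \<in> {1..k} \<Longrightarrow> (\<Sum>i=1..l j + 1. h (Lw i j)) = (\<Sum>i=1..l j. h (al i j))"
    using h by (auto simp: rel_def)
  have "h Lz \<ge> 0" "h Lt \<ge> 0" by (rule nn; simp add: labels_iff)+
  then have zt: "h Lz = 0" "h Lt = 0" using z by auto
  have nnV: "h (Lv i) \<ge> 0" if "i \<in> {1..a}" for i using that by (intro nn) (simp add: labels_iff)
  have nnY: "h (Ly i) \<ge> 0" "h (Lu i) \<ge> 0" if "i \<in> {1..b}" for i
    using that by (intro nn; simp add: labels_iff)+
  have sums: "(\<Sum>i=1..a. h (Lv i)) \<ge> 0" "(\<Sum>i=1..b. h (Ly i)) \<ge> 0"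
    using nnV nnY by (intro sum_nonneg; blast)+
  then have "(\<Sum>i=1..a. h (Lv i)) = 0" "(\<Sum>i=1..b. h (Ly i)) = 0" "(\<Sum>i=1..b. h (Lu i)) = 0"
    using V U zt by auto
  then have vyu: "i \<in> {1..a} \<Longrightarrow> h (Lv i) = 0" "i \<in> {1..b} \<Longrightarrow> h (Ly i) = 0" "i \<in> {1..b} \<Longrightarrow> h (Lu i) = 0" for i
    using nnV nnY sum_nonneg_0[of "{1..a}" "\<lambda>i. h (Lv i)"] sum_nonneg_0[of "{1..b}" "\<lambda>i. h (Ly i)"]
      sum_nonneg_0[of "{1..b}" "\<lambda>i. h (Lu i)"] by blast+
  have w: "h (Lw i j) = 0" if j: "j \<in> {1..k}" and i: "i \<in> {1..l j + 1}" for i j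
  proof -
    have "h (al i j) = 0" if "i \<in> {1..l j}" for i
      using that j by (rule al_cases) (simp_all add: vyu)
    then have "(\<Sum>i=1..l j + 1. h (Lw i j)) = 0" using W[OF j] by simp
    moreover have "h (Lw i j) \<ge> 0" if "i \<in> {1..l j + 1}" for i
      using that j by (intro nn) (simp add: labels_iff)
    ultimately show ?thesis using i sum_nonneg_0[of "{1..l j + 1}" "\<lambda>i. h (Lw i j)"] by blast
  qed
  show ?thesis using s by (cases s) (auto simp: labels_iff vyu zt w)
qed

end

locale realization = configuration a b k l al for a b k l al +
  fixes pt :: "label \<Rightarrow> real^'n"
  assumes rel_pt: "rel pt" and inj_base: "inj_on pt base" and basis: "is_lattice_basis (pt ` base)"
begin

lemma rel_inner: "rel (\<lambda>s. c \<bullet> pt s)"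
proof -
  have r: "pt Lz = - pt Lt" "(\<Sum>i=1..b. pt (Lu i)) = (\<Sum>i=1..b. pt (Ly i)) - pt Lt"
    "(\<Sum>i=1..a. pt (Lv i)) = (real a + real b - 1) *\<^sub>R pt Lt - (\<Sum>i=1..b. pt (Ly i))"
    and W: "\<And>j. j \<in> {1..k} \<Longrightarrow> (\<Sum>i=1..l j + 1. pt (Lw i j)) = (\<Sum>i=1..l j. pt (al i j))"
    using rel_pt by (auto simp: rel_def)
  note inner = inner_minus_right inner_diff_right inner_scaleR_right inner_sum_right
  show ?thesis
    unfolding rel_def real_scaleR_def
    using r[THEN arg_cong, of "\<lambda>x. c \<bullet> x", unfolded inner]
      W[THEN arg_cong, of _ "\<lambda>x. c \<bullet> x", unfolded inner] by blast
qed

text \<open>The functional is a combination of the basis dual to \<open>base\<close>; off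
  \<open>base\<close> it has the required values because solutions of the relations are determined
  by their values on \<open>base\<close>.\<close>

lemma functional:
  fixes g :: "label \<Rightarrow> real"
  assumes g: "rel g"
  obtains c where "\<And>s. s \<in> labels \<Longrightarrow> c \<bullet> pt s = g s"
    "(\<forall>s\<in>base. g s \<in> \<int>) \<longrightarrow> c \<in> int_lattice"
proof -
  have "\<forall>s\<in>base. \<exists>m. m \<in> int_lattice \<and> m \<bullet> pt s = 1 \<and> (\<forall>s'\<in>base. s' \<noteq> s \<longrightarrow> m \<bullet> pt s' = 0)"
  proof
    fix s assume s: "s \<in> base"
    obtain m where m: "m \<in> int_lattice" "m \<bullet> pt s = 1" "\<And>x. x \<in> pt ` base \<Longrightarrow> x \<noteq> pt s \<Longrightarrow> m \<bullet> x = 0"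
      using lattice_basis_dual[OF basis imageI[OF s]] by metis
    have "m \<bullet> pt s' = 0" if "s' \<in> base" "s' \<noteq> s" for s'
      by (rule m(3)) (use that s inj_base in \<open>auto dest: inj_onD\<close>)
    with m show "\<exists>m. m \<in> int_lattice \<and> m \<bullet> pt s = 1 \<and> (\<forall>s'\<in>base. s' \<noteq> s \<longrightarrow> m \<bullet> pt s' = 0)"
      by blast
  qed
  then obtain m where m: "\<And>s. s \<in> base \<Longrightarrow> m s \<in> int_lattice" "\<And>s. s \<in> base \<Longrightarrow> m s \<bullet> pt s = 1"
    "\<And>s s'. s \<in> base \<Longrightarrow> s' \<in> base \<Longrightarrow> s' \<noteq> s \<Longrightarrow> m s \<bullet> pt s' = 0" by metis
  define c where "c = (\<Sum>s\<in>base. g s *\<^sub>R m s)"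
  have "c \<bullet> pt s = g s" if s: "s \<in> base" for s
  proof -
    have "c \<bullet> pt s = (\<Sum>s'\<in>base. if s' = s then g s else 0)"
      unfolding c_def inner_sum_left by (rule sum.cong) (use m s in auto)
    then show ?thesis using s finite_base by simp
  qed
  then have "c \<bullet> pt s = g s" if "s \<in> labels" for s
    using rel_base_unique[OF rel_inner g] that by blast
  moreover have "c \<in> int_lattice" if gi: "\<forall>s\<in>base. g s \<in> \<int>"
    unfolding c_def
  proof (rule int_lattice_sum)
    fix s assume "s \<in> base"
    then show "g s *\<^sub>R m s \<in> int_lattice" using m(1)[of s] gi by (auto simp: int_lattice_def)
  qed
  ultimately show thesis using that by blast
qed

lemma pt_lattice:
  assumes "s \<in> labels"
  shows "pt s \<in> int_lattice"
proof (rule int_latticeI_inner)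
  fix y :: "real^'n" assume y: "y \<in> int_lattice"
  have "y \<bullet> pt s \<in> \<int>"
  proof (rule rel_base_Ints[OF rel_inner _ assms])
    fix s' assume "s' \<in> base"
    then have "pt s' \<in> int_lattice" using basis by (auto simp: is_lattice_basis_def)
    then show "y \<bullet> pt s' \<in> \<int>" by (rule int_lattice_inner[OF y])
  qed
  then show "pt s \<bullet> y \<in> \<int>" by (simp add: inner_commute)
qed

lemma fac_functional:
  assumes v: "valid r p q \<sigma>" and f: "\<And>s. f s \<in> \<int>"
  obtains c where "c \<in> int_lattice" "\<And>s. s \<in> fac K r p q \<sigma> \<Longrightarrow> c \<bullet> pt s = f s"
proof -
  obtain g where g: "rel g" "\<And>s. s \<in> fac K r p q \<sigma> \<Longrightarrow> g s = f s"
    "(\<forall>s. f s \<in> \<int>) \<longrightarrow> (\<forall>s. g s \<in> \<int>)"    using extend_fac[OF v, where K = K and f = f] by metis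
  obtain c where c: "\<And>s. s \<in> labels \<Longrightarrow> c \<bullet> pt s = g s"
    "(\<forall>s\<in>base. g s \<in> \<int>) \<longrightarrow> c \<in> int_lattice"
    using functional[OF g(1)] by metis
  show thesis
  proof (rule that)
    show "c \<in> int_lattice" using c(2) g(3) f by blast
    show "c \<bullet> pt s = f s" if "s \<in> fac K r p q \<sigma>" for s
      using that g(2) c(1) fac_subset by (metis subsetD)
  qed
qed

lemma fac_normal_nonpos:
  assumes v: "valid r p q \<sigma>" and c: "\<And>s. s \<in> fac K r p q \<sigma> \<Longrightarrow> c \<bullet> pt s = 1"
    and s: "s \<in> labels" "s \<notin> fac K r p q \<sigma>"
  shows "c \<bullet> pt s \<le> 0"
  using fac_normal_outside[OF v rel_inner c s] by blast

text \<open>Two labels are separated by a functional: by a dual basis vector if they lie in a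
  common facet, and otherwise by the normal of a facet that contains only one of them.\<close>

lemma inj_pt: "inj_on pt labels"
proof (rule inj_onI, rule ccontr)
  fix s s' assume s: "s \<in> labels" "s' \<in> labels" "pt s = pt s'" "s \<noteq> s'"
  obtain K r p q \<sigma> where v: "valid r p q \<sigma>" and sf: "s \<in> fac K r p q \<sigma>" using label_in_fac[OF s(1)] .
  show False
  proof (cases "s' \<in> fac K r p q \<sigma>")
    case True
    obtain c where "\<And>x. x \<in> fac K r p q \<sigma> \<Longrightarrow> c \<bullet> pt x = (if x = s then 1 else 0)"
      by (rule fac_functional[OF v, of "\<lambda>x. if x = s then 1 else 0" K]) auto
    from this[OF sf] this[OF True] s show False by simp
  next
    case False
    obtain c where c: "\<And>x. x \<in> fac K r p q \<sigma> \<Longrightarrow> c \<bullet> pt x = 1"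
      by (rule fac_functional[OF v, of "\<lambda>_. 1" K]) auto
    from c[OF sf] fac_normal_nonpos[OF v c s(2) False] s show False by simp
  qed
qed

lemma fac_basis:
  assumes v: "valid r p q \<sigma>"
  shows "is_lattice_basis (pt ` fac K r p q \<sigma>)"
proof (rule lattice_basisI)
  let ?F = "fac K r p q \<sigma>"
  have fin: "finite ?F" using finite_subset[OF fac_subset finite_labels] .
  have inj: "inj_on pt ?F" using inj_on_subset[OF inj_pt fac_subset] .
  show "finite (pt ` ?F)" using fin by simp
  show "pt ` ?F \<subseteq> int_lattice" using pt_lattice fac_subset by blast
  have "card ?F = card base"
    using card_fac[OF v, of K] card_fac[OF valid_base, of YT] unfolding base_def by simp
  moreover have "card base = CARD('n)" using lattice_basis_card[OF basis] card_image[OF inj_base] by simp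
  ultimately show "card (pt ` ?F) = CARD('n)" using card_image[OF inj] by simp
  show "\<exists>m\<in>int_lattice. m \<bullet> x = 1 \<and> (\<forall>x'\<in>pt ` ?F. x' \<noteq> x \<longrightarrow> m \<bullet> x' = 0)" if x: "x \<in> pt ` ?F" for x
  proof -
    obtain s where s: "s \<in> ?F" "x = pt s" using x by blast
    obtain c where c: "c \<in> int_lattice" "\<And>x. x \<in> ?F \<Longrightarrow> c \<bullet> pt x = (if x = s then 1 else 0)"
      by (rule fac_functional[OF v, of "\<lambda>x. if x = s then 1 else 0" K]) auto
    then show ?thesis using s by (intro bexI[of _ c]) auto
  qed
qed

definition P :: "(real^'n) set" where
  "P = convex hull (pt ` labels)"

lemma polytope_P: "polytope P"
  unfolding P_def using finite_labels by (simp add: polytope_convex_hull)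

lemma pt_in_P: "s \<in> labels \<Longrightarrow> pt s \<in> P"
  unfolding P_def by (simp add: hull_inc)

text \<open>A hyperplane that supports \<open>P\<close> at the origin would give a nonnegative
  solution of the relations, and these vanish.\<close>

lemma zero_interior_P: "0 \<in> interior P"
proof -
  have conv: "convex P" by (simp add: P_def)
  have "pt Lz = - pt Lt" using rel_pt by (simp add: rel_def)
  then have "0 = (1/2) *\<^sub>R pt Lz + (1/2) *\<^sub>R pt Lt" by simp
  moreover have "\<dots> \<in> P" using conv pt_in_P by (intro convexD) (auto simp: labels_iff)
  ultimately have zero: "0 \<in> P" by simp
  have "span (pt ` base) \<subseteq> span P" using base_subset pt_in_P by (intro span_mono) auto
  then have "span P = UNIV" using lattice_basis_span[OF basis] by auto
  then have "affine hull P = UNIV" using zero by (simp add: affine_hull_span_0 hull_inc)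
  then have ri: "rel_interior P = interior P" by (rule rel_interior_interior)
  show ?thesis
  proof (rule ccontr)
    assume "0 \<notin> interior P"
    then obtain c where c: "c \<noteq> 0" "\<And>y. y \<in> P \<Longrightarrow> c \<bullet> 0 \<le> c \<bullet> y"
      using supporting_hyperplane_rel_boundary[OF conv zero] ri by metis
    then have "c \<bullet> pt s = 0" if "s \<in> labels" for s
      using rel_nonneg_zero[OF rel_inner _ that, of c] pt_in_P by simp
    then have "c = 0"
      using basis_functional_eq[OF basis, of c 0] base_subset by auto
    then show False using c(1) by simp
  qed
qed

lemma aff_dim_P: "aff_dim P = int CARD('n)"
proof -
  have "interior P \<noteq> {}" using zero_interior_P by auto
  then have "aff_dim P = int (DIM(real^'n))" by (rule aff_dim_nonempty_interior)
  then show ?thesis by simp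
qed

lemma le_on_P:
  assumes "\<And>s. s \<in> labels \<Longrightarrow> c \<bullet> pt s \<le> t" "x \<in> P"
  shows "c \<bullet> x \<le> t"
  using inner_le_on_hull[of "pt ` labels" c t x] assms by (auto simp: P_def)

lemma face_of_P_hull:
  assumes "F face_of P"
  obtains S where "S \<subseteq> pt ` labels" "F = convex hull S"
proof -
  have "compact (pt ` labels)" using finite_labels by (simp add: finite_imp_compact)
  from face_of_convex_hull_subset[OF this assms[unfolded P_def]] show thesis using that by metis
qed

text \<open>The normal from lemma \<open>fac_functional\<close> is at most zero outside
  \<^term>\<open>fac K r p q \<sigma>\<close>, so it cuts out a face of \<open>P\<close> that is a
  simplex of the right dimension. Faces of this simplex are faces of \<open>P\<close>.\<close>

lemma fac_facet:
  assumes v: "valid r p q \<sigma>"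
  shows fac_is_facet: "convex hull (pt ` fac K r p q \<sigma>) facet_of P"
    and fac_vertices: "vertices (convex hull (pt ` fac K r p q \<sigma>)) = pt ` fac K r p q \<sigma>"
    and fac_face: "S \<subseteq> fac K r p q \<sigma> \<Longrightarrow> (convex hull (pt ` S)) face_of P \<and> vertices (convex hull (pt ` S)) = pt ` S"
    and fac_facet_normal: "\<exists>c. facet_normal P (convex hull (pt ` fac K r p q \<sigma>)) c"
proof -
  let ?F = "fac K r p q \<sigma>"
  obtain c where cl: "c \<in> int_lattice" and c: "\<And>x. x \<in> ?F \<Longrightarrow> c \<bullet> pt x = 1"
    by (rule fac_functional[OF v, of "\<lambda>_. 1" K]) auto
  have out: "c \<bullet> pt s \<le> 0" if "s \<in> labels" "s \<notin> ?F" for s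
    using fac_normal_nonpos[OF v c that] by blast
  have le1: "c \<bullet> pt s \<le> 1" if "s \<in> labels" for s
    using c[of s] out[OF that] by (cases "s \<in> ?F") auto
  have leP: "c \<bullet> x \<le> 1" if "x \<in> P" for x using le_on_P[of c 1 x] le1 that by blast
  define G where "G = P \<inter> {x. c \<bullet> x = 1}"
  have face: "G face_of P"
    unfolding G_def by (rule face_of_Int_supporting_hyperplane_le) (use leP in \<open>auto simp: P_def\<close>)
  have G: "G = convex hull (pt ` ?F)"
  proof
    obtain S where S: "S \<subseteq> pt ` labels" "G = convex hull S"
      by (rule face_of_P_hull[OF face]) (rule that)
    have "S \<subseteq> pt ` ?F"
    proof
      fix x assume x: "x \<in> S"
      then obtain s where s: "s \<in> labels" "x = pt s" using S by blast
      have "x \<in> G" using x S(2) by (simp add: hull_inc)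
      then have "c \<bullet> pt s = 1" using s by (simp add: G_def)
      then have "s \<in> ?F" using out[OF s(1)] by fastforce
      then show "x \<in> pt ` ?F" using s by blast
    qed
    then show "G \<subseteq> convex hull (pt ` ?F)" using S(2) by (simp add: hull_mono)
    have "?F \<subseteq> labels" by (rule fac_subset)
    then have "pt ` ?F \<subseteq> G" using c pt_in_P by (auto simp: G_def)
    then show "convex hull (pt ` ?F) \<subseteq> G"
      by (rule hull_minimal) (use face face_of_imp_convex in blast)
  qed
  have b: "is_lattice_basis (pt ` ?F)" by (rule fac_basis[OF v])
  have ind: "\<not> affine_dependent (pt ` ?F)"
    using lattice_basis_independent[OF b] affine_dependent_imp_dependent by blast
  have "aff_dim G = int CARD('n) - 1"
    using aff_dim_affine_independent[OF ind] lattice_basis_card[OF b] by (simp add: G aff_dim_convex_hull)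
  moreover have "G \<noteq> {}"
    using lattice_basis_card[OF b] by (auto simp: G)
  ultimately show facet: "convex hull (pt ` ?F) facet_of P"
    using face by (simp add: facet_of_def aff_dim_P G)
  show "vertices (convex hull (pt ` ?F)) = pt ` ?F"
    using extreme_point_of_convex_hull_affine_independent[OF ind] by (auto simp: vertices_def)
  show "\<exists>c. facet_normal P (convex hull (pt ` ?F)) c"
    using facet cl leP G by (intro exI[of _ c]) (auto simp: facet_normal_def G_def)
  show "(convex hull (pt ` S)) face_of P \<and> vertices (convex hull (pt ` S)) = pt ` S" if S: "S \<subseteq> ?F"
  proof
    have sub: "pt ` S \<subseteq> pt ` ?F" using S by blast
    then have "(convex hull (pt ` S)) face_of convex hull (pt ` ?F)"
      using face_of_convex_hull_affine_independent[OF ind] by blast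
    then show "(convex hull (pt ` S)) face_of P" using face G face_of_trans by blast
    have "\<not> affine_dependent (pt ` S)" using ind sub affine_dependent_subset by blast
    then show "vertices (convex hull (pt ` S)) = pt ` S"
      using extreme_point_of_convex_hull_affine_independent by (auto simp: vertices_def)
  qed
qed

text \<open>The labels in a facet of \<open>P\<close> contain no primitive collection because the
  relations have positive degree; so they lie in one of the sets \<^term>\<open>fac K r p q
  \<sigma>\<close>, which already span facets.\<close>

lemma facet_of_P:
  assumes F: "F facet_of P"
  obtains K r p q \<sigma> where "valid r p q \<sigma>" "F = convex hull (pt ` fac K r p q \<sigma>)"
proof -
  obtain c where c: "F = {x\<in>P. c \<bullet> x = 1}" "\<forall>x\<in>P. c \<bullet> x \<le> 1"
    by (rule facet_supporting_functional[OF polytope_imp_polyhedron[OF polytope_P] zero_interior_P F])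
  define S where "S = {s\<in>labels. c \<bullet> pt s = 1}"
  have face: "F face_of P" using F facet_of_imp_face_of by blast
  obtain S' where S': "S' \<subseteq> pt ` labels" "F = convex hull S'"
    by (rule face_of_P_hull[OF face]) (rule that)
  have "S' \<subseteq> F" unfolding S'(2) by (rule hull_subset)
  have "S' \<subseteq> pt ` S"
  proof
    fix x assume x: "x \<in> S'"
    then obtain s where s: "s \<in> labels" "x = pt s" using S'(1) by blast
    have "c \<bullet> x = 1" using \<open>S' \<subseteq> F\<close> x c(1) by blast
    then show "x \<in> pt ` S" using s by (simp add: S_def)
  qed
  then have FS: "F \<subseteq> convex hull (pt ` S)" using S'(2) by (simp add: hull_mono)
  obtain K r p q \<sigma> where v: "valid r p q \<sigma>" and sub: "S \<subseteq> fac K r p q \<sigma>"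
  proof (rule subset_fac)
    show "S \<subseteq> labels" by (auto simp: S_def)
    show "\<not> C \<subseteq> S" if "C \<in> prims" for C
    proof
      assume CS: "C \<subseteq> S"
      show False
        by (rule prims_not_level[OF rel_inner _ that, of c]) (use CS c(2) pt_in_P in \<open>auto simp: S_def\<close>)
    qed
  qed
  let ?G = "convex hull (pt ` fac K r p q \<sigma>)"
  have G: "?G facet_of P" by (rule fac_is_facet[OF v])
  have "F \<subseteq> ?G" by (rule order_trans[OF FS hull_mono[OF image_mono[OF sub]]])
  then have "F face_of ?G"
    by (rule face_of_subset[OF face _ facet_of_imp_subset[OF G]])
  moreover have "aff_dim F = aff_dim ?G" using F G by (simp add: facet_of_def)
  ultimately have "F = ?G" using face_of_aff_dim_lt[OF convex_convex_hull, of F] by (metis less_irrefl)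
  with v that show thesis by blast
qed

lemma vertices_P: "vertices P = pt ` labels"
proof
  show "vertices P \<subseteq> pt ` labels"
    unfolding P_def vertices_def by (rule extreme_points_of_convex_hull)
  show "pt ` labels \<subseteq> vertices P"
  proof
    fix x assume "x \<in> pt ` labels"
    then obtain s where s: "s \<in> labels" "x = pt s" by blast
    obtain K r p q \<sigma> where v: "valid r p q \<sigma>" and sf: "s \<in> fac K r p q \<sigma>" using label_in_fac[OF s(1)] .
    have "x \<in> vertices (convex hull (pt ` fac K r p q \<sigma>))" using fac_vertices[OF v] sf s by blast
    then show "x \<in> vertices P"
      using vertices_face[OF facet_of_imp_face_of[OF fac_is_facet[OF v]]] by blast
  qed
qed

theorem smooth_fano_P: "smooth_fano P"
  unfolding smooth_fano_def lattice_polytope_def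
proof (intro conjI allI impI)
  show "vertices P \<subseteq> int_lattice" using vertices_P pt_lattice by auto
  fix F assume "F facet_of P"
  then obtain K r p q \<sigma> where v: "valid r p q \<sigma>" and F: "F = convex hull (pt ` fac K r p q \<sigma>)"
    by (rule facet_of_P)
  then show "is_lattice_basis (vertices F)" using fac_vertices[OF v] fac_basis[OF v] by simp
qed (use polytope_P aff_dim_P zero_interior_P in auto)

lemma card_vertices_P: "card (vertices P) = CARD('n) + k + 3"
proof -
  have "card (vertices P) = card labels" unfolding vertices_P by (rule card_image[OF inj_pt])
  moreover have "card base = CARD('n)" using lattice_basis_card[OF basis] card_image[OF inj_base] by simp
  ultimately show ?thesis using card_fac[OF valid_base, of YT] by (simp add: base_def)
qed

end

section \<open>Primitive relations\<close>

lemma inner_sum_mset: "c \<bullet> (\<Sum>\<^sub># M) = (\<Sum>x\<in>#M. c \<bullet> x)"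
  by (induction M) (auto simp: inner_add_right)

lemma sum_mset_le_size:
  fixes f :: "'a \<Rightarrow> real"
  assumes "\<And>x. x \<in># M \<Longrightarrow> f x \<le> 1"
  shows "(\<Sum>x\<in>#M. f x) \<le> size M"
  using assms by (induction M) force+

lemma sum_mset_eq_size:
  fixes f :: "'a \<Rightarrow> real"
  assumes "\<And>x. x \<in># M \<Longrightarrow> f x \<le> 1" "(\<Sum>x\<in>#M. f x) \<ge> size M" "x \<in># M"
  shows "f x = 1"
proof -
  obtain N where N: "M = add_mset x N" using assms(3) by (metis mset_add)
  have "(\<Sum>x\<in>#N. f x) \<le> size N" using assms(1) N by (intro sum_mset_le_size) auto
  then show ?thesis using assms(1)[OF assms(3)] assms(2) N by simp
qed

lemma sum_mset_dual:
  assumes "m \<bullet> b = 1" "\<And>x. x \<in># M \<Longrightarrow> x \<noteq> b \<Longrightarrow> m \<bullet> x = 0"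
  shows "(\<Sum>x\<in>#M. m \<bullet> x) = count M b"
  using assms(2) by (induction M) (use assms(1) in auto)

context configuration
begin

text \<open>The intended primitive relations, with labels in place of vectors.\<close>

definition label_rels :: "(label set \<times> label multiset) set" where
  "label_rels =
     {(Lv ` {1..a} \<union> Ly ` {1..b}, replicate_mset (a + b - 1) Lt),
      (Ly ` {1..b} \<union> {Lz}, image_mset Lu (mset_set {1..b})),
      ({Lz, Lt}, {#}),
      ({Lt} \<union> Lu ` {1..b}, image_mset Ly (mset_set {1..b})),
      (Lu ` {1..b} \<union> Lv ` {1..a}, replicate_mset (a + b - 2) Lt)}
     \<union> (\<lambda>j. (wprim j, image_mset (\<lambda>i. al i j) (mset_set {1..l j}))) ` {1..k}"

lemma prims_label_rels: "prims = fst ` label_rels"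
  by (simp add: prims_def base_prims_def label_rels_def image_Un image_image)

lemma label_rels_face:
  assumes "(C, M) \<in> label_rels"
  obtains K r p q \<sigma> where "valid r p q \<sigma>" "set_mset M \<subseteq> fac K r p q \<sigma>"
proof -
  have v: "valid 1 1 1 (\<lambda>_. 1)" using a2 b1 by (auto simp: valid_def)
  have t: "set_mset M \<subseteq> fac VT 1 1 1 (\<lambda>_. 1)" if "set_mset M \<subseteq> {Lt}"
    using that by (auto simp: fac_def labels_iff)
  have yu: "set_mset M \<subseteq> fac YU 1 1 1 (\<lambda>_. 1)" if "set_mset M \<subseteq> Ly ` {1..b} \<union> Lu ` {1..b}"
    using that by (auto simp: fac_def labels_iff)
  have "set_mset M \<subseteq> {Lt} \<or> set_mset M \<subseteq> Ly ` {1..b} \<union> Lu ` {1..b}"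
  proof (cases "\<exists>j\<in>{1..k}. M = image_mset (\<lambda>i. al i j) (mset_set {1..l j})")
    case True
    then obtain j where j: "j \<in> {1..k}" "M = image_mset (\<lambda>i. al i j) (mset_set {1..l j})" by blast
    have "set_mset M \<subseteq> {al i j | i j. i \<in> {1..l j} \<and> j \<in> {1..k}}"
    proof
      fix s assume "s \<in># M"
      then obtain i where "i \<in> {1..l j}" "s = al i j" using j(2) by auto
      then show "s \<in> {al i j | i j. i \<in> {1..l j} \<and> j \<in> {1..k}}" using j(1) by blast
    qed
    then show ?thesis unfolding range_al by blast
  next
    case False
    then show ?thesis using assms by (auto simp: label_rels_def split: if_splits)
  qed
  then show thesis using t yu v that by blast
qed

lemma sum_label_rels:
  fixes g :: "label \<Rightarrow> 'c::real_vector"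
  assumes "rel g" "(C, M) \<in> label_rels"
  shows "sum g C = (\<Sum>s\<in>#M. g s)"
proof -
  have rep: "(\<Sum>s\<in>#replicate_mset n Lt. g s) = real n *\<^sub>R g Lt" for n
    by (induction n) (auto simp: algebra_simps)
  have z: "g Lz = - g Lt" and U: "(\<Sum>i=1..b. g (Lu i)) = (\<Sum>i=1..b. g (Ly i)) - g Lt"
    and V: "(\<Sum>i=1..a. g (Lv i)) = (real a + real b - 1) *\<^sub>R g Lt - (\<Sum>i=1..b. g (Ly i))"
    and W: "\<And>j. j \<in> {1..k} \<Longrightarrow> (\<Sum>i=1..l j + 1. g (Lw i j)) = (\<Sum>i=1..l j. g (al i j))"
    using assms(1) by (auto simp: rel_def)
  have im: "sum g (Lv ` {1..a}) = (\<Sum>i=1..a. g (Lv i))" "sum g (Ly ` {1..b}) = (\<Sum>i=1..b. g (Ly i))"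
    "sum g (Lu ` {1..b}) = (\<Sum>i=1..b. g (Lu i))"
    "\<And>j. sum g (wprim j) = (\<Sum>i=1..l j + 1. g (Lw i j))"
    unfolding wprim_def by (subst sum.reindex; simp add: inj_on_def)+
  have mset: "(\<Sum>s\<in>#image_mset f (mset_set I). g s) = (\<Sum>i\<in>I. g (f i))" for f :: "nat \<Rightarrow> label" and I
    by (simp add: multiset.map_comp comp_def sum_unfold_sum_mset)
  have ab: "real (a + b - 1) = real a + real b - 1" "real (a + b - 2) = real a + real b - 2"
    using a2 b1 by auto
  show ?thesis
    using assms(2) unfolding label_rels_def
  proof (elim UnE insertE imageE emptyE Pair_inject, goal_cases)
    case 1
    have "sum g C = sum g (Lv ` {1..a}) + sum g (Ly ` {1..b})"
      unfolding 1 by (rule sum.union_disjoint) auto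
    then show ?thesis using V unfolding 1 rep ab im by simp
  next
    case 2
    have "sum g C = sum g (Ly ` {1..b}) + sum g {Lz}"
      unfolding 2 by (rule sum.union_disjoint) auto
    then show ?thesis using U z unfolding 2 mset im by simp
  next
    case 3
    then show ?thesis using z by simp
  next
    case 4
    have "sum g C = sum g {Lt} + sum g (Lu ` {1..b})"
      unfolding 4 by (rule sum.union_disjoint) auto
    then show ?thesis using U unfolding 4 mset im by simp
  next
    case 5
    have "sum g C = sum g (Lu ` {1..b}) + sum g (Lv ` {1..a})"
      unfolding 5 by (rule sum.union_disjoint) auto
    moreover have "(real a + real b - 2) *\<^sub>R g Lt = (real a + real b - 1) *\<^sub>R g Lt - g Lt"
      using scaleR_left_diff_distrib[of "real a + real b - 1" 1 "g Lt"] by simp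
    ultimately show ?thesis using U V unfolding 5 rep ab im by simp
  next
    case (6 j)
    then show ?thesis using W[of j] by (simp only: mset im)
  qed
qed

end

context realization
begin

lemma proper_face_in_fac:
  assumes F: "F proper_face_of P"
  obtains K r p q \<sigma> where "valid r p q \<sigma>" "vertices F \<subseteq> pt ` fac K r p q \<sigma>"
proof (cases "F = {}")
  case True
  then have "vertices F = {}" using vertices_subset by blast
  then show thesis using that[OF valid_base] by blast
next
  case False
  have face: "F face_of P" and ne: "F \<noteq> P" using F by (auto simp: proper_face_of_def)
  obtain G where G: "G facet_of P" "F \<subseteq> G"
    by (rule face_of_polyhedron_subset_facet[OF polytope_imp_polyhedron[OF polytope_P] face False ne])
  obtain K r p q \<sigma> where v: "valid r p q \<sigma>" and GK: "G = convex hull (pt ` fac K r p q \<sigma>)"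
    by (rule facet_of_P[OF G(1)])
  have "vertices F \<subseteq> vertices G"
    unfolding vertices_face[OF face] vertices_face[OF facet_of_imp_face_of[OF G(1)]] using G(2) by blast
  then show thesis using that[OF v] unfolding GK fac_vertices[OF v] by blast
qed

lemma fac_proper_face:
  assumes v: "valid r p q \<sigma>" and S: "S \<subseteq> fac K r p q \<sigma>"
  shows "(convex hull (pt ` S)) proper_face_of P" "vertices (convex hull (pt ` S)) = pt ` S"
proof -
  let ?G = "convex hull (pt ` fac K r p q \<sigma>)"
  have "convex hull (pt ` S) \<noteq> P"
  proof
    assume "convex hull (pt ` S) = P"
    then have "P \<subseteq> ?G" using hull_mono[OF image_mono[OF S], of convex pt] by simp
    then show False using fac_is_facet[OF v, of K] facet_of_imp_subset facet_of_irrefl by (metis subset_antisym)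
  qed
  then show "(convex hull (pt ` S)) proper_face_of P" "vertices (convex hull (pt ` S)) = pt ` S"
    using fac_face[OF v S] by (auto simp: proper_face_of_def)
qed

lemma fac_normal_exists:
  assumes v: "valid r p q \<sigma>"
  obtains c where "facet_normal P (convex hull (pt ` fac K r p q \<sigma>)) c"
    "\<And>s. s \<in> fac K r p q \<sigma> \<Longrightarrow> c \<bullet> pt s = 1"
    "\<And>s. s \<in> labels \<Longrightarrow> c \<bullet> pt s \<le> 1"
proof -
  obtain c where c: "facet_normal P (convex hull (pt ` fac K r p q \<sigma>)) c"
    using fac_facet_normal[OF v] by blast
  show thesis
  proof (rule that[OF c])
    show "c \<bullet> pt s = 1" if "s \<in> fac K r p q \<sigma>" for s
      using facet_normal_vertices[OF c] that unfolding fac_vertices[OF v] by blast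
    show "c \<bullet> pt s \<le> 1" if "s \<in> labels" for s
      using facet_normal_int_le[OF c] that unfolding vertices_P by blast
  qed
qed

lemma prim_not_in_fac:
  assumes "valid r p q \<sigma>" "C \<in> prims" "C \<subseteq> fac K r p q \<sigma>"
  shows False
proof -
  obtain c where c: "\<And>s. s \<in> fac K r p q \<sigma> \<Longrightarrow> c \<bullet> pt s = 1" "\<And>s. s \<in> labels \<Longrightarrow> c \<bullet> pt s \<le> 1"
    by (rule fac_normal_exists[OF assms(1), of K]) (rule that)
  show False
    by (rule prims_not_level[OF rel_inner c(2) assms(2)]) (use c(1) assms(3) in blast)+
qed

lemma image_subset_fac:
  assumes "S \<subseteq> labels" "pt ` S \<subseteq> pt ` fac K r p q \<sigma>"
  shows "S \<subseteq> fac K r p q \<sigma>"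
  using inj_on_image_mem_iff[OF inj_pt _ fac_subset] assms by blast

text \<open>A set of vertices spans a proper face if and only if its labels lie in some
  \<^term>\<open>fac K r p q \<sigma>\<close>, that is, if they contain no set from
  \<^term>\<open>prims\<close>. Primitive collections are the minimal sets that violate this, and
  \<^term>\<open>prims\<close> is an antichain.\<close>

lemma primitive_collection_iff:
  "primitive_collection P A \<longleftrightarrow> (\<exists>C\<in>prims. A = pt ` C)"
proof
  assume A: "primitive_collection P A"
  define S where "S = {s\<in>labels. pt s \<in> A}"
  have SL: "S \<subseteq> labels" by (auto simp: S_def)
  have "A \<subseteq> pt ` labels" using A by (simp add: primitive_collection_def vertices_P)
  then have AS: "A = pt ` S" by (auto simp: S_def)
  have "\<exists>C\<in>prims. C \<subseteq> S"
  proof (rule ccontr)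
    assume no: "\<not> ?thesis"
    obtain K r p q \<sigma> where "valid r p q \<sigma>" "S \<subseteq> fac K r p q \<sigma>"
      by (rule subset_fac[OF SL]) (use no in blast)+
    then show False using fac_proper_face(1) A AS by (metis primitive_collection_def)
  qed
  then obtain C where C: "C \<in> prims" "C \<subseteq> S" by blast
  have "S \<subseteq> C"
  proof (rule ccontr)
    assume "\<not> S \<subseteq> C"
    then obtain s where s: "s \<in> S" "s \<notin> C" by blast
    then have "pt s \<in> A" using AS by blast
    then obtain F where F: "F proper_face_of P" "vertices F = A - {pt s}"
      using A unfolding primitive_collection_def by blast
    obtain K r p q \<sigma> where v: "valid r p q \<sigma>" and sub: "vertices F \<subseteq> pt ` fac K r p q \<sigma>"
      by (rule proper_face_in_fac[OF F(1)])
    have "pt ` C \<subseteq> A - {pt s}"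
    proof
      fix x assume "x \<in> pt ` C"
      then obtain s' where s': "s' \<in> C" "x = pt s'" by blast
      then have "s' \<noteq> s" "s' \<in> labels" "s \<in> labels" "s' \<in> S" using s C(2) SL by auto
      then have "pt s' \<noteq> pt s" using inj_onD[OF inj_pt] by blast
      then show "x \<in> A - {pt s}" using \<open>s' \<in> S\<close> unfolding AS s'(2) by blast
    qed
    then have "C \<subseteq> fac K r p q \<sigma>"
      using image_subset_fac[OF prims_subset[OF C(1)]] sub F(2) by simp
    then show False using prim_not_in_fac[OF v C(1)] by blast
  qed
  then show "\<exists>C\<in>prims. A = pt ` C" using C AS by blast
next
  assume "\<exists>C\<in>prims. A = pt ` C"
  then obtain C where C: "C \<in> prims" "A = pt ` C" by blast
  have CL: "C \<subseteq> labels" by (rule prims_subset[OF C(1)])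
  show "primitive_collection P A"
    unfolding primitive_collection_def
  proof (intro conjI ballI notI)
    assume "A = {}"
    then have "C \<subseteq> base" using C by simp
    then show False using prim_not_in_fac[OF valid_base C(1)] unfolding base_def by blast
  next
    show "A \<subseteq> vertices P" unfolding C(2) vertices_P using CL by (rule image_mono)
  next
    assume F: "(convex hull A) proper_face_of P"
    obtain K r p q \<sigma> where v: "valid r p q \<sigma>" and sub: "vertices (convex hull A) \<subseteq> pt ` fac K r p q \<sigma>"
      by (rule proper_face_in_fac[OF F])
    have face: "(convex hull A) face_of P" using F by (simp add: proper_face_of_def)
    have "A \<subseteq> convex hull A" by (rule hull_subset)
    moreover have "A \<subseteq> vertices P" unfolding C(2) vertices_P using CL by (rule image_mono)
    ultimately have "A \<subseteq> vertices P \<inter> convex hull A" by (rule Int_greatest[rotated])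
    then have "A \<subseteq> pt ` fac K r p q \<sigma>" using sub unfolding vertices_face[OF face] by (rule order_trans)
    then have "C \<subseteq> fac K r p q \<sigma>" using image_subset_fac[OF CL] C(2) by simp
    then show False using prim_not_in_fac[OF v C(1)] by blast
  next
    fix x assume "x \<in> A"
    then obtain s where s: "s \<in> C" "x = pt s" using C by blast
    have sub: "C - {s} \<subseteq> labels" using CL by blast
    obtain K r p q \<sigma> where v: "valid r p q \<sigma>" and f: "C - {s} \<subseteq> fac K r p q \<sigma>"
    proof (rule subset_fac[OF sub])
      fix C' assume C': "C' \<in> prims"
      show "\<not> C' \<subseteq> C - {s}"
      proof
        assume "C' \<subseteq> C - {s}"
        then have "C' = C" using prims_antichain[OF C(1) C'] by blast
        with \<open>C' \<subseteq> C - {s}\<close> s show False by blast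
      qed
    qed
    have "pt ` (C - {s}) = A - {x}"
      using inj_on_image_set_diff[OF inj_pt, of C "{s}"] CL s C by auto
    then show "\<exists>F. F proper_face_of P \<and> vertices F = A - {x}"
      using fac_proper_face[OF v f] by metis
  qed
qed

text \<open>A facet normal is one on the vertices of its facet and at most one on all others, so a
  representation by vertices of a facet has the smallest number of terms. Two such representations
  therefore have equally many terms, and the normal of the first facet shows that both use only
  vertices of this facet, which form a basis.\<close>

lemma face_combination_unique:
  fixes M M' :: "(real^'n) multiset"
  assumes v: "valid r p q \<sigma>" and M: "set_mset M \<subseteq> pt ` fac K r p q \<sigma>"
    and v': "valid r' p' q' \<sigma>'" and M': "set_mset M' \<subseteq> pt ` fac K' r' p' q' \<sigma>'"
    and eq: "\<Sum>\<^sub># M = \<Sum>\<^sub># M'"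
  shows "M = M'"
proof -
  have sz: "size N \<le> size N'"
    if "valid r p q \<sigma>" "set_mset N \<subseteq> pt ` fac K r p q \<sigma>" "set_mset N' \<subseteq> pt ` labels" "\<Sum>\<^sub># N = \<Sum>\<^sub># N'"
    for N N' :: "(real^'n) multiset" and K r p q \<sigma>
  proof -
    note vN = that(1)
    obtain c where c: "\<And>s. s \<in> fac K r p q \<sigma> \<Longrightarrow> c \<bullet> pt s = 1" "\<And>s. s \<in> labels \<Longrightarrow> c \<bullet> pt s \<le> 1"
      by (rule fac_normal_exists[OF vN, of K]) (rule that)
    have "(\<Sum>x\<in>#N. c \<bullet> x) = (\<Sum>x\<in>#N. 1)"
      by (intro arg_cong[of _ _ sum_mset] image_mset_cong) (use c that(2) in auto)
    then have "real (size N) = c \<bullet> \<Sum>\<^sub># N'" using that(4) by (simp flip: inner_sum_mset)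
    also have "\<dots> \<le> size N'" unfolding inner_sum_mset
      by (rule sum_mset_le_size) (use c that(3) in auto)
    finally show ?thesis by simp
  qed
  have sub: "set_mset M \<subseteq> pt ` labels" "set_mset M' \<subseteq> pt ` labels"
    using M M' fac_subset by blast+
  have size: "size M = size M'"
    using sz[OF v M sub(2) eq] sz[OF v' M' sub(1) eq[symmetric]] by simp
  obtain c where c: "facet_normal P (convex hull (pt ` fac K r p q \<sigma>)) c"
     "\<And>s. s \<in> fac K r p q \<sigma> \<Longrightarrow> c \<bullet> pt s = 1" "\<And>s. s \<in> labels \<Longrightarrow> c \<bullet> pt s \<le> 1"
    by (rule fac_normal_exists[OF v, of K]) (rule that)
  have "(\<Sum>x\<in>#M. c \<bullet> x) = (\<Sum>x\<in>#M. 1)"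
    by (intro arg_cong[of _ _ sum_mset] image_mset_cong) (use c M in auto)
  then have ge: "(\<Sum>x\<in>#M'. c \<bullet> x) \<ge> size M'"
    using eq size by (simp flip: inner_sum_mset)
  have M'F: "set_mset M' \<subseteq> pt ` fac K r p q \<sigma>"
  proof
    fix x assume x: "x \<in># M'"
    then obtain s where s: "s \<in> labels" "x = pt s" using sub(2) by blast
    have "c \<bullet> x = 1" by (rule sum_mset_eq_size[OF _ ge x]) (use c(3) sub(2) in auto)
    then have "x \<in> vertices (convex hull (pt ` fac K r p q \<sigma>))"
      using facet_normal_vertices[OF c(1)] s by (auto simp: vertices_P)
    then show "x \<in> pt ` fac K r p q \<sigma>" unfolding fac_vertices[OF v] .
  qed
  have "count M x = count M' x" if x: "x \<in> pt ` fac K r p q \<sigma>" for x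
  proof -
    obtain m where m: "m \<bullet> x = 1" "\<And>b'. b' \<in> pt ` fac K r p q \<sigma> \<Longrightarrow> b' \<noteq> x \<Longrightarrow> m \<bullet> b' = 0"
      by (rule lattice_basis_dual[OF fac_basis[OF v] x]) (rule that)
    have "m \<bullet> \<Sum>\<^sub># M = count M x" "m \<bullet> \<Sum>\<^sub># M' = count M' x"
      unfolding inner_sum_mset by (rule sum_mset_dual; use m M M'F in blast)+
    then show ?thesis using eq by simp
  qed
  moreover have "count M x = count M' x" if "x \<notin> pt ` fac K r p q \<sigma>" for x
    using that M M'F by (metis not_in_iff subsetD)
  ultimately show ?thesis by (intro multiset_eqI) blast
qed

theorem primitive_relations_P:
  "primitive_relations P = (\<lambda>(C, M). (pt ` C, image_mset pt M)) ` label_rels"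
proof -
  have sum: "\<Sum>(pt ` C) = \<Sum>\<^sub># (image_mset pt M)" if "(C, M) \<in> label_rels" for C M
  proof -
    have "C \<in> prims" unfolding prims_label_rels using that by force
    then have "inj_on pt C" using inj_on_subset[OF inj_pt] prims_subset by blast
    then have "\<Sum>(pt ` C) = sum pt C" by (simp add: sum.reindex)
    then show ?thesis using sum_label_rels[OF rel_pt that] by simp
  qed
  have nonzero: "\<Sum>\<^sub># (image_mset pt M) \<noteq> 0" if M: "(C, M) \<in> label_rels" "M \<noteq> {#}" for C M
  proof -
    obtain K r p q \<sigma> where v: "valid r p q \<sigma>" and sub: "set_mset M \<subseteq> fac K r p q \<sigma>"
      by (rule label_rels_face[OF M(1)])
    have "\<Sum>\<^sub># (image_mset pt M) = \<Sum>\<^sub># {#} \<Longrightarrow> image_mset pt M = {#}"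
      by (rule face_combination_unique[OF v _ v]) (use sub in auto)
    then show ?thesis using M(2) by auto
  qed
  show ?thesis
  proof (intro set_eqI iffI)
    fix z assume "z \<in> primitive_relations P"
    then obtain A N where z: "z = (A, N)" and A: "primitive_collection P A"
      and N: "\<Sum>A = 0 \<and> N = {#} \<or>
         \<Sum>A \<noteq> 0 \<and> (\<exists>F. F proper_face_of P \<and> vertices F = set_mset N \<and> \<Sum>A = \<Sum>\<^sub># N)"
      by (auto simp: primitive_relations_def)
    obtain C M where CM: "(C, M) \<in> label_rels" and AC: "A = pt ` C"
      using A unfolding primitive_collection_iff prims_label_rels by auto
    obtain K r p q \<sigma> where v: "valid r p q \<sigma>" and sub: "set_mset M \<subseteq> fac K r p q \<sigma>"
      by (rule label_rels_face[OF CM])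
    have "N = image_mset pt M"
      using N
    proof
      assume 0: "\<Sum>A = 0 \<and> N = {#}"
      then have "M = {#}" using nonzero[OF CM] sum[OF CM] AC by auto
      then show ?thesis using 0 by simp
    next
      assume "\<Sum>A \<noteq> 0 \<and> (\<exists>F. F proper_face_of P \<and> vertices F = set_mset N \<and> \<Sum>A = \<Sum>\<^sub># N)"
      then obtain F where F: "F proper_face_of P" "vertices F = set_mset N" "\<Sum>A = \<Sum>\<^sub># N" by blast
      obtain K' r' p' q' \<sigma>' where v': "valid r' p' q' \<sigma>'" and sub': "vertices F \<subseteq> pt ` fac K' r' p' q' \<sigma>'"
        by (rule proper_face_in_fac[OF F(1)])
      show ?thesis
        by (rule face_combination_unique[OF v' _ v]) (use sub' F sub sum[OF CM] AC in auto)
    qed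
    then show "z \<in> (\<lambda>(C, M). (pt ` C, image_mset pt M)) ` label_rels" using z AC CM by force
  next
    fix z assume "z \<in> (\<lambda>(C, M). (pt ` C, image_mset pt M)) ` label_rels"
    then obtain C M where CM: "(C, M) \<in> label_rels" and z: "z = (pt ` C, image_mset pt M)" by auto
    have A: "primitive_collection P (pt ` C)"
      unfolding primitive_collection_iff prims_label_rels using CM by force
    obtain K r p q \<sigma> where v: "valid r p q \<sigma>" and sub: "set_mset M \<subseteq> fac K r p q \<sigma>"
      by (rule label_rels_face[OF CM])
    show "z \<in> primitive_relations P"
    proof (cases "M = {#}")
      case True
      then show ?thesis using A sum[OF CM] z by (simp add: primitive_relations_def)
    next
      case False
      then have "\<Sum>(pt ` C) \<noteq> 0" using nonzero[OF CM] sum[OF CM] by simp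
      moreover have "(convex hull (pt ` set_mset M)) proper_face_of P"
        "vertices (convex hull (pt ` set_mset M)) = set_mset (image_mset pt M)"
        using fac_proper_face[OF v sub] by auto
      ultimately show ?thesis using A sum[OF CM] z unfolding primitive_relations_def by blast
    qed
  qed
qed

end

section \<open>No vertex can be added\<close>

context realization
begin

text \<open>Defined on sets of labels, so that different indices with the same facet give the same
  normal.\<close>

definition normal :: "label set \<Rightarrow> real^'n" where
  "normal S = (SOME c. facet_normal P (convex hull (pt ` S)) c)"

lemma normal_fac:
  assumes v: "valid r p q \<sigma>"
  shows facet_normal_fac: "facet_normal P (convex hull (pt ` fac K r p q \<sigma>)) (normal (fac K r p q \<sigma>))"
    and normal_one: "s \<in> fac K r p q \<sigma> \<Longrightarrow> normal (fac K r p q \<sigma>) \<bullet> pt s = 1"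
proof -
  show n: "facet_normal P (convex hull (pt ` fac K r p q \<sigma>)) (normal (fac K r p q \<sigma>))"
    unfolding normal_def by (rule someI_ex) (rule fac_facet_normal[OF v])
  show "normal (fac K r p q \<sigma>) \<bullet> pt s = 1" if "s \<in> fac K r p q \<sigma>"
    using facet_normal_vertices[OF n] that unfolding fac_vertices[OF v] by blast
qed

lemma normal_values:
  assumes v: "valid r p q \<sigma>"
  shows "normal (fac VT r p q \<sigma>) \<bullet> pt Lz = -1"
    and "normal (fac YT r p q \<sigma>) \<bullet> pt (Lu q) = 0"
    and "normal (fac YT r p q \<sigma>) \<bullet> pt (Lv r) = 0"
    and "normal (fac YU r p q \<sigma>) \<bullet> pt Lz = 0"
    and "normal (fac ZU r p q \<sigma>) \<bullet> pt (Ly p) = 0"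
    and "j \<in> {1..k} \<Longrightarrow> normal (fac YU r p q \<sigma>) \<bullet> pt (Lw (\<sigma> j) j) = 0"
proof -
  note n = fac_normal_values[OF v rel_inner]
  show "normal (fac VT r p q \<sigma>) \<bullet> pt Lz = -1"
    by (rule n(2)[where K = VT]) (use normal_one[OF v] in auto)
  show "normal (fac YT r p q \<sigma>) \<bullet> pt (Lu q) = 0" "normal (fac YT r p q \<sigma>) \<bullet> pt (Lv r) = 0"
    by (rule n(3,4)[where K = YT]; use normal_one[OF v] in auto)+
  show "normal (fac YU r p q \<sigma>) \<bullet> pt Lz = 0"
    by (rule n(5)[where K = YU]) (use normal_one[OF v] in auto)
  show "normal (fac ZU r p q \<sigma>) \<bullet> pt (Ly p) = 0"
    by (rule n(6)[where K = ZU]) (use normal_one[OF v] in auto)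
  show "j \<in> {1..k} \<Longrightarrow> normal (fac YU r p q \<sigma>) \<bullet> pt (Lw (\<sigma> j) j) = 0"
    by (rule n(7)[where K = YU]) (use normal_one[OF v] in auto)
qed

lemma facet_normal_eq_normal:
  assumes v: "valid r p q \<sigma>" and c: "facet_normal P (convex hull (pt ` fac K r p q \<sigma>)) c"
  shows "c = normal (fac K r p q \<sigma>)"
proof (rule basis_functional_eq[OF fac_basis[OF v]])
  fix x assume "x \<in> pt ` fac K r p q \<sigma>"
  then show "c \<bullet> x = normal (fac K r p q \<sigma>) \<bullet> x"
    using facet_normal_vertices[OF c] facet_normal_vertices[OF facet_normal_fac[OF v]]
    unfolding fac_vertices[OF v] by auto
qed

end

locale added_vertex = realization a b k l al pt for a b k l al and pt :: "label \<Rightarrow> real^'n" +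
  fixes Q x
  assumes Q: "smooth_fano Q" and VQ: "vertices Q = insert x (vertices P)" and x: "x \<notin> vertices P"
begin

text \<open>In the polar of \<open>P\<close>, the vertex that belongs to the facet is cut off by
  the new vertex \<open>x\<close>.\<close>

definition cut :: "label set \<Rightarrow> bool" where
  "cut S \<longleftrightarrow> normal S \<bullet> x > 1"

lemma normal_not_one: "valid r p q \<sigma> \<Longrightarrow> normal (fac K r p q \<sigma>) \<bullet> x \<noteq> 1"
  by (rule added_vertex_off_facets[OF smooth_fano_P Q VQ x facet_normal_fac])

lemma cut_step:
  assumes v: "valid r p q \<sigma>" and v': "valid r' p' q' \<sigma>'" and s: "s \<in> fac K r p q \<sigma>"
    and sub: "fac K r p q \<sigma> - {s} \<subseteq> fac K' r' p' q' \<sigma>'" and z: "normal (fac K' r' p' q' \<sigma>') \<bullet> pt s = 0"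
  shows "cut (fac K r p q \<sigma>) \<longleftrightarrow> cut (fac K' r' p' q' \<sigma>')"
  unfolding cut_def
proof (rule added_vertex_same_side[OF smooth_fano_P Q VQ x facet_normal_fac[OF v] facet_normal_fac[OF v']])
  show "pt s \<in> vertices (convex hull (pt ` fac K r p q \<sigma>))" unfolding fac_vertices[OF v] using s by blast
  show "vertices (convex hull (pt ` fac K r p q \<sigma>)) - {pt s} \<subseteq> vertices (convex hull (pt ` fac K' r' p' q' \<sigma>'))"
    unfolding fac_vertices[OF v] fac_vertices[OF v'] using sub by blast
qed (rule z)

lemma cut_YU_YT:
  assumes v: "valid r p q \<sigma>"
  shows "cut (fac YU r p q \<sigma>) \<longleftrightarrow> cut (fac YT r p q \<sigma>)"
proof (rule cut_step[OF v v])
  show "Lu q \<in> fac YU r p q \<sigma>" using v by (auto simp: fac_def labels_iff valid_def)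
  show "fac YU r p q \<sigma> - {Lu q} \<subseteq> fac YT r p q \<sigma>" by (auto simp: fac_def)
  show "normal (fac YT r p q \<sigma>) \<bullet> pt (Lu q) = 0" by (rule normal_values(2)[OF v])
qed

lemma cut_YT_YT:
  assumes v: "valid r p q \<sigma>" and r': "r' \<in> {1..a}"
  shows "cut (fac YT r p q \<sigma>) \<longleftrightarrow> cut (fac YT r' p q \<sigma>)"
proof (cases "r' = r")
  case False
  have v': "valid r' p q \<sigma>" using v r' by (simp add: valid_def)
  show ?thesis
  proof (rule cut_step[OF v v'])
    show "Lv r' \<in> fac YT r p q \<sigma>" using v' False by (auto simp: fac_def labels_iff valid_def)
    show "fac YT r p q \<sigma> - {Lv r'} \<subseteq> fac YT r' p q \<sigma>" by (auto simp: fac_def)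
    show "normal (fac YT r' p q \<sigma>) \<bullet> pt (Lv r') = 0" by (rule normal_values(3)[OF v'])
  qed
qed simp

lemma cut_VT_YT:
  assumes v: "valid r p q \<sigma>"
  shows "cut (fac VT r p q \<sigma>) \<longleftrightarrow> cut (fac YT r p q \<sigma>)"
proof (rule cut_step[OF v v])
  show "Lv r \<in> fac VT r p q \<sigma>" using v by (auto simp: fac_def labels_iff valid_def)
  show "fac VT r p q \<sigma> - {Lv r} \<subseteq> fac YT r p q \<sigma>" by (auto simp: fac_def)
  show "normal (fac YT r p q \<sigma>) \<bullet> pt (Lv r) = 0" by (rule normal_values(3)[OF v])
qed

lemma cut_YU_ZU:
  assumes v: "valid r p q \<sigma>"
  shows "cut (fac YU r p q \<sigma>) \<longleftrightarrow> cut (fac ZU r p q \<sigma>)"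
proof (rule cut_step[OF v v])
  show "Ly p \<in> fac YU r p q \<sigma>" using v by (auto simp: fac_def labels_iff valid_def)
  show "fac YU r p q \<sigma> - {Ly p} \<subseteq> fac ZU r p q \<sigma>" by (auto simp: fac_def)
  show "normal (fac ZU r p q \<sigma>) \<bullet> pt (Ly p) = 0" by (rule normal_values(5)[OF v])
qed

lemma cut_YU_choice:
  assumes v: "valid r p q \<sigma>" and j: "j \<in> {1..k}" and i: "i \<in> {1..l j + 1}"
  shows "cut (fac YU r p q \<sigma>) \<longleftrightarrow> cut (fac YU r p q (\<sigma>(j := i)))"
proof (cases "i = \<sigma> j")
  case False
  have v': "valid r p q (\<sigma>(j := i))" using v i by (simp add: valid_def)
  show ?thesis
  proof (rule cut_step[OF v v'])
    show "Lw i j \<in> fac YU r p q \<sigma>" using i j False by (auto simp: fac_def labels_iff)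
    show "fac YU r p q \<sigma> - {Lw i j} \<subseteq> fac YU r p q (\<sigma>(j := i))" by (auto simp: fac_def)
    show "normal (fac YU r p q (\<sigma>(j := i))) \<bullet> pt (Lw i j) = 0"
      using normal_values(6)[OF v' j] by simp
  qed
qed simp

text \<open>Walls of degree one lead from \<^term>\<open>YU\<close> to \<^term>\<open>YT\<close>
  and back with a different omitted \<open>v\<^sub>r\<close>. The choice \<open>\<sigma>\<close>
  is changed within the kind \<^term>\<open>YU\<close>, where all
  \<open>\<alpha>\<^sub>i\<^sub>j\<close> are present and the relation of \<open>w\<^sub>j\<close>
  is a wall relation; this is done for one \<open>j\<close> after the other.\<close>

lemma cut_YU_all:
  assumes v: "valid r p q \<sigma>"
  shows "cut (fac YU r p q \<sigma>) \<longleftrightarrow> cut (fac YU 1 1 1 (\<lambda>_. 1))"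
proof -
  have one: "1 \<in> {1..a}" using a2 by simp
  have v1: "valid 1 p q \<sigma>" using v one by (simp add: valid_def)
  have "cut (fac YU r p q \<sigma>) \<longleftrightarrow> cut (fac YU 1 p q \<sigma>)"
    using cut_YU_YT[OF v] cut_YT_YT[OF v one] cut_YU_YT[OF v1] by simp
  moreover have flips: "cut (fac YU 1 p q \<sigma>) \<longleftrightarrow> cut (fac YU 1 p q (\<lambda>j. if j \<le> m then 1 else \<sigma> j))"
    if "m \<le> k" for m
    using that
  proof (induction m)
    case 0
    have "fac YU 1 p q (\<lambda>j. if j \<le> 0 then 1 else \<sigma> j) = fac YU 1 p q \<sigma>"
      unfolding fac_def by (intro arg_cong2[of _ _ _ _ minus] image_cong) auto
    then show ?case by simp
  next
    case (Suc m)
    let ?s = "\<lambda>j. if j \<le> m then 1 else \<sigma> j"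
    have "valid 1 p q ?s" using v1 by (auto simp: valid_def)
    then have "cut (fac YU 1 p q ?s) \<longleftrightarrow> cut (fac YU 1 p q (?s(Suc m := 1)))"
      by (rule cut_YU_choice) (use Suc in auto)
    moreover have "?s(Suc m := 1) = (\<lambda>j. if j \<le> Suc m then 1 else \<sigma> j)" by (auto simp: le_Suc_eq)
    ultimately show ?case using Suc by simp
  qed
  moreover have "fac YU 1 p q (\<lambda>j. if j \<le> k then 1 else \<sigma> j) = fac YU 1 1 1 (\<lambda>_. 1)"
  proof -
    have "(\<lambda>j. Lw (if j \<le> k then 1 else \<sigma> j) j) ` {1..k} = (\<lambda>j. Lw 1 j) ` {1..k}"
      by (rule image_cong) auto
    then show ?thesis by (simp add: fac_def)
  qed
  ultimately show ?thesis using flips[OF order_refl] by simp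
qed

lemma cut_all:
  assumes v: "valid r p q \<sigma>" and K: "K \<noteq> VZ"
  shows "cut (fac K r p q \<sigma>) \<longleftrightarrow> cut (fac YU 1 1 1 (\<lambda>_. 1))"
  using K cut_YU_all[OF v] cut_YU_YT[OF v] cut_VT_YT[OF v] cut_YU_ZU[OF v] by (cases K) auto

text \<open>The facets through \<open>t\<close> are of the kinds \<^term>\<open>VT\<close> and
  \<^term>\<open>YT\<close>, and one of them survives since \<open>t\<close> remains a
  vertex.\<close>

lemma not_cut:
  assumes v: "valid r p q \<sigma>" and K: "K \<noteq> VZ"
  shows "\<not> cut (fac K r p q \<sigma>)"
proof -
  have "pt Lt \<in> vertices P" by (simp add: vertices_P labels_iff)
  then obtain G c where G: "facet_normal P G c" "pt Lt \<in> vertices G" "c \<bullet> x \<le> 1"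
    by (rule added_vertex_keeps_vertex[OF smooth_fano_P Q VQ])
  have "G facet_of P" using G(1) unfolding facet_normal_def by (rule conjunct1)
  then obtain K' r' p' q' \<sigma>' where v': "valid r' p' q' \<sigma>'" and GK: "G = convex hull (pt ` fac K' r' p' q' \<sigma>')"
    by (rule facet_of_P)
  have "Lt \<in> fac K' r' p' q' \<sigma>'"
    using G(2) image_subset_fac[of "{Lt}"] unfolding GK fac_vertices[OF v'] by (auto simp: labels_iff)
  then have "K' \<noteq> VZ" by (auto simp: fac_def)
  moreover have "\<not> cut (fac K' r' p' q' \<sigma>')"
    using G(3) facet_normal_eq_normal[OF v'] G(1) unfolding GK cut_def by fastforce
  ultimately show ?thesis using cut_all[OF v K] cut_all[OF v'] by simp
qed

text \<open>So \<open>x\<close> lies in the cone over a facet of kind \<^term>\<open>VZ\<close>.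
  The edge of the polar from its normal to that of the neighbour of kind \<^term>\<open>VT\<close>
  has length two and is cut at its midpoint. Hence the coefficients of \<open>x\<close> other than
  that of \<open>z\<close> add up to one, and some \<open>v\<^sub>r\<close> does not occur in
  \<open>x\<close>. Then a facet of kind \<^term>\<open>YU\<close> takes the forbidden value one
  on \<open>x\<close>.\<close>

lemma no_added_vertex: False
proof -
  have x_lattice: "x \<in> int_lattice" using smooth_fano_lattice_vertices[OF Q] VQ by blast
  obtain G d where G: "G facet_of P" and d: "\<And>v. v \<in> vertices G \<Longrightarrow> 0 \<le> d v"
    "x = (\<Sum>v\<in>vertices G. d v *\<^sub>R v)"
    by (rule smooth_fano_cone[OF smooth_fano_P, of x]) (rule that)
  obtain K r p q \<sigma> where v: "valid r p q \<sigma>" and GK: "G = convex hull (pt ` fac K r p q \<sigma>)"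
    by (rule facet_of_P[OF G])
  define S where "S = fac K r p q \<sigma>"
  define e where "e s = d (pt s)" for s
  have finS: "finite S" unfolding S_def using finite_subset[OF fac_subset finite_labels] .
  have SL: "S \<subseteq> labels" unfolding S_def by (rule fac_subset)
  have VG: "vertices G = pt ` S" unfolding GK S_def by (rule fac_vertices[OF v])
  have xe: "x = (\<Sum>s\<in>S. e s *\<^sub>R pt s)"
    unfolding d(2) VG e_def using inj_on_subset[OF inj_pt SL] by (simp add: sum.reindex)
  have e0: "e s \<ge> 0" if "s \<in> S" for s unfolding e_def by (rule d(1)) (use that VG in blast)
  have cx: "c \<bullet> x = (\<Sum>s\<in>S. e s * (c \<bullet> pt s))" for c by (simp add: xe inner_sum_right)
  have eint: "e s \<in> \<int>" if s: "s \<in> S" for s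
  proof -
    obtain c where c: "c \<in> int_lattice" "\<And>s'. s' \<in> fac K r p q \<sigma> \<Longrightarrow> c \<bullet> pt s' = (if s' = s then 1 else 0)"
      by (rule fac_functional[OF v, of "\<lambda>s'. if s' = s then 1 else 0" K]) auto
    have "c \<bullet> x = (\<Sum>s'\<in>S. if s' = s then e s else 0)"
      unfolding cx by (rule sum.cong) (use c(2) in \<open>auto simp: S_def\<close>)
    then have "c \<bullet> x = e s" using finS s by simp
    then show ?thesis using int_lattice_inner[OF c(1) x_lattice] by simp
  qed
  have nx: "normal S \<bullet> x = (\<Sum>s\<in>S. e s)"
    unfolding cx by (rule sum.cong) (use normal_one[OF v] in \<open>auto simp: S_def\<close>)
  have xnz: "x \<noteq> 0"
  proof
    assume "x = 0"
    then have "0 extreme_point_of Q" using VQ by (auto simp: vertices_def)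
    then show False using extreme_point_not_in_interior[of 0 Q] smooth_fano_interior[OF Q] by blast
  qed
  have "(\<Sum>s\<in>S. e s) \<noteq> 0"
  proof
    assume "(\<Sum>s\<in>S. e s) = 0"
    then have "\<And>s. s \<in> S \<Longrightarrow> e s = 0" using sum_nonneg_0[of S e] finS e0 by blast
    then show False using xnz unfolding xe by simp
  qed
  moreover have "(\<Sum>s\<in>S. e s) \<ge> 0" by (rule sum_nonneg) (rule e0)
  moreover have "(\<Sum>s\<in>S. e s) \<in> \<int>" by (rule Ints_sum) (rule eint)
  ultimately have "normal S \<bullet> x \<ge> 1" unfolding nx by (auto elim!: Ints_cases)
  then have cutS: "normal S \<bullet> x > 1" using normal_not_one[OF v, of K] unfolding S_def by linarith
  then have K: "K = VZ" using not_cut[OF v] unfolding cut_def S_def by blast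
  let ?c = "normal (fac VT r p q \<sigma>)"
  have small: "?c \<bullet> x < 1"
    using not_cut[OF v, of VT] normal_not_one[OF v, of VT] unfolding cut_def by simp
  have zS: "Lz \<in> S" using K by (auto simp: S_def fac_def labels_iff)
  have sub: "S - {Lz} \<subseteq> fac VT r p q \<sigma>" using K by (auto simp: S_def fac_def)
  have cz: "?c \<bullet> pt Lz = -1" by (rule normal_values(1)[OF v])
  obtain \<theta> :: real where \<theta>: "0 < \<theta>" "\<theta> < 1" "\<theta> * (1 - ?c \<bullet> pt Lz) \<in> \<int>"
      "(1 - \<theta>) * (normal S \<bullet> x) + \<theta> * (?c \<bullet> x) = 1"
  proof (rule added_vertex_cuts_edge[OF smooth_fano_P Q VQ x])
    show "facet_normal P (convex hull (pt ` S)) (normal S)"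
      unfolding S_def by (rule facet_normal_fac[OF v])
    show "facet_normal P (convex hull (pt ` fac VT r p q \<sigma>)) ?c" by (rule facet_normal_fac[OF v])
    show "pt Lz \<in> vertices (convex hull (pt ` S))" unfolding S_def fac_vertices[OF v] using zS S_def by blast
    show "vertices (convex hull (pt ` S)) - {pt Lz} \<subseteq> vertices (convex hull (pt ` fac VT r p q \<sigma>))"
      unfolding S_def fac_vertices[OF v] using sub S_def by blast
    show "(normal S \<bullet> x - 1) * (?c \<bullet> x - 1) < 0"
      using cutS small by (simp add: mult_less_0_iff)
  qed (rule that)
  have "\<theta> = 1/2"
  proof -
    obtain i where "\<theta> * 2 = of_int i" using \<theta>(3) cz by (auto elim!: Ints_cases)
    with \<theta>(1,2) have "0 < i" "i < 2" by linarith+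
    then show ?thesis using \<open>\<theta> * 2 = of_int i\<close> by simp
  qed
  with \<theta>(4) have "(1 - 1/2) * (normal S \<bullet> x) + 1/2 * (?c \<bullet> x) = 1" by (simp only:)
  then have mid: "normal S \<bullet> x + ?c \<bullet> x = 2" by (simp add: field_simps)
  let ?R = "\<Sum>s\<in>S - {Lz}. e s"
  have split: "c \<bullet> x = e Lz * (c \<bullet> pt Lz) + (\<Sum>s\<in>S - {Lz}. e s * (c \<bullet> pt s))" for c
    unfolding cx by (rule sum.remove[OF finS zS])
  have "(\<Sum>s\<in>S - {Lz}. e s * (?c \<bullet> pt s)) = ?R"
    by (rule sum.cong) (use sub normal_one[OF v] in auto)
  then have "?c \<bullet> x = ?R - e Lz" using split[of ?c] cz by simp
  moreover have "normal S \<bullet> x = ?R + e Lz"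
    unfolding nx using sum.remove[OF finS zS, of e] by simp
  ultimately have R1: "?R = 1" using mid by simp
  have "\<exists>r'\<in>{1..a}. e (Lv r') = 0"
  proof (rule ccontr)
    assume no: "\<not> ?thesis"
    have ge1: "e (Lv i) \<ge> 1" if "i \<in> {1..a}" for i
    proof -
      have "Lv i \<in> S" using that K by (auto simp: S_def fac_def labels_iff)
      moreover have "e (Lv i) \<noteq> 0" using no that by blast
      ultimately show ?thesis using e0[of "Lv i"] eint[of "Lv i"] by (auto elim!: Ints_cases)
    qed
    have "(\<Sum>s\<in>{Lv 1, Lv 2}. e s) \<le> ?R"
      by (rule sum_mono2) (use finS K a2 e0 in \<open>auto simp: S_def fac_def labels_iff\<close>)
    then show False using R1 ge1[of 1] ge1[of 2] a2 by simp
  qed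
  then obtain r' where r': "r' \<in> {1..a}" "e (Lv r') = 0" by blast
  have v': "valid r' p q \<sigma>" using v r' by (simp add: valid_def)
  let ?c' = "normal (fac YU r' p q \<sigma>)"
  have "(\<Sum>s\<in>S - {Lz}. e s * (?c' \<bullet> pt s)) = ?R"
  proof (rule sum.cong)
    fix s assume s: "s \<in> S - {Lz}"
    show "e s * (?c' \<bullet> pt s) = e s"
    proof (cases "s = Lv r'")
      case False
      then have "s \<in> fac YU r' p q \<sigma>" using s K by (auto simp: S_def fac_def)
      then show ?thesis using normal_one[OF v'] by simp
    qed (simp add: r')
  qed simp
  moreover have "?c' \<bullet> pt Lz = 0" by (rule normal_values(4)[OF v'])
  ultimately have "?c' \<bullet> x = 1" using split[of ?c'] R1 by simp
  then show False using normal_not_one[OF v', of YU] by blast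
qed

end

section \<open>No vertex can be removed\<close>

context realization
begin

lemma removed_vertex_nonneg:
  assumes Q: "smooth_fano Q" and VQ: "vertices Q = pt ` (labels - {s0})" and s0: "s0 \<in> labels"
    and g: "rel g" and nn: "\<And>s. s \<in> labels \<Longrightarrow> s \<noteq> s0 \<Longrightarrow> g s \<ge> 0"
  shows "g s0 = (0::real)"
proof -
  obtain c where c: "\<And>s. s \<in> labels \<Longrightarrow> c \<bullet> pt s = g s" by (rule functional[OF g]) (rule that)
  have "c = 0"
  proof (rule smooth_fano_nonneg_functional[OF Q])
    fix y assume "y \<in> vertices Q"
    then obtain s where "s \<in> labels" "s \<noteq> s0" "y = pt s" unfolding VQ by blast
    then show "0 \<le> c \<bullet> y" using c nn by simp
  qed
  then show ?thesis using c[OF s0] by simp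
qed

text \<open>The second relation of lemma \<open>vertex_not_removable\<close> is that of a block
  \<open>w\<^sub>j\<close> with \<open>s0\<close> among the
  \<open>\<alpha>\<^sub>i\<^sub>j\<close>. All \<open>y\<^sub>i\<close> and
  \<open>u\<^sub>i\<close> lie in a common facet of kind \<^term>\<open>YU\<close>.\<close>

lemma not_removable_yu:
  assumes Q: "smooth_fano Q" and VQ: "vertices Q = pt ` (labels - {s0})" and s0: "s0 \<in> labels"
    and j: "j \<in> {1..k}" and al0: "al i0 j = s0" "i0 \<in> {1..l j}"
    and A: "A \<subseteq> labels" "s0 \<notin> A" "sum pt A = sum pt M" "card A = card M + 1" "Lw 1 j \<notin> A"
    and M: "M \<subseteq> Ly ` {1..b} \<union> Lu ` {1..b}" "s0 \<in> M"
  shows False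
proof -
  have v: "valid 1 1 1 (\<lambda>_. 1)" using a2 b1 by (auto simp: valid_def)
  let ?S = "fac YU 1 1 1 (\<lambda>_. 1)"
  have yu: "Ly ` {1..b} \<union> Lu ` {1..b} \<subseteq> ?S" by (auto simp: fac_def labels_iff)
  have alS: "(\<lambda>i. al i j) ` {1..l j} \<subseteq> Ly ` {1..b} \<union> Lu ` {1..b}"
    unfolding range_al[symmetric] using j by blast
  have Msub: "M \<subseteq> labels" using M yu fac_subset by blast
  have Wsub: "wprim j \<subseteq> labels" using j by (auto simp: wprim_def labels_iff)
  have W1: "Lw 1 j \<in> wprim j" "Lw 1 j \<in> labels" using j by (auto simp: wprim_def labels_iff)
  have s0yu: "s0 \<in> Ly ` {1..b} \<union> Lu ` {1..b}" using M by blast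
  have inj: "inj_on pt A" "inj_on pt M" "inj_on pt (wprim j)"
    using inj_on_subset[OF inj_pt] A Msub Wsub by blast+
  have notin: "pt s \<notin> pt ` X" if "s \<in> labels" "X \<subseteq> labels" "s \<notin> X" for s X
    using that inj_on_image_mem_iff[OF inj_pt] by blast
  show False
  proof (rule vertex_not_removable[OF smooth_fano_P Q, where x = "pt s0" and A = "pt ` A" and M = "pt ` M"
        and W = "pt ` wprim j" and f = "\<lambda>i. pt (al i j)" and I = "{1..l j}" and w = "pt (Lw 1 j)"
        and G = "convex hull (pt ` ?S)"])
    show "vertices P = insert (pt s0) (vertices Q)" unfolding vertices_P VQ using s0 by blast
    show "pt s0 \<notin> vertices Q" unfolding VQ by (rule notin) (use s0 in auto)
    show "pt ` A \<subseteq> vertices Q" unfolding VQ by (rule image_mono) (use A in auto)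
    show "\<Sum>(pt ` A) = \<Sum>(pt ` M)" using A(3) inj by (simp add: sum.reindex)
    show "card (pt ` A) = card (pt ` M) + 1" using A(4) inj by (simp add: card_image)
    show "pt s0 \<in> pt ` M" using M by blast
    show "pt ` wprim j \<subseteq> vertices Q" unfolding VQ
      by (rule image_mono) (use Wsub s0yu in \<open>auto simp: wprim_def\<close>)
    have "\<Sum>(pt ` wprim j) = sum pt (wprim j)" using inj by (simp add: sum.reindex)
    also have "\<dots> = (\<Sum>i=1..l j + 1. pt (Lw i j))"
      unfolding wprim_def by (subst sum.reindex) (simp_all add: inj_on_def)
    also have "\<dots> = (\<Sum>i=1..l j. pt (al i j))" using rel_pt j by (simp add: rel_def)
    finally show "\<Sum>(pt ` wprim j) = (\<Sum>i=1..l j. pt (al i j))" .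
    have "card (wprim j) = l j + 1" unfolding wprim_def by (subst card_image) (auto simp: inj_on_def)
    then show "card (pt ` wprim j) = card {1..l j} + 1" using inj by (simp add: card_image)
    show "finite {1..l j}" by simp
    show "pt s0 \<in> (\<lambda>i. pt (al i j)) ` {1..l j}" using al0 by blast
    show "convex hull (pt ` ?S) facet_of P" by (rule fac_is_facet[OF v])
    show "pt ` M \<union> (\<lambda>i. pt (al i j)) ` {1..l j} \<subseteq> vertices (convex hull (pt ` ?S))"
      unfolding fac_vertices[OF v] using M(1) yu alS by blast
    show "pt (Lw 1 j) \<in> pt ` wprim j" using W1 by blast
    show "pt (Lw 1 j) \<notin> pt ` A" by (rule notin) (use W1 A in auto)
    show "pt (Lw 1 j) \<notin> pt ` M" by (rule notin) (use W1 Msub M in auto)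
    have "pt (Lw 1 j) \<notin> pt ` (\<lambda>i. al i j) ` {1..l j}"
      by (rule notin) (use W1 alS yu fac_subset in \<open>blast+\<close>)
    then show "pt (Lw 1 j) \<notin> (\<lambda>i. pt (al i j)) ` {1..l j}" by (simp add: image_image)
  qed
qed

text \<open>For \<open>v\<^sub>r\<close> and \<open>w\<^sub>i\<^sub>j\<close> the functional that
  separates the vertex from the others is the difference of two coordinates in the same block; for
  \<open>z\<close> it takes the value one at \<open>t\<close> and at a single
  \<open>y\<^sub>1\<close>, and the remaining values are chosen to satisfy the relations. For
  \<open>t\<close>, a facet normal of \<open>Q\<close> has an integral value of at least two,
  while \<open>(a + b - 1) t\<close> is a sum of only \<open>a + b\<close> vertices of
  \<open>Q\<close>. The \<open>y\<^sub>i\<close> and \<open>u\<^sub>i\<close> are excluded by the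
  relations \<open>t + \<Sum>u = \<Sum>y\<close> and \<open>z + \<Sum>y = \<Sum>u\<close> of
  degree one.\<close>

lemma no_removed_vertex:
  assumes Q: "smooth_fano Q" and V: "vertices P = insert x (vertices Q)" and x: "x \<notin> vertices Q"
  shows False
proof -
  have "x \<in> pt ` labels" using V vertices_P by blast
  then obtain s0 where s0: "s0 \<in> labels" "x = pt s0" by blast
  have "vertices Q = pt ` labels - {pt s0}" using V x s0 unfolding vertices_P by blast
  also have "\<dots> = pt ` (labels - {s0})" using inj_on_image_set_diff[OF inj_pt, of labels "{s0}"] s0 by simp
  finally have VQ: "vertices Q = pt ` (labels - {s0})" .
  note pos = removed_vertex_nonneg[OF Q VQ s0(1)]
  have z: "pt Lz = - pt Lt" and U: "(\<Sum>i=1..b. pt (Lu i)) = (\<Sum>i=1..b. pt (Ly i)) - pt Lt"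
    and V: "(\<Sum>i=1..a. pt (Lv i)) = (real a + real b - 1) *\<^sub>R pt Lt - (\<Sum>i=1..b. pt (Ly i))"
    using rel_pt by (auto simp: rel_def)
  have im: "sum pt (Ly ` {1..b}) = (\<Sum>i=1..b. pt (Ly i))" "sum pt (Lu ` {1..b}) = (\<Sum>i=1..b. pt (Lu i))"
    by (subst sum.reindex; simp add: inj_on_def)+
  show False
  proof (cases s0)
    case (Lv r)
    then have r: "r \<in> {1..a}" using s0 by (simp add: labels_iff)
    obtain r' where r': "r' \<in> {1..a}" "r' \<noteq> r"
      using a2 by (cases "r = 1") (auto intro: that[of 1] that[of 2])
    define g :: "label \<Rightarrow> real" where "g = (\<lambda>s. (if s = label.Lv r' then 1 else 0) - (if s = label.Lv r then 1 else 0))"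
    have "g (al i j) = 0" if "i \<in> {1..l j}" "j \<in> {1..k}" for i j
      using that by (rule al_cases) (auto simp: g_def)
    then have "rel g" using r r' by (simp add: rel_def g_def sum_subtractf)
    then have "g s0 = 0" by (rule pos) (use Lv in \<open>auto simp: g_def\<close>)
    then show False using Lv r' by (simp add: g_def)
  next
    case (Lw i0 j0)
    then have i0: "j0 \<in> {1..k}" "i0 \<in> {1..l j0 + 1}" using s0 by (simp_all add: labels_iff)
    obtain i1 where i1: "i1 \<in> {1..l j0 + 1}" "i1 \<noteq> i0"
      using l1[OF i0(1)] by (cases "i0 = 1") (auto intro: that[of 1] that[of 2])
    define g :: "label \<Rightarrow> real" where "g = (\<lambda>s. (if s = label.Lw i1 j0 then 1 else 0) - (if s = label.Lw i0 j0 then 1 else 0))"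
    have "g (al i j) = 0" if "i \<in> {1..l j}" "j \<in> {1..k}" for i j
      using that by (rule al_cases) (auto simp: g_def)
    moreover have "(\<Sum>i=1..l j + 1. g (label.Lw i j)) = 0" if "j \<in> {1..k}" for j
      unfolding g_def sum_subtractf using i0 i1 by (cases "j = j0") (simp_all del: sum.cl_ivl_Suc)
    ultimately have "rel g" by (simp add: rel_def g_def[THEN fun_cong] del: sum.cl_ivl_Suc)
    then have "g s0 = 0" by (rule pos) (use Lw in \<open>auto simp: g_def\<close>)
    then show False using Lw i1 by (simp add: g_def)
  next
    case Lz
    define g :: "label \<Rightarrow> real" where "g = (\<lambda>s. case s of
        label.Lv i \<Rightarrow> if i = 1 then real a + real b - 2 else 0 | Ly i \<Rightarrow> if i = 1 then 1 else 0
      | label.Lz \<Rightarrow> -1 | Lt \<Rightarrow> 1 | Lu i \<Rightarrow> 0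
      | label.Lw i j \<Rightarrow> if i = 1 then (\<Sum>i=1..l j. if al i j = Ly 1 then 1 else 0) else 0)"
    have gal: "g (al i j) = (if al i j = Ly 1 then 1 else 0)" if "i \<in> {1..l j}" "j \<in> {1..k}" for i j
      using that by (rule al_cases) (auto simp: g_def)
    have "rel g"
      unfolding rel_def
    proof (intro conjI ballI)
      fix j assume j: "j \<in> {1..k}"
      have "(\<Sum>i=1..l j + 1. g (label.Lw i j)) = (\<Sum>i=1..l j. if al i j = Ly 1 then 1 else 0)"
        unfolding g_def by (simp del: sum.cl_ivl_Suc)
      also have "\<dots> = (\<Sum>i=1..l j. g (al i j))" by (rule sum.cong) (use gal j in auto)
      finally show "(\<Sum>i=1..l j + 1. g (label.Lw i j)) = (\<Sum>i=1..l j. g (al i j))" .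
    qed (use a2 b1 in \<open>simp_all add: g_def\<close>)
    then have "g s0 = 0"
      by (rule pos) (use Lz a2 b1 in \<open>auto simp: g_def intro!: sum_nonneg split: label.splits\<close>)
    then show False using Lz by (simp add: g_def)
  next
    case Lt
    have xP: "smooth_fano P" by (rule smooth_fano_P)
    have xl: "x \<in> int_lattice" unfolding s0(2) by (rule pt_lattice[OF s0(1)])
    obtain F d where F: "F facet_of Q" and d: "\<And>v. v \<in> vertices F \<Longrightarrow> 0 \<le> d v"
      "x = (\<Sum>v\<in>vertices F. d v *\<^sub>R v)"
      by (rule smooth_fano_cone[OF Q, of x]) (rule that)
    obtain h where h: "facet_normal Q F h" by (rule smooth_fano_facet_normal[OF Q F])
    have hx: "h \<bullet> x = (\<Sum>v\<in>vertices F. d v)" unfolding d(2) by (rule facet_normal_cone[OF h])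
    have "h \<bullet> x \<noteq> 1" by (rule added_vertex_off_facets[OF Q smooth_fano_P assms(2) x h])
    moreover have "h \<bullet> x \<ge> 0" unfolding hx by (rule sum_nonneg) (rule d(1))
    moreover have "h \<bullet> x \<noteq> 0"
    proof
      assume "h \<bullet> x = 0"
      moreover have "finite (vertices F)"
        using smooth_fano_facet_basis[OF Q F] by (simp add: is_lattice_basis_def)
      ultimately have "\<And>v. v \<in> vertices F \<Longrightarrow> d v = 0"
        using sum_nonneg_0[of "vertices F" d] d(1) hx by metis
      then have "x = 0" unfolding d(2) by simp
      moreover have "x \<in> vertices P" using assms(2) by blast
      ultimately have "0 extreme_point_of P" by (simp add: vertices_def)
      then show False using extreme_point_not_in_interior zero_interior_P by blast
    qed
    moreover have "h \<bullet> x \<in> \<int>" by (rule facet_normal_Ints[OF h xl])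
    ultimately have two: "h \<bullet> x \<ge> 2" by (auto elim!: Ints_cases)
    have hle: "h \<bullet> pt s \<le> 1" if "s \<in> labels" "s \<noteq> s0" for s
      by (rule facet_normal_int_le[OF h]) (use that VQ in blast)
    have "(\<Sum>i=1..a. h \<bullet> pt (label.Lv i)) \<le> (\<Sum>i=1..a. 1)"
      by (rule sum_mono, rule hle) (use Lt in \<open>auto simp: labels_iff\<close>)
    moreover have "(\<Sum>i=1..b. h \<bullet> pt (Ly i)) \<le> (\<Sum>i=1..b. 1)"
      by (rule sum_mono, rule hle) (use Lt in \<open>auto simp: labels_iff\<close>)
    moreover have "(\<Sum>i=1..a. h \<bullet> pt (label.Lv i)) + (\<Sum>i=1..b. h \<bullet> pt (Ly i)) = (real a + real b - 1) * (h \<bullet> x)"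
      using arg_cong[OF V, of "\<lambda>z. h \<bullet> z"] Lt s0(2) by (simp add: inner_sum_right inner_diff_right)
    moreover have "(real a + real b - 1) * (h \<bullet> x) \<ge> (real a + real b - 1) * 2"
      using two a2 by (intro mult_left_mono) auto
    ultimately show False using a2 b1 by simp
  next
    case (Ly p0)
    then have "s0 \<in> {al i j | i j. i \<in> {1..l j} \<and> j \<in> {1..k}}" using s0 unfolding range_al by (auto simp: labels_iff)
    then obtain i0 j0 where ij: "s0 = al i0 j0" "i0 \<in> {1..l j0}" "j0 \<in> {1..k}" by blast
    have "sum pt ({Lt} \<union> Lu ` {1..b}) = sum pt {Lt} + sum pt (Lu ` {1..b})"
      by (rule sum.union_disjoint) auto
    then have "sum pt ({Lt} \<union> Lu ` {1..b}) = sum pt (label.Ly ` {1..b})" using U unfolding im by simp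
    moreover have "card ({Lt} \<union> Lu ` {1..b}) = card (label.Ly ` {1..b}) + 1"
      by (subst card_Un_disjoint) (auto simp: card_image inj_on_def)
    ultimately show False
      by (intro not_removable_yu[OF Q VQ s0(1) ij(3) ij(1)[symmetric] ij(2), of "{Lt} \<union> Lu ` {1..b}" "label.Ly ` {1..b}"])
        (use s0(1) Ly in \<open>auto simp: labels_iff\<close>)
  next
    case (Lu q0)
    then have "s0 \<in> {al i j | i j. i \<in> {1..l j} \<and> j \<in> {1..k}}" using s0 unfolding range_al by (auto simp: labels_iff)
    then obtain i0 j0 where ij: "s0 = al i0 j0" "i0 \<in> {1..l j0}" "j0 \<in> {1..k}" by blast
    have "sum pt ({label.Lz} \<union> Ly ` {1..b}) = sum pt {label.Lz} + sum pt (Ly ` {1..b})"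
      by (rule sum.union_disjoint) auto
    then have "sum pt ({label.Lz} \<union> Ly ` {1..b}) = sum pt (label.Lu ` {1..b})" using U z unfolding im by simp
    moreover have "card ({label.Lz} \<union> Ly ` {1..b}) = card (label.Lu ` {1..b}) + 1"
      by (subst card_Un_disjoint) (auto simp: card_image inj_on_def)
    ultimately show False
      by (intro not_removable_yu[OF Q VQ s0(1) ij(3) ij(1)[symmetric] ij(2), of "{label.Lz} \<union> Ly ` {1..b}" "label.Lu ` {1..b}"])
        (use s0(1) Lu in \<open>auto simp: labels_iff\<close>)
  qed
qed

lemma no_I_step:
  assumes Q: "smooth_fano Q"
  shows "\<not> I_step Q P"
proof
  assume "I_step Q P"
  then consider x where "x \<notin> vertices Q" "vertices P = insert x (vertices Q)"
    | x where "x \<notin> vertices P" "vertices Q = insert x (vertices P)"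
    unfolding I_step_def by auto
  then show False
  proof cases
    case 1
    then show False using no_removed_vertex[OF Q] by blast
  next
    case 2
    then interpret added_vertex a b k l al pt Q x by unfold_locales (use Q in auto)
    show False by (rule no_added_vertex)
  qed
qed

end

section \<open>Isolation\<close>

lemma lattice_basis_image:
  fixes f :: "real^'n \<Rightarrow> real^'n"
  assumes f: "linear f" "inj f" "f ` int_lattice = int_lattice" and B: "is_lattice_basis B"
  shows "is_lattice_basis (f ` B)"
proof -
  have fin: "finite B" and sub: "B \<subseteq> int_lattice" using B by (auto simp: is_lattice_basis_def)
  have ind: "\<And>c :: real^'n \<Rightarrow> int. (\<Sum>v\<in>B. of_int (c v) *\<^sub>R v) = 0 \<Longrightarrow> \<forall>v\<in>B. c v = 0"
    using B unfolding is_lattice_basis_def by blast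
  have comb: "(\<Sum>v\<in>f ` B. of_int (c v) *\<^sub>R v) = f (\<Sum>v\<in>B. of_int (c (f v)) *\<^sub>R v)" for c :: "real^'n \<Rightarrow> int"
    using inj_on_subset[OF f(2)]
    by (subst sum.reindex) (auto simp: linear_sum[OF f(1)] linear_cmul[OF f(1)])
  show ?thesis
    unfolding is_lattice_basis_def
  proof (intro conjI allI impI ballI)
    fix c :: "real^'n \<Rightarrow> int" and w
    assume c: "(\<Sum>v\<in>f ` B. of_int (c v) *\<^sub>R v) = 0" and w: "w \<in> f ` B"
    obtain b where b: "b \<in> B" "w = f b" using w by blast
    have "f (\<Sum>v\<in>B. of_int (c (f v)) *\<^sub>R v) = f 0" using c linear_0[OF f(1)] unfolding comb by simp
    then have "(\<Sum>v\<in>B. of_int (c (f v)) *\<^sub>R v) = 0" by (rule injD[OF f(2)])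
    then have "\<forall>v\<in>B. c (f v) = 0" by (rule ind)
    then show "c w = 0" using b by simp
  next
    fix x :: "real^'n" assume "x \<in> int_lattice"
    then obtain y where y: "y \<in> int_lattice" "x = f y" using f(3) by blast
    obtain c :: "real^'n \<Rightarrow> int" where c: "y = (\<Sum>v\<in>B. of_int (c v) *\<^sub>R v)"
      using B y unfolding is_lattice_basis_def by blast
    have "(\<Sum>v\<in>f ` B. of_int (c (inv f v)) *\<^sub>R v) = f y"
      unfolding comb c using f(2) by simp
    then show "\<exists>c :: real^'n \<Rightarrow> int. x = (\<Sum>v\<in>f ` B. of_int (c v) *\<^sub>R v)"
      using y(2) by (intro exI[of _ "\<lambda>v. c (inv f v)"]) simp
  qed (use fin sub f(3) in auto)
qed

context realization
begin

text \<open>A polytope equivalent to \<open>P\<close> is again built from a solution of the same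
  relations, so it has no I-neighbour either.\<close>

lemma no_I_step_equivalent:
  assumes Q: "smooth_fano Q" and R: "smooth_fano R" "unimodularly_equivalent P R"
  shows "\<not> I_step Q R"
proof -
  obtain f where f: "linear f" "bij f" "f ` int_lattice = int_lattice" "f ` P = R"
    by (rule unimodular_equivalence_linear[OF smooth_fano_P R]) (rule that)
  have inj: "inj f" using f(2) by (simp add: bij_is_inj)
  interpret im: realization a b k l al "\<lambda>s. f (pt s)"
  proof unfold_locales
    note lin = linear_sum[OF f(1), symmetric] linear_neg[OF f(1), symmetric] linear_diff[OF f(1), symmetric]
      linear_cmul[OF f(1), symmetric]
    show "rel (\<lambda>s. f (pt s))" using rel_pt by (simp add: rel_def lin)
    show "inj_on (\<lambda>s. f (pt s)) base"
      using comp_inj_on[OF inj_base inj_on_subset[OF inj]] by (simp add: comp_def)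
    show "is_lattice_basis ((\<lambda>s. f (pt s)) ` base)"
      using lattice_basis_image[OF f(1) inj f(3) basis] by (simp add: image_image)
  qed
  have "im.P = R"
    unfolding im.P_def f(4)[symmetric] P_def
    by (simp add: convex_hull_linear_image[OF f(1)] image_image)
  then show ?thesis using im.no_I_step[OF Q] by simp
qed

text \<open>A nonempty sequence of I-steps that ends at a polytope equivalent to \<open>P\<close>
  has a last step, which cannot exist.\<close>

theorem I_isolated_P: "I_isolated P"
  unfolding I_isolated_def
proof (intro conjI allI impI)
  fix P' assume "smooth_fano P' \<and> I_equivalent P' P"
  then obtain m :: nat and R where R: "\<And>i. i \<le> m \<Longrightarrow> smooth_fano (R i)"
    "unimodularly_equivalent P' (R 0)" "unimodularly_equivalent P (R m)"
    "\<And>i. i \<in> {1..m} \<Longrightarrow> I_step (R (i - 1)) (R i)" unfolding I_equivalent_def by metis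
  have "m = 0"
  proof (rule ccontr)
    assume "m \<noteq> 0"
    then have "I_step (R (m - 1)) (R m)" by (intro R(4)) simp
    then show False using no_I_step_equivalent[OF R(1) R(1) R(3)] by simp
  qed
  then show "unimodularly_equivalent P' P"
    using R(2,3) unimodularly_equivalent_trans unimodularly_equivalent_sym by blast
qed (rule smooth_fano_P)

end

lemma I_isolated_imp_F_isolated:
  assumes "I_isolated P"
  shows "F_isolated P"
proof -
  have "I_equivalent P' P" if "F_equivalent P' P" for P'
    using that unfolding F_equivalent_def I_equivalent_def F_step_def by blast
  then show ?thesis using assms by (auto simp: I_isolated_def F_isolated_def)
qed

section \<open>Existence\<close>

context configuration
begin

text \<open>The labels in \<open>base\<close> are sent to the coordinate vectors. The coordinates
  of the other vectors come from extending the coordinate functions on \<open>base\<close> to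
  solutions of the relations.\<close>

lemma realization_exists:
  assumes n: "CARD('n::finite) + 3 + k = card labels"
  obtains pt :: "label \<Rightarrow> real^'n" where "realization a b k l al pt"
proof -
  have "card base = CARD('n)" using card_fac[OF valid_base, of YT] n by (simp add: base_def)
  then obtain e :: "label \<Rightarrow> 'n" where e: "bij_betw e base UNIV"
    using finite_same_card_bij[OF finite_base, of "UNIV :: 'n set"] by auto
  have "\<forall>i. \<exists>g. rel g \<and> (\<forall>s\<in>base. g s = (if e s = i then 1 else 0 :: real))"
  proof
    fix i
    show "\<exists>g. rel g \<and> (\<forall>s\<in>base. g s = (if e s = i then 1 else 0 :: real))"
      using extend_fac[OF valid_base, of YT "\<lambda>s. if e s = i then 1 else 0"] unfolding base_def by metis
  qed
  then obtain g where g: "\<And>i. rel (g i)" "\<And>i s. s \<in> base \<Longrightarrow> g i s = (if e s = i then 1 else 0 :: real)"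
    by metis
  define pt :: "label \<Rightarrow> real^'n" where "pt s = (\<chi> i. g i s)" for s
  have pt_base: "pt s = axis (e s) 1" if "s \<in> base" for s
    using g(2)[OF that] by (auto simp: pt_def axis_def vec_eq_iff)
  have "realization a b k l al pt"
  proof unfold_locales
    show "rel pt" using g(1) by (simp add: rel_def vec_eq_iff pt_def)
    have "inj_on e base" using e by (rule bij_betw_imp_inj_on)
    show "inj_on pt base"
    proof (rule inj_onI)
      fix s s' assume s: "s \<in> base" "s' \<in> base" "pt s = pt s'"
      then have "e s = e s'" using pt_base[of s] pt_base[of s'] by (simp add: axis_eq_axis)
      then show "s = s'" using inj_onD[OF \<open>inj_on e base\<close>] s by blast
    qed
    have "pt ` base = (\<lambda>s. axis (e s) 1) ` base" by (rule image_cong) (simp_all add: pt_base)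
    also have "\<dots> = (\<lambda>i. axis i 1) ` e ` base" by (simp add: image_image)
    also have "e ` base = UNIV" using e by (simp add: bij_betw_def)
    finally have im: "pt ` base = range (\<lambda>i. axis i 1)" .
    show "is_lattice_basis (pt ` base)"
      unfolding im
    proof (rule lattice_basisI)
      show "range (\<lambda>i. axis i (1::real)) \<subseteq> (int_lattice :: (real^'n) set)" using axis_in_int_lattice by blast
      show "card (range (\<lambda>i. axis i (1::real) :: real^'n)) = CARD('n)"
        by (rule card_image) (auto simp: inj_on_def axis_eq_axis)
      show "\<exists>m\<in>int_lattice. m \<bullet> x = 1 \<and> (\<forall>x'\<in>range (\<lambda>i. axis i 1). x' \<noteq> x \<longrightarrow> m \<bullet> x' = 0)"
        if "x \<in> range (\<lambda>i. axis i 1)" for x :: "real^'n"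
        using that axis_in_int_lattice by (intro bexI[of _ x]) (auto simp: inner_axis_axis)
    qed simp
  qed
  then show thesis by (rule that)
qed

end

text \<open>There are \<open>2 b\<close> labels \<open>y\<^sub>i\<close> and
  \<open>u\<^sub>i\<close> and at least as many places on the right-hand sides.\<close>

lemma obtain_right_hand_sides:
  fixes b k :: nat
  assumes b: "b \<ge> 1" and le: "2 * b \<le> (\<Sum>j=1..k. l j)"
  obtains al where "{al i j | i j. i \<in> {1..l j} \<and> j \<in> {1..k}} = Ly ` {1..b} \<union> Lu ` {1..b}"
proof -
  let ?T = "Ly ` {1..b} \<union> Lu ` {1..b}" and ?S = "SIGMA j:{1..k}. {1..l j}"
  have "card ?T = card (Ly ` {1..b}) + card (Lu ` {1..b})" by (rule card_Un_disjoint) auto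
  then have "card ?T = 2 * b" by (simp add: card_image inj_on_def)
  then have "card ?T \<le> card ?S" using le by simp
  then obtain h where h: "h ` ?T \<subseteq> ?S" "inj_on h ?T"
    using card_le_inj[of ?T ?S] by auto
  define al where "al i j = (if (j, i) \<in> h ` ?T then inv_into ?T h (j, i) else Ly 1)" for i j
  have "al i j \<in> ?T" for i j
    unfolding al_def using b inv_into_into[of _ h ?T] by auto
  moreover have "\<exists>i j. s = al i j \<and> i \<in> {1..l j} \<and> j \<in> {1..k}" if s: "s \<in> ?T" for s
  proof -
    obtain j i where hs: "h s = (j, i)" by fastforce
    have "(j, i) \<in> h ` ?T" using s hs by (metis imageI)
    then have "(j, i) \<in> ?S" using h(1) by blast
    moreover have "al i j = s"
      using \<open>(j, i) \<in> h ` ?T\<close> inv_into_f_f[OF h(2) s] hs by (simp add: al_def)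
    ultimately show ?thesis by auto
  qed
  ultimately have "{al i j | i j. i \<in> {1..l j} \<and> j \<in> {1..k}} = ?T" by blast
  then show thesis by (rule that)
qed

theorem theorem4p3:
  fixes a b k :: nat and l :: "nat \<Rightarrow> nat"
  assumes "a \<ge> 2" and "b \<ge> 1" and "k \<ge> 1" and "\<And>j. j \<in> {1..k} \<Longrightarrow> l j \<ge> 1"
    and "2 * b \<le> (\<Sum>j=1..k. l j)"
    and "CARD('n::finite) = a + 2 * b - 1 + (\<Sum>j=1..k. l j)"
  shows "\<exists>P :: (real ^ 'n) set.
    smooth_fano P \<and> I_isolated P \<and> F_isolated P \<and>
    card (vertices P) = CARD('n) + k + 3 \<and>
    (\<exists>(v :: nat \<Rightarrow> real ^ 'n) (y :: nat \<Rightarrow> real ^ 'n) (z :: real ^ 'n) (t :: real ^ 'n)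
        (u :: nat \<Rightarrow> real ^ 'n) (w :: nat \<Rightarrow> nat \<Rightarrow> real ^ 'n) (\<alpha> :: nat \<Rightarrow> nat \<Rightarrow> real ^ 'n).
      vertices P = v ` {1..a} \<union> y ` {1..b} \<union> {z, t} \<union> u ` {1..b}
                     \<union> (\<Union>j\<in>{1..k}. (\<lambda>i. w i j) ` {1..l j + 1}) \<and>
      {\<alpha> i j | i j. i \<in> {1..l j} \<and> j \<in> {1..k}} = y ` {1..b} \<union> u ` {1..b} \<and>
      primitive_relations P =
        {(v ` {1..a} \<union> y ` {1..b}, replicate_mset (a + b - 1) t),
         (y ` {1..b} \<union> {z}, image_mset u (mset_set {1..b})),
         ({z, t}, {#}),
         ({t} \<union> u ` {1..b}, image_mset y (mset_set {1..b})),
         (u ` {1..b} \<union> v ` {1..a}, replicate_mset (a + b - 2) t)}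
        \<union> {((\<lambda>i. w i j) ` {1..l j + 1}, image_mset (\<lambda>i. \<alpha> i j) (mset_set {1..l j})) | j. j \<in> {1..k}})"
proof -
  obtain al where al: "{al i j | i j. i \<in> {1..l j} \<and> j \<in> {1..k}} = Ly ` {1..b} \<union> Lu ` {1..b}"
    by (rule obtain_right_hand_sides[OF assms(2,5)])
  interpret configuration a b k l al by unfold_locales (use assms al in auto)
  have "CARD('n) + 3 + k = card labels" using assms(1,2,6) by (simp add: card_labels)
  then obtain pt :: "label \<Rightarrow> real^'n" where "realization a b k l al pt"
    by (rule realization_exists)
  then interpret realization a b k l al pt .
  have "{pt (al i j) | i j. i \<in> {1..l j} \<and> j \<in> {1..k}} = pt ` {al i j | i j. i \<in> {1..l j} \<and> j \<in> {1..k}}"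
    by blast
  also have "\<dots> = (\<lambda>i. pt (Ly i)) ` {1..b} \<union> (\<lambda>i. pt (Lu i)) ` {1..b}"
    unfolding al by (simp only: image_Un image_image)
  finally have alpha: "{pt (al i j) | i j. i \<in> {1..l j} \<and> j \<in> {1..k}}
    = (\<lambda>i. pt (Ly i)) ` {1..b} \<union> (\<lambda>i. pt (Lu i)) ` {1..b}" .
  have vert: "vertices P = (\<lambda>i. pt (Lv i)) ` {1..a} \<union> (\<lambda>i. pt (Ly i)) ` {1..b} \<union> {pt Lz, pt Lt}
      \<union> (\<lambda>i. pt (Lu i)) ` {1..b} \<union> (\<Union>j\<in>{1..k}. (\<lambda>i. pt (Lw i j)) ` {1..l j + 1})"
    unfolding vertices_P labels_def by (simp only: image_Un image_image image_UN image_insert image_empty)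
  have prim: "primitive_relations P =
        {((\<lambda>i. pt (Lv i)) ` {1..a} \<union> (\<lambda>i. pt (Ly i)) ` {1..b}, replicate_mset (a + b - 1) (pt Lt)),
         ((\<lambda>i. pt (Ly i)) ` {1..b} \<union> {pt Lz}, image_mset (\<lambda>i. pt (Lu i)) (mset_set {1..b})),
         ({pt Lz, pt Lt}, {#}),
         ({pt Lt} \<union> (\<lambda>i. pt (Lu i)) ` {1..b}, image_mset (\<lambda>i. pt (Ly i)) (mset_set {1..b})),
         ((\<lambda>i. pt (Lu i)) ` {1..b} \<union> (\<lambda>i. pt (Lv i)) ` {1..a}, replicate_mset (a + b - 2) (pt Lt))}
        \<union> {((\<lambda>i. pt (Lw i j)) ` {1..l j + 1}, image_mset (\<lambda>i. pt (al i j)) (mset_set {1..l j})) | j. j \<in> {1..k}}"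
    unfolding primitive_relations_P label_rels_def wprim_def Setcompr_eq_image Collect_mem_eq
    by (simp only: image_Un image_insert image_image image_empty prod.case multiset.map_comp comp_def
        image_replicate_mset image_mset_empty)
  show ?thesis
    by (intro exI[of _ P] conjI smooth_fano_P I_isolated_P I_isolated_imp_F_isolated card_vertices_P
        exI[of _ "\<lambda>i. pt (Lv i)"] exI[of _ "\<lambda>i. pt (Ly i)"] exI[of _ "pt Lz"] exI[of _ "pt Lt"]
        exI[of _ "\<lambda>i. pt (Lu i)"] exI[of _ "\<lambda>i j. pt (Lw i j)"] exI[of _ "\<lambda>i j. pt (al i j)"]
        vert alpha prim)
qed

end
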